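(* Let $n \ge 3$ be an integer and let $p, q$ be real numbers with $p \geq 0$, $p + q > 1$, $0 \leq q \leq \frac{1}{n-1}$ and $$p(n-2) + q(n-1) < n + \frac{2-q}{1-q}.$$ Then every positive solution $v$ of $$-\Delta v = v^p |\nabla v|^q \quad \text{in } \mathbb{R}^n$$ is constant.
   Context: A positive solution is a classical ($C^2$) function $v:\mathbb{R}^n\to(0,\infty)$ satisfying the equation at every point of $\mathbb{R}^n$. When $q=0$ the factor $|\nabla v|^q$ is understood to be identically $1$, so the equation reads $-\Delta v = v^p$. *)

theory Defs
  imports "HOL-Analysis.Analysis"
begin

definition partial_deriv :: "'n::finite \<Rightarrow> (real ^ 'n \<Rightarrow> real) \<Rightarrow> real ^ 'n \<Rightarrow> real" where
  "partial_deriv i f x = frechet_derivative f (at x) (axis i 1)"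

(* Differentiability is required alongside continuity of the partial derivatives because
   frechet_derivative has an arbitrary value where f is not differentiable. *)
definition C1 :: "(real ^ 'n::finite \<Rightarrow> real) \<Rightarrow> bool" where
  "C1 f \<longleftrightarrow> f differentiable_on UNIV \<and> (\<forall>i. continuous_on UNIV (partial_deriv i f))"

definition C2 :: "(real ^ 'n::finite \<Rightarrow> real) \<Rightarrow> bool" where
  "C2 f \<longleftrightarrow> C1 f \<and> (\<forall>i. C1 (partial_deriv i f))"

definition grad :: "(real ^ 'n::finite \<Rightarrow> real) \<Rightarrow> real ^ 'n \<Rightarrow> real ^ 'n" where
  "grad f x = (\<chi> i. partial_deriv i f x)"

definition laplacian :: "(real ^ 'n::finite \<Rightarrow> real) \<Rightarrow> real ^ 'n \<Rightarrow> real" where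
  "laplacian f x = (\<Sum>i\<in>UNIV. partial_deriv i (partial_deriv i f) x)"

(* The equation reads |grad v|^0 as 1 even at critical points of v, whereas 0 powr 0 = 0. *)
definition norm_powr :: "'a::real_normed_vector \<Rightarrow> real \<Rightarrow> real" where
  "norm_powr w q = (if q = 0 then 1 else norm w powr q)"

definition positive_solution :: "real \<Rightarrow> real \<Rightarrow> (real ^ 'n::finite \<Rightarrow> real) \<Rightarrow> bool" where
  "positive_solution p q v \<longleftrightarrow>
     C2 v \<and> (\<forall>x. v x > 0) \<and>
     (\<forall>x. - laplacian v x = v x powr p * norm_powr (grad v x) q)"

end

(* Put N = n - 1 and u = v powr (-1 / (n - 2)), so that
   Delta u = N |Du|^2 / u + F with F = c u^E |Du|^q and c > 0.  In terms of u the divergence of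
   u^(2 - 2N) |Du|^b (D^2u Du - F Du) contains no |Du|^4 term, and adding multiples of the divergences
   of u^(2 - 2N) |Du|^b F Du and (a small one) u^(1 - 2N) |Du|^(b + 2) Du yields a quadratic form in the
   entries of D^2u, F and |Du|^2 / u.  For suitable b it is positive definite in the subcritical range;
   at the critical exponents it degenerates on the explicit radial solutions.  Cutting off on a ball of
   radius R and applying Young's inequality bounds the integral of the form by a negative power of R,
   hence Du = 0.
   For q > 0 the exponent b is negative, so |Du|^b is singular at critical points.  It is replaced by
   (m + epsilon)^(2b) with m = (|Du|^2 + delta)^(1/4), delta much smaller than epsilon; with the
   fourth root the regularisation varies so slowly with |Du| that the form stays positive definite.
   Since v is only C^2, Bochner's identity is used in integrated form. *)
theory Submission
  imports Defs
begin

section \<open>Continuously differentiable functions and integration by parts\<close>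

text \<open>With K = |Du|^2 / u the equation reads Delta u = N K + F, so the three divergences add
  up to that of u^(2 - 2N) psi (D^2u Du - r Theta F Du - eta K Du), where psi is the regularised
  weight and r, eta are free. Let h be the second derivative of u along Du. The coefficient of K^2
  is then eta (N - 1), so a small eta > 0 is what controls K; that of K F is positive for small eta
  (at Theta = 1) if (N - 2 - E) (1 - r) < N; the block in (h, F) needs a discriminant condition on b
  and r. At the limiting b and r, the K F condition follows from E (1 - q) + 3 - 2q > 0, which is
  the subcritical hypothesis multiplied by 1 - q; the decay in R follows from the same inequality
  and p + q > 1. The obstacle is the regularisation: near critical points the effective exponent is
  b Theta with Theta < 1, and an r fitted to b may make the form indefinite. Hence r is multiplied
  by Theta too; up to an error, the form is then a convex combination of the forms for b = r = 0 and
  for the chosen b and r.\<close>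

definition has_grad :: "(real ^ 'n::finite \<Rightarrow> real) \<Rightarrow> (real ^ 'n \<Rightarrow> real ^ 'n) \<Rightarrow> bool" where
  "has_grad f g \<longleftrightarrow> (\<forall>x. (f has_derivative (\<lambda>h. g x \<bullet> h)) (at x)) \<and> continuous_on UNIV g"

lemma has_gradI:
  assumes "\<And>x. (f has_derivative (\<lambda>h. g x \<bullet> h)) (at x)" "continuous_on UNIV g"
  shows "has_grad f g"
  using assms by (simp add: has_grad_def)

lemma has_grad_deriv: "has_grad f g \<Longrightarrow> (f has_derivative (\<lambda>h. g x \<bullet> h)) (at x)"
  by (simp add: has_grad_def)

lemma has_grad_continuous_grad: "has_grad f g \<Longrightarrow> continuous_on S g"
  by (auto simp: has_grad_def intro: continuous_on_subset)

lemma has_grad_continuous: "has_grad f g \<Longrightarrow> continuous_on S f"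
  by (meson has_derivative_continuous has_grad_deriv continuous_at_imp_continuous_on)

lemma has_grad_const: "has_grad (\<lambda>x. c) (\<lambda>x. 0)"
  by (rule has_gradI) auto

lemma has_grad_mult:
  assumes "has_grad f f'" "has_grad g g'"
  shows "has_grad (\<lambda>x. f x * g x) (\<lambda>x. g x *\<^sub>R f' x + f x *\<^sub>R g' x)"
proof (rule has_gradI)
  show "((\<lambda>x. f x * g x) has_derivative (\<lambda>h. (g x *\<^sub>R f' x + f x *\<^sub>R g' x) \<bullet> h)) (at x)" for x
    by (rule derivative_eq_intros has_grad_deriv[OF assms(1)] has_grad_deriv[OF assms(2)])+
      (auto simp: algebra_simps)
  show "continuous_on UNIV (\<lambda>x. g x *\<^sub>R f' x + f x *\<^sub>R g' x)"
    using assms by (intro continuous_intros has_grad_continuous[OF assms(1)] has_grad_continuous[OF assms(2)]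
        has_grad_continuous_grad[OF assms(1)] has_grad_continuous_grad[OF assms(2)])
qed

lemma has_grad_add:
  assumes "has_grad f f'" "has_grad g g'"
  shows "has_grad (\<lambda>x. f x + g x) (\<lambda>x. f' x + g' x)"
proof (rule has_gradI)
  show "((\<lambda>x. f x + g x) has_derivative (\<lambda>h. (f' x + g' x) \<bullet> h)) (at x)" for x
    by (rule derivative_eq_intros has_grad_deriv[OF assms(1)] has_grad_deriv[OF assms(2)])+
      (auto simp: algebra_simps)
  show "continuous_on UNIV (\<lambda>x. f' x + g' x)"
    by (intro continuous_intros has_grad_continuous_grad[OF assms(1)] has_grad_continuous_grad[OF assms(2)])
qed

lemma has_grad_cmult:
  assumes "has_grad f f'"
  shows "has_grad (\<lambda>x. c * f x) (\<lambda>x. c *\<^sub>R f' x)"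
  using has_grad_mult[OF has_grad_const[of c] assms] by simp

lemma has_grad_sum:
  assumes "finite I" "\<And>i. i \<in> I \<Longrightarrow> has_grad (f i) (f' i)"
  shows "has_grad (\<lambda>x. \<Sum>i\<in>I. f i x) (\<lambda>x. \<Sum>i\<in>I. f' i x)"
  using assms by (induction I rule: finite_induct) (auto intro: has_grad_const has_grad_add)

lemma has_grad_compose:
  assumes "has_grad f f'"
    and "\<And>x. (\<phi> has_real_derivative \<phi>' (f x)) (at (f x))" "continuous_on UNIV (\<lambda>x. \<phi>' (f x))"
  shows "has_grad (\<lambda>x. \<phi> (f x)) (\<lambda>x. \<phi>' (f x) *\<^sub>R f' x)"
proof (rule has_gradI)
  show "((\<lambda>x. \<phi> (f x)) has_derivative (\<lambda>h. (\<phi>' (f x) *\<^sub>R f' x) \<bullet> h)) (at x)" for x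
    using has_derivative_compose[OF has_grad_deriv[OF assms(1), of x] assms(2)[of x, unfolded has_field_derivative_def]]
    by simp
  show "continuous_on UNIV (\<lambda>x. \<phi>' (f x) *\<^sub>R f' x)"
    by (intro continuous_intros assms has_grad_continuous_grad[OF assms(1)])
qed

lemma has_grad_powr:
  assumes "has_grad f f'" "\<And>x. f x > 0"
  shows "has_grad (\<lambda>x. f x powr a) (\<lambda>x. (a * f x powr (a - 1)) *\<^sub>R f' x)"
proof (rule has_grad_compose[OF assms(1)])
  show "((\<lambda>s. s powr a) has_real_derivative a * f x powr (a - 1)) (at (f x))" for x
    by (rule has_real_derivative_powr[OF assms(2)])
  show "continuous_on UNIV (\<lambda>x. a * f x powr (a - 1))"
    using assms(2) by (intro continuous_intros has_grad_continuous[OF assms(1)]) (auto simp: less_imp_neq[symmetric])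
qed

lemma has_grad_shift:
  assumes "has_grad f f'"
  shows "has_grad (\<lambda>x. f (x + c)) (\<lambda>x. f' (x + c))"
proof (rule has_gradI)
  show "((\<lambda>x. f (x + c)) has_derivative (\<lambda>h. f' (x + c) \<bullet> h)) (at x)" for x
  proof -
    have "((\<lambda>x. x + c) has_derivative (\<lambda>h. h)) (at x)"
      by (auto intro!: derivative_eq_intros)
    from has_derivative_compose[OF this has_grad_deriv[OF assms]] show ?thesis .
  qed
  show "continuous_on UNIV (\<lambda>x. f' (x + c))"
    by (rule continuous_on_compose2[OF has_grad_continuous_grad[OF assms, of UNIV]]) (auto intro!: continuous_intros)
qed

lemma has_grad_eq_zero:
  assumes "has_grad f f'" "open S" "\<And>y. y \<in> S \<Longrightarrow> f y = 0" "x \<in> S"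
  shows "f' x = 0"
proof -
  have "((\<lambda>_. 0) has_derivative (\<lambda>h. f' x \<bullet> h)) (at x)"
    by (rule has_derivative_transform_within_open[OF has_grad_deriv[OF assms(1)] assms(2,4)])
      (use assms in auto)
  then have "(\<lambda>h. f' x \<bullet> h) = (\<lambda>h. 0)"
    by (rule has_derivative_unique) simp
  then show ?thesis by (metis inner_eq_zero_iff)
qed

lemma has_grad_eq_zero_outside:
  assumes "has_grad f f'" "\<And>y. norm y > R \<Longrightarrow> f y = 0" "norm x > R"
  shows "f' x = 0"
  by (rule has_grad_eq_zero[OF assms(1), of "{y. norm y > R}"])
    (use assms in \<open>auto intro!: open_Collect_less continuous_intros\<close>)

text \<open>Bridge from partial derivatives to \<open>has_grad\<close>, where the gradient is an
  explicit function: a linear map is determined by its values on the coordinate axes.\<close>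

lemma has_grad_of_C1:
  assumes "C1 f"
  shows "has_grad f (grad f)"
proof (rule has_gradI)
  fix x
  have d: "f differentiable (at x)"
    using assms by (auto simp: C1_def differentiable_on_def)
  then have D: "(f has_derivative frechet_derivative f (at x)) (at x)"
    by (simp add: frechet_derivative_works)
  then have lin: "linear (frechet_derivative f (at x))"
    by (rule has_derivative_linear)
  have "frechet_derivative f (at x) h = grad f x \<bullet> h" for h
  proof -
    have "h = (\<Sum>i\<in>UNIV. h $ i *\<^sub>R axis i 1)"
      by (simp add: basis_expansion[of h, folded scalar_mult_eq_scaleR] flip: scalar_mult_eq_scaleR)
    then have "frechet_derivative f (at x) h = frechet_derivative f (at x) (\<Sum>i\<in>UNIV. h $ i *\<^sub>R axis i 1)"
      by (rule arg_cong)
    also have "\<dots> = (\<Sum>i\<in>UNIV. h $ i *\<^sub>R frechet_derivative f (at x) (axis i 1))"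
      by (simp add: linear_sum[OF lin] linear_cmul[OF lin])
    finally show ?thesis
      by (simp add: grad_def partial_deriv_def inner_vec_def mult.commute)
  qed
  then show "(f has_derivative (\<lambda>h. grad f x \<bullet> h)) (at x)"
    using D by presburger
next
  show "continuous_on UNIV (grad f)"
    using assms unfolding grad_def C1_def
    by (auto intro!: continuous_on_vec_lambda)
qed

lemma integrable_continuous_compact_support:
  fixes f :: "real ^ 'n::finite \<Rightarrow> real"
  assumes "continuous_on UNIV f" "\<And>x. norm x > R \<Longrightarrow> f x = 0"
  shows "integrable lborel f"
proof -
  have "integrable lborel (\<lambda>x. indicator (cball 0 R) x *\<^sub>R f x)"
    by (rule borel_integrable_compact) (auto intro: continuous_on_subset[OF assms(1)])
  also have "(\<lambda>x. indicator (cball 0 R) x *\<^sub>R f x) = f"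
    using assms(2) by (auto simp: indicator_def fun_eq_iff not_le[symmetric])
  finally show ?thesis .
qed

lemma lborel_integral_shift:
  fixes f :: "'a::euclidean_space \<Rightarrow> real"
  assumes "f \<in> borel_measurable borel"
  shows "(LINT x|lborel. f (x + c)) = (LINT x|lborel. f x)"
proof -
  have "(LINT x|lborel. f x) = (LINT x|distr lborel borel ((+) c). f x)"
    by (simp add: lborel_distr_plus)
  also have "\<dots> = (LINT x|lborel. f (c + x))"
    by (rule integral_distr) (use assms in auto)
  finally show ?thesis by (simp add: add.commute)
qed

text \<open>Dominated convergence; the mean value inequality on the ball of radius
  \<open>R + 1\<close> bounds the quotients. Only the product in \<open>supp\<close> has to vanish
  far out, so either \<open>k\<close> or \<open>f\<close> may be the compactly supported factor;
  \<open>integral_grad_swap\<close> needs both cases.\<close>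

lemma difference_quotient_tendsto:
  fixes f k :: "real ^ 'n::finite \<Rightarrow> real" and h :: "nat \<Rightarrow> real"
  assumes f: "has_grad f f'" and k: "continuous_on UNIV k"
    and supp: "\<And>x s. norm x > R \<Longrightarrow> \<bar>s\<bar> \<le> 1 \<Longrightarrow> k x * (f (x + s *\<^sub>R d) - f x) = 0"
    and d: "norm d \<le> 1" and h: "h \<longlonglongrightarrow> 0" "\<And>j. h j \<noteq> 0" "\<And>j. \<bar>h j\<bar> \<le> 1"
  shows "(\<lambda>j. LINT x|lborel. k x * ((f (x + h j *\<^sub>R d) - f x) / h j))
           \<longlonglongrightarrow> (LINT x|lborel. k x * (f' x \<bullet> d))"
proof -
  have cf: "continuous_on UNIV f" by (rule has_grad_continuous[OF f])
  have "bounded (f' ` cball 0 (R + 1))"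
    by (intro compact_imp_bounded compact_continuous_image has_grad_continuous_grad[OF f]) auto
  then obtain L where L: "\<forall>x\<in>cball 0 (R + 1). norm (f' x) \<le> L"
    by (auto simp: bounded_iff)
  have "bounded (k ` cball 0 R)"
    by (intro compact_imp_bounded compact_continuous_image continuous_on_subset[OF k]) auto
  then obtain M where M: "\<forall>x\<in>cball 0 R. \<bar>k x\<bar> \<le> M"
    by (auto simp: bounded_iff)
  have meas: "(\<lambda>x. k x * ((f (x + c) - f x) / s)) \<in> borel_measurable borel" for c s
  proof -
    have "continuous_on UNIV (\<lambda>x. f (x + c))"
      by (rule continuous_on_compose2[OF cf]) (auto intro!: continuous_intros)
    then have "(\<lambda>x. f (x + c)) \<in> borel_measurable borel" "f \<in> borel_measurable borel"
      "k \<in> borel_measurable borel"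
      using cf k by (auto intro: borel_measurable_continuous_onI)
    then show ?thesis by measurable
  qed
  show ?thesis
  proof (rule integral_dominated_convergence[where w = "\<lambda>x. indicator (cball 0 R) x *\<^sub>R (\<bar>M\<bar> * \<bar>L\<bar>)"])
    show "(\<lambda>x. k x * (f' x \<bullet> d)) \<in> borel_measurable lborel"
      using k has_grad_continuous_grad[OF f, of UNIV]
      by (auto intro!: borel_measurable_continuous_onI continuous_intros)
    show "integrable lborel (\<lambda>x. indicator (cball 0 R) x *\<^sub>R (\<bar>M\<bar> * \<bar>L\<bar>))"
      by (rule borel_integrable_compact) auto
    show "AE x in lborel. (\<lambda>j. k x * ((f (x + h j *\<^sub>R d) - f x) / h j)) \<longlonglongrightarrow> k x * (f' x \<bullet> d)"
    proof (rule AE_I2, rule tendsto_mult[OF tendsto_const])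
      fix x
      have "((\<lambda>s. x + s *\<^sub>R d) has_derivative (\<lambda>s. s *\<^sub>R d)) (at 0)"
        by (auto intro!: derivative_eq_intros)
      then have "((\<lambda>s. f (x + s *\<^sub>R d)) has_derivative (\<lambda>s. f' (x + 0 *\<^sub>R d) \<bullet> (s *\<^sub>R d))) (at 0)"
        by (rule has_derivative_compose[OF _ has_grad_deriv[OF f]])
      then have "((\<lambda>s. f (x + s *\<^sub>R d)) has_real_derivative f' x \<bullet> d) (at 0)"
        by (simp add: has_field_derivative_def mult_commute_abs)
      then have "((\<lambda>s. (f (x + s *\<^sub>R d) - f x) / s) \<longlongrightarrow> f' x \<bullet> d) (at 0)"
        by (simp add: has_field_derivative_iff)
      moreover have "filterlim h (at 0) sequentially"
        using h by (auto simp: filterlim_at)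
      ultimately show "(\<lambda>j. (f (x + h j *\<^sub>R d) - f x) / h j) \<longlonglongrightarrow> f' x \<bullet> d"
        by (rule filterlim_compose)
    qed
    show "AE x in lborel. norm (k x * ((f (x + h j *\<^sub>R d) - f x) / h j)) \<le> indicator (cball 0 R) x *\<^sub>R (\<bar>M\<bar> * \<bar>L\<bar>)" for j
    proof (rule AE_I2)
      fix x :: "real ^ 'n"
      show "norm (k x * ((f (x + h j *\<^sub>R d) - f x) / h j)) \<le> indicator (cball 0 R) x *\<^sub>R (\<bar>M\<bar> * \<bar>L\<bar>)"
      proof (cases "norm x \<le> R")
        case False
        then show ?thesis using supp[of x "h j"] h(3)[of j] by auto
      next
        case True
        have "norm (f (x + h j *\<^sub>R d) - f x) \<le> \<bar>L\<bar> * norm (x + h j *\<^sub>R d - x)"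
        proof (rule differentiable_bound[of "cball 0 (R+1)" f "\<lambda>x h. f' x \<bullet> h"])
          fix y :: "real ^ 'n" assume y: "y \<in> cball 0 (R+1)"
          show "(f has_derivative (\<lambda>h. f' y \<bullet> h)) (at y within cball 0 (R+1))"
            by (rule has_derivative_at_withinI[OF has_grad_deriv[OF f]])
          show "onorm (\<lambda>h. f' y \<bullet> h) \<le> \<bar>L\<bar>"
          proof (rule onorm_le)
            fix z
            have "norm (f' y \<bullet> z) \<le> norm (f' y) * norm z"
              using Cauchy_Schwarz_ineq2 by auto
            also have "\<dots> \<le> \<bar>L\<bar> * norm z"
              using L y by (intro mult_right_mono) force+
            finally show "norm (f' y \<bullet> z) \<le> \<bar>L\<bar> * norm z" .
          qed
        next
          have "norm (x + h j *\<^sub>R d) \<le> norm x + \<bar>h j\<bar> * norm d"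
            by (metis norm_scaleR norm_triangle_ineq)
          also have "\<dots> \<le> R + 1"
            using True h(3)[of j] d by (intro add_mono mult_le_one) auto
          finally show "x + h j *\<^sub>R d \<in> cball 0 (R+1)" by simp
        qed (use True in auto)
        also have "\<dots> \<le> \<bar>L\<bar> * \<bar>h j\<bar>"
          using d by (auto intro!: mult_left_mono mult_left_le)
        finally have "\<bar>(f (x + h j *\<^sub>R d) - f x) / h j\<bar> \<le> \<bar>L\<bar>"
          using h(2)[of j] by (simp add: field_simps)
        moreover have "\<bar>k x\<bar> \<le> \<bar>M\<bar>" using M True by force
        ultimately have "\<bar>k x\<bar> * \<bar>(f (x + h j *\<^sub>R d) - f x) / h j\<bar> \<le> \<bar>M\<bar> * \<bar>L\<bar>"
          by (intro mult_mono) auto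
        then show ?thesis
          using True by (simp only: abs_mult real_norm_def) simp
      qed
    qed
  qed (use meas in auto)
qed

text \<open>By translation invariance of Lebesgue measure every difference quotient of
  \<open>f\<close> integrates to zero; then let the step size tend to zero.\<close>

lemma integral_grad_zero:
  assumes f: "has_grad f f'" and supp: "\<And>x. norm x > R \<Longrightarrow> f x = 0" and d: "norm d \<le> 1"
  shows "(LINT x|lborel. f' x \<bullet> d) = 0"
proof -
  define h where "h = (\<lambda>j::nat. 1 / real (Suc j))"
  have h: "h \<longlonglongrightarrow> 0" "\<And>j. h j \<noteq> 0" "\<And>j. \<bar>h j\<bar> \<le> 1"
    unfolding h_def using LIMSEQ_inverse_real_of_nat by (auto simp: inverse_eq_divide)
  have sh: "f (x + s *\<^sub>R d) = 0" if "norm x > R + 1" "\<bar>s\<bar> \<le> 1" for x s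
  proof (rule supp)
    have "norm x \<le> norm (x + s *\<^sub>R d) + \<bar>s\<bar> * norm d"
      by (metis add_diff_cancel_right' norm_scaleR norm_triangle_ineq4)
    moreover have "\<bar>s\<bar> * norm d \<le> 1" using that d by (intro mult_le_one) auto
    ultimately show "norm (x + s *\<^sub>R d) > R" using that by linarith
  qed
  have cf: "continuous_on UNIV f" by (rule has_grad_continuous[OF f])
  have "(\<lambda>j::nat. LINT x|lborel. 1 * ((f (x + h j *\<^sub>R d) - f x) / h j)) \<longlonglongrightarrow> (LINT x|lborel. 1 * (f' x \<bullet> d))"
    by (rule difference_quotient_tendsto[OF f _ _ d h, where R = "R + 1"]) (use sh supp in auto)
  moreover have "(LINT x|lborel. 1 * ((f (x + h j *\<^sub>R d) - f x) / h j)) = 0" for j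
  proof -
    have "integrable lborel (\<lambda>x. f (x + h j *\<^sub>R d))"
      by (rule integrable_continuous_compact_support[where R = "R + 1"])
        (use sh h in \<open>auto intro!: continuous_on_compose2[OF cf] continuous_intros\<close>)
    moreover have "integrable lborel f"
      by (rule integrable_continuous_compact_support[OF cf supp])
    ultimately have "(LINT x|lborel. (f (x + h j *\<^sub>R d) - f x) / h j)
        = ((LINT x|lborel. f (x + h j *\<^sub>R d)) - (LINT x|lborel. f x)) / h j"
      by (simp add: Bochner_Integration.integral_diff)
    also have "\<dots> = 0"
      using lborel_integral_shift[of f "h j *\<^sub>R d"] cf by (simp add: borel_measurable_continuous_onI)
    finally show ?thesis by simp
  qed
  ultimately have "(\<lambda>j::nat. 0) \<longlonglongrightarrow> (LINT x|lborel. 1 * (f' x \<bullet> d))"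
    by (simp only:)
  then show ?thesis by (simp add: LIMSEQ_const_iff)
qed

text \<open>For \<open>f\<close> twice differentiable both sides equal \<open>- \<integral> k \<partial>\<^sub>d \<partial>\<^sub>d' f\<close>; for \<open>f\<close> merely \<open>C\<^sup>1\<close> a
  difference quotient of \<open>f\<close> takes the place of one of the derivatives.\<close>

lemma integral_grad_swap:
  assumes k: "has_grad k k'" and supp: "\<And>x. norm x > R \<Longrightarrow> k x = 0" and f: "has_grad f f'"
    and d: "norm d \<le> 1" and e: "norm e \<le> 1"
  shows "(LINT x|lborel. (k' x \<bullet> d) * (f' x \<bullet> e)) = (LINT x|lborel. (k' x \<bullet> e) * (f' x \<bullet> d))"
proof -
  define h where "h = (\<lambda>j::nat. 1 / real (Suc j))"
  have h: "h \<longlonglongrightarrow> 0" "\<And>j. h j \<noteq> 0" "\<And>j. \<bar>h j\<bar> \<le> 1"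
    unfolding h_def using LIMSEQ_inverse_real_of_nat by (auto simp: inverse_eq_divide)
  have h': "(\<lambda>j. - h j) \<longlonglongrightarrow> 0" "\<And>j. - h j \<noteq> 0" "\<And>j. \<bar>- h j\<bar> \<le> 1"
    using h tendsto_minus[OF h(1)] by auto
  have sh: "k (x + s *\<^sub>R e) = 0" if "norm x > R + 1" "\<bar>s\<bar> \<le> 1" for x s
  proof (rule supp)
    have "norm x \<le> norm (x + s *\<^sub>R e) + \<bar>s\<bar> * norm e"
      by (metis add_diff_cancel_right' norm_scaleR norm_triangle_ineq4)
    moreover have "\<bar>s\<bar> * norm e \<le> 1" using that e by (intro mult_le_one) auto
    ultimately show "norm (x + s *\<^sub>R e) > R" using that by linarith
  qed
  have k'0: "k' x = 0" if "norm x > R" for x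
    by (rule has_grad_eq_zero_outside[OF k supp that])
  have ck: "continuous_on UNIV k" and cf': "continuous_on UNIV f'" and ck': "continuous_on UNIV k'"
    and cf: "continuous_on UNIV f"
    using has_grad_continuous[OF k] has_grad_continuous_grad[OF f] has_grad_continuous_grad[OF k]
      has_grad_continuous[OF f] by auto
  have lim1: "(\<lambda>j. LINT x|lborel. (k' x \<bullet> d) * ((f (x + h j *\<^sub>R e) - f x) / h j))
      \<longlonglongrightarrow> (LINT x|lborel. (k' x \<bullet> d) * (f' x \<bullet> e))"
    by (rule difference_quotient_tendsto[OF f _ _ e h, where R = R])
      (use k'0 ck' in \<open>auto intro!: continuous_intros\<close>)
  have lim2: "(\<lambda>j. LINT x|lborel. (f' x \<bullet> d) * ((k (x + (- h j) *\<^sub>R e) - k x) / (- h j)))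
      \<longlonglongrightarrow> (LINT x|lborel. (f' x \<bullet> d) * (k' x \<bullet> e))"
    by (rule difference_quotient_tendsto[OF k _ _ e h', where R = "R + 1"])
      (use sh supp cf' in \<open>auto intro!: continuous_intros\<close>)
  \<comment> \<open>The difference quotient of \<open>f\<close> is still C^1, so direction
    \<open>d\<close> can be integrated by parts; a translation of the variable then moves the
    quotient from \<open>f\<close> to \<open>k\<close> and reverses the sign of the step.\<close>
  have eq: "(LINT x|lborel. (k' x \<bullet> d) * ((f (x + h j *\<^sub>R e) - f x) / h j))
      = (LINT x|lborel. (f' x \<bullet> d) * ((k (x + (- h j) *\<^sub>R e) - k x) / (- h j)))" for j
  proof -
    let ?c = "h j *\<^sub>R e"
    have cfs: "continuous_on UNIV (\<lambda>x. f (x + ?c))" "continuous_on UNIV (\<lambda>x. f' (x + ?c))"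
      by (auto intro!: continuous_on_compose2[OF cf] continuous_on_compose2[OF cf'] continuous_intros)
    have cks: "continuous_on UNIV (\<lambda>x. k (x - ?c))"
      by (auto intro!: continuous_on_compose2[OF ck] continuous_intros)
    have df: "has_grad (\<lambda>x. (1 / h j) * (f (x + ?c) + (-1) * f x))
                (\<lambda>x. (1 / h j) *\<^sub>R (f' (x + ?c) + (-1) *\<^sub>R f' x))"
      by (intro has_grad_cmult has_grad_add has_grad_shift f)
    have int1: "integrable lborel (\<lambda>x. (k' x \<bullet> d) * ((f (x + ?c) - f x) / h j))"
      by (rule integrable_continuous_compact_support[where R = R])
       (use k'0 ck' cf cfs h in \<open>auto intro!: continuous_intros\<close>)
    have int2: "integrable lborel (\<lambda>x. k x * (f' (x + ?c) \<bullet> d))"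
      by (rule integrable_continuous_compact_support[where R = R])
       (use supp ck cf cfs in \<open>auto intro!: continuous_intros\<close>)
    have int3: "integrable lborel (\<lambda>x. k x * (f' x \<bullet> d))"
      by (rule integrable_continuous_compact_support[where R = R])
       (use supp ck cf' in \<open>auto intro!: continuous_intros\<close>)
    have int4: "integrable lborel (\<lambda>x. k (x - ?c) * (f' x \<bullet> d))"
      by (rule integrable_continuous_compact_support[where R = "R+1"])
       (use sh[of _ "- h j"] h(3)[of j] cks cf' in \<open>auto intro!: continuous_intros\<close>)
    have "0 = (LINT x|lborel. (((1 / h j) * (f (x + ?c) + (-1) * f x)) *\<^sub>R k' x
         + k x *\<^sub>R ((1 / h j) *\<^sub>R (f' (x + ?c) + (-1) *\<^sub>R f' x))) \<bullet> d)"
      by (rule integral_grad_zero[OF has_grad_mult[OF k df] _ d, of R, symmetric]) (use supp in auto)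
    also have "\<dots> = (LINT x|lborel. (k' x \<bullet> d) * ((f (x + ?c) - f x) / h j)
         + (1 / h j) * (k x * (f' (x + ?c) \<bullet> d) - k x * (f' x \<bullet> d)))"
      by (rule Bochner_Integration.integral_cong) (auto simp: field_simps inner_simps diff_divide_distrib)
    also have "\<dots> = (LINT x|lborel. (k' x \<bullet> d) * ((f (x + ?c) - f x) / h j))
         + (1 / h j) * ((LINT x|lborel. k x * (f' (x + ?c) \<bullet> d)) - (LINT x|lborel. k x * (f' x \<bullet> d)))"
      using int1 int2 int3 by (simp add: Bochner_Integration.integral_add Bochner_Integration.integral_diff)
    also have "(LINT x|lborel. k x * (f' (x + ?c) \<bullet> d)) = (LINT x|lborel. k (x - ?c) * (f' x \<bullet> d))"
      using lborel_integral_shift[of "\<lambda>x. k (x - ?c) * (f' x \<bullet> d)" ?c] int4 by simp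
    finally have "(LINT x|lborel. (k' x \<bullet> d) * ((f (x + ?c) - f x) / h j))
       = - (1 / h j) * ((LINT x|lborel. k (x - ?c) * (f' x \<bullet> d)) - (LINT x|lborel. k x * (f' x \<bullet> d)))"
      by (simp add: algebra_simps)
    also have "\<dots> = (LINT x|lborel. - (1 / h j) * (k (x - ?c) * (f' x \<bullet> d) - k x * (f' x \<bullet> d)))"
      using int3 int4 by (simp add: Bochner_Integration.integral_diff)
    also have "\<dots> = (LINT x|lborel. (f' x \<bullet> d) * ((k (x + (- h j) *\<^sub>R e) - k x) / (- h j)))"
      by (rule Bochner_Integration.integral_cong) (use h(2)[of j] in \<open>auto simp: field_simps\<close>)
    finally show ?thesis .
  qed
  have "(LINT x|lborel. (k' x \<bullet> d) * (f' x \<bullet> e)) = (LINT x|lborel. (f' x \<bullet> d) * (k' x \<bullet> e))"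
    by (rule LIMSEQ_unique[OF lim1[unfolded eq] lim2])
  then show ?thesis by (simp add: mult.commute)
qed

section \<open>The integrated Bochner identity\<close>

text \<open>Divergence theorem for the field A B, one component at a time. Keeping the scalar
  \<open>A\<close> apart from \<open>B\<close> allows B = |Du|^q Du later, whose factor |Du|^q alone
  need not be differentiable.\<close>

lemma integral_div_zero:
  fixes A :: "real ^ 'n::finite \<Rightarrow> real" and B :: "real ^ 'n \<Rightarrow> real ^ 'n"
  assumes A: "has_grad A A'" and supp: "\<And>x. norm x > R \<Longrightarrow> A x = 0"
    and B: "\<And>i. has_grad (\<lambda>x. B x $ i) (\<lambda>x. B' x $ i)"
  shows "integrable lborel (\<lambda>x. A' x \<bullet> B x + A x * trace (B' x))"
    and "(LINT x|lborel. A' x \<bullet> B x + A x * trace (B' x)) = 0"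
proof -
  let ?g = "\<lambda>i x. B x $ i *\<^sub>R A' x + A x *\<^sub>R B' x $ i"
  have g: "has_grad (\<lambda>x. A x * B x $ i) (?g i)" for i
    by (rule has_grad_mult[OF A B])
  have supp': "\<And>i x. norm x > R \<Longrightarrow> A x * B x $ i = 0"
    using supp by simp
  have int: "integrable lborel (\<lambda>x. ?g i x \<bullet> axis i 1)" for i
    by (rule integrable_continuous_compact_support[where R = R])
      (use has_grad_eq_zero_outside[OF g supp'] in
        \<open>auto intro!: continuous_intros has_grad_continuous_grad[OF g, of UNIV]
          has_grad_continuous_grad[OF A] has_grad_continuous_grad[OF B] has_grad_continuous[OF A] has_grad_continuous[OF B]\<close>)
  have eq: "(\<lambda>x. A' x \<bullet> B x + A x * trace (B' x)) = (\<lambda>x. \<Sum>i\<in>UNIV. ?g i x \<bullet> axis i 1)"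
    by (auto simp: fun_eq_iff inner_vec_def inner_axis trace_def sum.distrib sum_distrib_left mult.commute
        intro!: arg_cong2[where f = "(+)"])
      (simp add: inner_axis' inner_add_left axis_def if_distrib if_distribR sum.delta sum.distrib mult.commute cong: if_cong)
  show "integrable lborel (\<lambda>x. A' x \<bullet> B x + A x * trace (B' x))"
    unfolding eq using int by (rule Bochner_Integration.integrable_sum)
  have "(LINT x|lborel. (\<Sum>i\<in>UNIV. ?g i x \<bullet> axis i 1)) = (\<Sum>i\<in>UNIV. LINT x|lborel. ?g i x \<bullet> axis i 1)"
    using int by (rule Bochner_Integration.integral_sum)
  also have "\<dots> = 0"
    by (intro sum.neutral ballI integral_grad_zero[OF g supp']) (auto simp: norm_axis_1)
  finally show "(LINT x|lborel. A' x \<bullet> B x + A x * trace (B' x)) = 0"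
    unfolding eq .
qed

lemma continuous_nonneg_integral_zero:
  fixes f :: "real ^ 'n::finite \<Rightarrow> real"
  assumes cont: "continuous_on UNIV f" and int: "integrable lborel f"
    and nonneg: "\<And>x. 0 \<le> f x" and zero: "(LINT x|lborel. f x) \<le> 0"
  shows "f y = 0"
proof (rule ccontr)
  assume "f y \<noteq> 0"
  then have pos: "f y > 0" using nonneg[of y] by linarith
  have "isCont f y" using cont by (simp add: continuous_on_eq_continuous_at)
  then obtain d where d: "d > 0" "\<And>x. dist x y < d \<Longrightarrow> dist (f x) (f y) < f y / 2"
    unfolding continuous_at_eps_delta using pos by (metis half_gt_zero)
  have ge: "f y / 2 * indicator (ball y d) x \<le> f x" for x
  proof (cases "x \<in> ball y d")
    case True
    then have "\<bar>f x - f y\<bar> < f y / 2" using d(2)[of x] by (simp add: dist_commute dist_real_def)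
    then have "f y / 2 \<le> f x" by linarith
    then show ?thesis using True by simp
  qed (use nonneg in simp)
  have "0 < f y / 2 * measure lborel (ball y d)"
    using pos d(1) content_ball_gt_0_iff[of y d] by simp
  also have "\<dots> = (LINT x|lborel. f y / 2 * indicator (ball y d) x)"
    by simp
  also have "\<dots> \<le> (LINT x|lborel. f x)"
  proof (rule integral_mono)
    have "integrable lborel (indicator (ball y d) :: real ^ 'n \<Rightarrow> real)"
      using emeasure_lborel_ball_finite[of y d] by (intro integrable_real_indicator) auto
    then show "integrable lborel (\<lambda>x. f y / 2 * indicator (ball y d) x)"
      by (rule integrable_mult_right)
  qed (use int ge in auto)
  finally show False using zero by simp
qed

section \<open>Cut-off functions\<close>

lemma has_real_derivative_max_power:
  assumes "2 \<le> M"
  shows "((\<lambda>t. max 0 t ^ M) has_real_derivative real M * max 0 t ^ (M - 1)) (at t)"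
proof -
  consider "t < 0" | "t > 0" | "t = 0" by linarith
  then show ?thesis
  proof cases
    case 1
    have "((\<lambda>t. 0) has_real_derivative 0) (at t)" by simp
    then have "((\<lambda>t. max 0 t ^ M) has_real_derivative 0) (at t)"
      by (rule has_field_derivative_transform_within_open[where S = "{..<0}"]) (use 1 assms in auto)
    moreover have "max 0 t = 0" using 1 by simp
    ultimately show ?thesis using assms by (simp only:) (simp add: power_0_left)
  next
    case 2
    have "((\<lambda>t. t ^ M) has_real_derivative real M * t ^ (M - 1)) (at t)"
      by (auto intro!: derivative_eq_intros)
    then have "((\<lambda>t. max 0 t ^ M) has_real_derivative real M * t ^ (M - 1)) (at t)"
      by (rule has_field_derivative_transform_within_open[where S = "{0<..}"]) (use 2 in auto)
    then show ?thesis using 2 by simp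
  next
    case 3
    have "((\<lambda>h. max 0 h ^ M / h) \<longlongrightarrow> 0) (at (0::real))"
    proof (rule Lim_null_comparison)
      show "eventually (\<lambda>h::real. norm (max 0 h ^ M / h) \<le> \<bar>h\<bar> ^ (M - 1)) (at 0)"
      proof (rule always_eventually, rule allI)
        fix h :: real
        have "max 0 h ^ M \<le> \<bar>h\<bar> ^ M" by (rule power_mono) auto
        also have "\<dots> = \<bar>h\<bar> ^ (M - 1) * \<bar>h\<bar>" using assms by (simp flip: power_Suc2)
        finally show "norm (max 0 h ^ M / h) \<le> \<bar>h\<bar> ^ (M - 1)"
          by (cases "h = 0") (auto simp: field_simps)
      qed
      have "((\<lambda>h::real. \<bar>h\<bar> ^ (M - 1)) \<longlongrightarrow> \<bar>0\<bar> ^ (M - 1)) (at 0)"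
        by (intro tendsto_intros)
      then show "((\<lambda>h::real. \<bar>h\<bar> ^ (M - 1)) \<longlongrightarrow> 0) (at 0)"
        using assms by (simp add: power_0_left)
    qed
    then show ?thesis using 3 assms by (simp add: has_field_derivative_iff power_0_left)
  qed
qed

text \<open>Only powers with exponent at least 2 are used: they are C^1 across the sphere of radius
  \<open>R\<close>, where \<open>bump\<close> itself has a kink.\<close>

definition bump :: "real \<Rightarrow> 'a::real_inner \<Rightarrow> real" where
  "bump R x = max 0 (1 - (x \<bullet> x) / R\<^sup>2)"

lemma bump_nonneg: "0 \<le> bump R x" and bump_le_1: "bump R x \<le> 1"
  by (auto simp: bump_def)

lemma bump_eq_zero: "norm x \<ge> R \<Longrightarrow> R > 0 \<Longrightarrow> bump R x = 0"
  by (auto simp: bump_def field_simps dot_square_norm power_mono max_def)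

lemma has_grad_bump_power:
  assumes "2 \<le> M"
  shows "has_grad (\<lambda>x :: real ^ 'n::finite. bump R x ^ M)
           (\<lambda>x. (- (2 * real M / R\<^sup>2) * bump R x ^ (M - 1)) *\<^sub>R x)"
proof -
  have sq: "has_grad (\<lambda>x :: real ^ 'n. x \<bullet> x) (\<lambda>x. 2 *\<^sub>R x)"
    by (rule has_gradI) (auto intro!: derivative_eq_intros continuous_intros simp: inner_commute)
  have "has_grad (\<lambda>x :: real ^ 'n. max 0 (1 - (x \<bullet> x) / R\<^sup>2) ^ M)
     (\<lambda>x. (real M * max 0 (1 - (x \<bullet> x) / R\<^sup>2) ^ (M - 1) * (- 1 / R\<^sup>2)) *\<^sub>R (2 *\<^sub>R x))"
  proof (rule has_grad_compose[OF sq])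
    fix x :: "real ^ 'n"
    have "((\<lambda>s. 1 - s / R\<^sup>2) has_real_derivative (- 1 / R\<^sup>2)) (at (x \<bullet> x))"
      unfolding divide_inverse by (auto intro!: derivative_eq_intros)
    from DERIV_chain2[OF has_real_derivative_max_power[OF assms] this]
    show "((\<lambda>s. max 0 (1 - s / R\<^sup>2) ^ M) has_real_derivative
        real M * max 0 (1 - (x \<bullet> x) / R\<^sup>2) ^ (M - 1) * (- 1 / R\<^sup>2)) (at (x \<bullet> x))" .
    show "continuous_on UNIV (\<lambda>x :: real ^ 'n. real M * max 0 (1 - (x \<bullet> x) / R\<^sup>2) ^ (M - 1) * (- 1 / R\<^sup>2))"
      unfolding divide_inverse by (intro continuous_intros)
  qed
  then show ?thesis by (simp add: bump_def[abs_def] fun_eq_iff divide_inverse mult_ac)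
qed

section \<open>Regularity of the map z -> |z|^q z at the origin\<close>

lemma norm_powr_eq_inner: "norm_powr z q = (if q = 0 then 1 else (z \<bullet> z) powr (q / 2))"
proof -
  have "norm z powr q = (z \<bullet> z) powr (q / 2)"
    by (simp add: norm_eq_sqrt_inner flip: powr_half_sqrt) (simp add: powr_powr)
  then show ?thesis by (simp add: norm_powr_def)
qed

lemma norm_powr_nonneg: "0 \<le> norm_powr z q"
  by (simp add: norm_powr_def)

lemma continuous_on_norm_powr:
  assumes "0 \<le> q"
  shows "continuous_on S (\<lambda>z. norm_powr z q)"
  using assms unfolding norm_powr_def
  by (cases "q = 0") (simp, simp, rule continuous_on_powr', auto intro!: continuous_intros)

text \<open>For q > 0 the quotient at the origin is bounded by |z|^q, so the derivative there is 0.
  The formula agrees, since every summand vanishes at z = 0 although \<open>q - 2\<close> may be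
  negative.\<close>

lemma has_derivative_norm_powr_mult:
  fixes z :: "real ^ 'n::finite"
  assumes "0 \<le> q"
  shows "((\<lambda>z. norm_powr z q * z $ i) has_derivative
    (\<lambda>h. norm_powr z q * h $ i + q * norm z powr (q - 2) * z $ i * (z \<bullet> h))) (at z)"
proof (cases "q = 0")
  case True
  then show ?thesis by (auto simp: norm_powr_def intro!: derivative_eq_intros bounded_linear_imp_has_derivative bounded_linear_vec_nth)
next
  case q: False
  show ?thesis
  proof (cases "z = 0")
    case True
    have "((\<lambda>h :: real ^ 'n. norm (norm_powr h q * h $ i) / norm h) \<longlongrightarrow> 0) (at 0)"
    proof (rule Lim_null_comparison)
      show "eventually (\<lambda>h :: real ^ 'n. norm (norm (norm_powr h q * h $ i) / norm h) \<le> norm_powr h q) (at 0)"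
      proof (rule always_eventually, rule allI)
        fix h :: "real ^ 'n"
        have "norm_powr h q * \<bar>h $ i\<bar> \<le> norm_powr h q * norm h"
          by (intro mult_left_mono component_le_norm_cart norm_powr_nonneg)
        then show "norm (norm (norm_powr h q * h $ i) / norm h) \<le> norm_powr h q"
          by (cases "h = 0") (auto simp: field_simps abs_mult norm_powr_nonneg)
      qed
      have "isCont (\<lambda>h :: real ^ 'n. norm_powr h q) 0"
        using continuous_on_norm_powr[OF assms, of "UNIV :: (real ^ 'n) set"] by (simp add: continuous_on_eq_continuous_at)
      then show "((\<lambda>h :: real ^ 'n. norm_powr h q) \<longlongrightarrow> 0) (at 0)"
        using q by (simp add: isCont_def norm_powr_def)
    qed
    then show ?thesis using True q by (simp add: has_derivative_at norm_powr_def)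
  next
    case False
    then have pos: "z \<bullet> z > 0" by simp
    have "((\<lambda>z. z \<bullet> z) has_derivative (\<lambda>h. 2 * (z \<bullet> h))) (at z)"
      by (auto intro!: derivative_eq_intros simp: inner_commute)
    from has_derivative_compose[OF this has_real_derivative_powr[OF pos, of "q / 2", unfolded has_field_derivative_def]]
    have p: "((\<lambda>z. (z \<bullet> z) powr (q / 2)) has_derivative (\<lambda>h. q * (z \<bullet> z) powr (q / 2 - 1) * (z \<bullet> h))) (at z)"
      by (simp add: mult.assoc)
    have c: "((\<lambda>z. z $ i) has_derivative (\<lambda>h. h $ i)) (at z)"
      by (rule bounded_linear_imp_has_derivative[OF bounded_linear_vec_nth])
    have e: "(z \<bullet> z) powr (q / 2 - 1) = norm z powr (q - 2)"
      by (simp add: norm_eq_sqrt_inner flip: powr_half_sqrt) (simp add: powr_powr diff_divide_distrib)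
    show ?thesis
      using has_derivative_mult[OF p c] q unfolding norm_powr_eq_inner e by (simp add: mult_ac)
  qed
qed

text \<open>The power \<open>q - 2\<close> may blow up at the origin, but two components of z
  compensate for it: the product is bounded by |z|^q.\<close>

lemma continuous_on_norm_powr_sub_two_mult:
  assumes "0 < q"
  shows "continuous_on UNIV (\<lambda>z :: real ^ 'n::finite. norm z powr (q - 2) * z $ i * z $ k)"
proof -
  have "isCont (\<lambda>z :: real ^ 'n. norm z powr (q - 2) * z $ i * z $ k) z" for z
  proof (cases "z = 0")
    case False
    then show ?thesis unfolding isCont_def by (intro tendsto_intros) auto
  next
    case True
    have "((\<lambda>z :: real ^ 'n. norm z powr (q - 2) * z $ i * z $ k) \<longlongrightarrow> 0) (at 0)"
    proof (rule Lim_null_comparison)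
      show "eventually (\<lambda>z :: real ^ 'n. norm (norm z powr (q - 2) * z $ i * z $ k) \<le> norm z powr q) (at 0)"
      proof (rule always_eventually, rule allI)
        fix z :: "real ^ 'n"
        have "norm (norm z powr (q - 2) * z $ i * z $ k) \<le> norm z powr (q - 2) * norm z * norm z"
          unfolding norm_mult by (intro mult_mono) (auto simp: component_le_norm_cart)
        also have "\<dots> = norm z powr q"
          by (cases "z = 0") (auto simp: powr_diff power2_eq_square)
        finally show "norm (norm z powr (q - 2) * z $ i * z $ k) \<le> norm z powr q" .
      qed
      have "isCont (\<lambda>h :: real ^ 'n. norm_powr h q) 0"
        using continuous_on_norm_powr[of q "UNIV :: (real ^ 'n) set"] assms by (simp add: continuous_on_eq_continuous_at)
      then show "((\<lambda>h :: real ^ 'n. norm h powr q) \<longlongrightarrow> 0) (at 0)"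
        using assms by (simp add: isCont_def norm_powr_def)
    qed
    then show ?thesis using True by (simp add: isCont_def)
  qed
  then show ?thesis by (simp add: continuous_on_eq_continuous_at)
qed

section \<open>Symmetry of the Hessian and Bochner's identity for C^2 functions\<close>

locale hessian =
  fixes u :: "real ^ 'n::finite \<Rightarrow> real" and U :: "real ^ 'n \<Rightarrow> real ^ 'n" and H :: "real ^ 'n \<Rightarrow> real ^ 'n ^ 'n"
  assumes has_grad_u: "has_grad u U"
    and has_grad_U: "\<And>i. has_grad (\<lambda>x. U x $ i) (\<lambda>x. H x $ i)"
begin

lemma continuous_u: "continuous_on S u" and continuous_U: "continuous_on S U"
  by (rule has_grad_continuous[OF has_grad_u] has_grad_continuous_grad[OF has_grad_u])+

lemma continuous_H: "continuous_on S (\<lambda>x. H x $ i $ j)"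
  by (intro continuous_intros has_grad_continuous_grad[OF has_grad_U])

lemma has_grad_norm_powr_U:
  assumes "0 \<le> q"
  shows "has_grad (\<lambda>x. norm_powr (U x) q * U x $ i)
    (\<lambda>x. norm_powr (U x) q *\<^sub>R H x $ i + (q * norm (U x) powr (q - 2) * U x $ i) *\<^sub>R (U x v* H x))"
proof (rule has_gradI)
  fix x
  have "(U has_derivative (\<lambda>h. H x *v h)) (at x)"
    unfolding has_derivative_componentwise_within[of U]
    using has_grad_deriv[OF has_grad_U, of _ x]
    by (auto simp: Basis_vec_def inner_axis matrix_vector_mul_component)
  from has_derivative_compose[OF this has_derivative_norm_powr_mult[OF assms, of i]]
  show "((\<lambda>x. norm_powr (U x) q * U x $ i) has_derivative
      (\<lambda>h. (norm_powr (U x) q *\<^sub>R H x $ i + (q * norm (U x) powr (q - 2) * U x $ i) *\<^sub>R (U x v* H x)) \<bullet> h)) (at x)"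
    by (rule has_derivative_eq_rhs)
      (auto simp: fun_eq_iff inner_add_left dot_lmul_matrix matrix_vector_mul_component)
next
  have "continuous_on UNIV (\<lambda>x. (norm_powr (U x) q *\<^sub>R H x $ i) $ j)" for j
    by (auto intro!: continuous_intros continuous_H continuous_on_compose2[OF continuous_on_norm_powr[OF assms] continuous_U])
  moreover have "continuous_on UNIV (\<lambda>x. ((q * norm (U x) powr (q - 2) * U x $ i) *\<^sub>R (U x v* H x)) $ j)" for j
  proof (cases "q = 0")
    case False
    then have q: "0 < q" using assms by simp
    have *: "continuous_on UNIV (\<lambda>x. norm (U x) powr (q - 2) * U x $ i * U x $ k)" for k
      using continuous_on_compose2[OF continuous_on_norm_powr_sub_two_mult[OF q] continuous_U] by blast
    \<comment> \<open>Writing out the product \<open>U x v* H x\<close> supplies the second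
      component of \<open>U\<close> that the possibly negative power needs.\<close>
    have "continuous_on UNIV (\<lambda>x. \<Sum>k\<in>UNIV. q * (norm (U x) powr (q - 2) * U x $ i * U x $ k) * H x $ k $ j)"
      by (intro continuous_intros * continuous_H)
    then show ?thesis
      by (simp add: vector_matrix_mult_def sum_distrib_left mult_ac)
  qed auto
  ultimately have "continuous_on UNIV (\<lambda>x. (norm_powr (U x) q *\<^sub>R H x $ i
      + (q * norm (U x) powr (q - 2) * U x $ i) *\<^sub>R (U x v* H x)) $ j)" for j
    unfolding vector_add_component by (intro continuous_on_add)
  then show "continuous_on UNIV (\<lambda>x. norm_powr (U x) q *\<^sub>R H x $ i
      + (q * norm (U x) powr (q - 2) * U x $ i) *\<^sub>R (U x v* H x))"
    using continuous_on_vec_lambda[of UNIV "\<lambda>j x. (norm_powr (U x) q *\<^sub>R H x $ i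
      + (q * norm (U x) powr (q - 2) * U x $ i) *\<^sub>R (U x v* H x)) $ j"]
    by (simp only: vec_lambda_eta)
qed

text \<open>Schwarz's theorem by duality: tested against compactly supported C^1 functions, the two
  mixed derivatives agree by one integration by parts and \<open>integral_grad_swap\<close>;
  continuity makes the agreement pointwise.\<close>

lemma symmetric: "H y $ i $ j = H y $ j $ i"
proof -
  define R where "R = norm y + 2"
  define D where "D = (\<lambda>x. H x $ i $ j - H x $ j $ i)"
  have cD: "continuous_on UNIV D" unfolding D_def by (intro continuous_intros continuous_H)
  have zero: "(LINT x|lborel. k x * D x) = 0" if k: "has_grad k k'" and supp: "\<And>x. norm x > r \<Longrightarrow> k x = 0" for k k' r
  proof -
    have k0: "k' x = 0" if "norm x > r" for x
      by (rule has_grad_eq_zero_outside[OF k supp that])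
    have ck: "continuous_on UNIV k" "continuous_on UNIV k'"
      using has_grad_continuous[OF k] has_grad_continuous_grad[OF k] by auto
    have i1: "integrable lborel (\<lambda>x. k' x $ a * U x $ b)" for a b
      by (rule integrable_continuous_compact_support[where R = r])
       (use k0 ck in \<open>auto intro!: continuous_intros continuous_U\<close>)
    have i2: "integrable lborel (\<lambda>x. k x * H x $ a $ b)" for a b
      by (rule integrable_continuous_compact_support[where R = r])
       (use supp ck in \<open>auto intro!: continuous_intros continuous_H\<close>)
    have ibp: "(LINT x|lborel. k' x $ a * U x $ b) + (LINT x|lborel. k x * H x $ b $ a) = 0" for a b
    proof -
      have "0 = (LINT x|lborel. (U x $ b *\<^sub>R k' x + k x *\<^sub>R H x $ b) \<bullet> axis a 1)"
        by (rule integral_grad_zero[OF has_grad_mult[OF k has_grad_U], of r, symmetric]) (use supp in \<open>auto simp: norm_axis_1\<close>)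
      also have "\<dots> = (LINT x|lborel. k' x $ a * U x $ b + k x * H x $ b $ a)"
        by (simp add: inner_axis mult.commute)
      also have "\<dots> = (LINT x|lborel. k' x $ a * U x $ b) + (LINT x|lborel. k x * H x $ b $ a)"
        by (rule Bochner_Integration.integral_add[OF i1 i2])
      finally show ?thesis by simp
    qed
    have "(LINT x|lborel. k' x $ i * U x $ j) = (LINT x|lborel. k' x $ j * U x $ i)"
      using integral_grad_swap[OF k supp has_grad_u, of r "axis i 1" "axis j 1"] by (simp add: inner_axis norm_axis_1)
    then have "(LINT x|lborel. k x * H x $ i $ j) - (LINT x|lborel. k x * H x $ j $ i) = 0"
      using ibp[of i j] ibp[of j i] by linarith
    then show ?thesis
      unfolding D_def right_diff_distrib by (simp add: Bochner_Integration.integral_diff[OF i2 i2])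
  qed
  have "D y = 0"
  proof (rule ccontr)
    assume "D y \<noteq> 0"
    moreover have "isCont D y" using cD by (simp add: continuous_on_eq_continuous_at)
    ultimately obtain d where d: "d > 0" "\<And>x. dist x y < d \<Longrightarrow> dist (D x) (D y) < \<bar>D y\<bar>"
      unfolding continuous_at_eps_delta by (metis zero_less_abs_iff)
    \<comment> \<open>The factor \<open>D y\<close> makes \<open>k x * D x\<close> nonnegative on
      the ball around \<open>y\<close>, where \<open>D\<close> does not change sign.\<close>
    define k :: "real ^ 'n \<Rightarrow> real" where "k = (\<lambda>x. bump d (x + (- y)) ^ 2 * D y)"
    have k: "has_grad k (\<lambda>x. D y *\<^sub>R ((- (2 * real 2 / d\<^sup>2) * bump d (x + (- y)) ^ (2 - 1)) *\<^sub>R (x + (- y))))"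
      unfolding k_def using has_grad_cmult[OF has_grad_shift[OF has_grad_bump_power[of 2 d], of "- y"], of "D y"]
      by (simp add: mult.commute)
    have k0: "k x = 0" if "dist x y \<ge> d" for x
      using that d(1) bump_eq_zero[of d "x + (- y)"] by (simp add: k_def dist_norm)
    have supp: "k x = 0" if "norm x > norm y + d" for x
    proof (rule k0)
      have "norm x \<le> norm (x - y) + norm y" by (metis diff_add_cancel norm_triangle_ineq)
      then show "dist x y \<ge> d" using that by (simp add: dist_norm)
    qed
    have "k y * D y = 0"
    proof (rule continuous_nonneg_integral_zero)
      show "continuous_on UNIV (\<lambda>x. k x * D x)"
        by (intro continuous_intros has_grad_continuous[OF k] cD)
      then show "integrable lborel (\<lambda>x. k x * D x)"
        by (rule integrable_continuous_compact_support) (use supp in auto)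
      show "(LINT x|lborel. k x * D x) \<le> 0" using zero[OF k supp] by simp
      show "0 \<le> k x * D x" for x
      proof (cases "dist x y < d")
        case True
        then have "D y * D x \<ge> 0"
          using d(2)[OF True] by (auto simp: dist_real_def abs_if split: if_splits intro: mult_nonneg_nonneg mult_nonpos_nonpos)
        then have "bump d (x + (- y)) ^ 2 * (D y * D x) \<ge> 0" by simp
        then show ?thesis by (simp add: k_def mult.assoc)
      qed (use k0 in auto)
    qed
    then show False using \<open>D y \<noteq> 0\<close> by (simp add: k_def bump_def)
  qed
  then show ?thesis by (simp add: D_def)
qed

text \<open>Integrated form of \<open>div (H U - (tr H) U) = |H|\<^sup>2 - (tr H)\<^sup>2\<close>, free of third derivatives.\<close>

lemma integral_bochner:
  assumes \<phi>: "has_grad \<phi> \<phi>'" and supp: "\<And>x. norm x > R \<Longrightarrow> \<phi> x = 0"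
  defines "J \<equiv> \<lambda>x. \<phi> x * ((\<Sum>i\<in>UNIV. \<Sum>j\<in>UNIV. (H x $ i $ j)\<^sup>2) - (trace (H x))\<^sup>2)
     + \<phi>' x \<bullet> (H x *v U x - trace (H x) *\<^sub>R U x)"
  shows "integrable lborel J" "(LINT x|lborel. J x) = 0"
proof -
  have \<phi>0: "\<phi>' x = 0" if "norm x > R" for x
    by (rule has_grad_eq_zero_outside[OF \<phi> supp that])
  have c\<phi>: "continuous_on UNIV \<phi>" "continuous_on UNIV \<phi>'"
    using has_grad_continuous[OF \<phi>] has_grad_continuous_grad[OF \<phi>] by auto
  let ?F = "\<lambda>i j x. (U x $ j * \<phi>' x $ i + \<phi> x * H x $ j $ i) * H x $ i $ j"
  let ?G = "\<lambda>i j x. (U x $ j * \<phi>' x $ j + \<phi> x * H x $ j $ j) * H x $ i $ i"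
  have iF: "integrable lborel (?F i j)" for i j
    by (rule integrable_continuous_compact_support[where R = R])
     (use \<phi>0 c\<phi> supp in \<open>auto intro!: continuous_intros continuous_U continuous_H\<close>)
  have iG: "integrable lborel (?G i j)" for i j
    by (rule integrable_continuous_compact_support[where R = R])
     (use \<phi>0 c\<phi> supp in \<open>auto intro!: continuous_intros continuous_U continuous_H\<close>)
  \<comment> \<open>Exchanging the directions i and j between \<phi> U_j and U_i replaces the third
    derivatives of the classical argument: the left side produces |H|^2, the right side (tr
    H)^2.\<close>
  have FG: "(LINT x|lborel. ?F i j x) = (LINT x|lborel. ?G i j x)" for i j
    using integral_grad_swap[OF has_grad_mult[OF \<phi> has_grad_U[of j]] _ has_grad_U[of i], of R "axis i 1" "axis j 1"] supp
    by (simp add: inner_axis norm_axis_1)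
  have eq: "J x = (\<Sum>i\<in>UNIV. \<Sum>j\<in>UNIV. ?F i j x - ?G i j x)" for x
  proof -
    have "?F i j x = \<phi> x * (H x $ i $ j)\<^sup>2 + \<phi>' x $ i * (H x $ i $ j * U x $ j)" for i j
      by (simp add: symmetric[of x j i] algebra_simps power2_eq_square)
    then have "(\<Sum>i\<in>UNIV. \<Sum>j\<in>UNIV. ?F i j x) = \<phi> x * (\<Sum>i\<in>UNIV. \<Sum>j\<in>UNIV. (H x $ i $ j)\<^sup>2) + \<phi>' x \<bullet> (H x *v U x)"
      by (simp add: inner_vec_def matrix_vector_mult_def sum_distrib_left sum.distrib)
    moreover have "(\<Sum>i\<in>UNIV. \<Sum>j\<in>UNIV. ?G i j x) = \<phi> x * (trace (H x))\<^sup>2 + trace (H x) * (\<phi>' x \<bullet> U x)"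
    proof -
      have "(\<Sum>i\<in>UNIV. \<Sum>j\<in>UNIV. ?G i j x) = (\<Sum>i\<in>UNIV. (\<Sum>j\<in>UNIV. U x $ j * \<phi>' x $ j + \<phi> x * H x $ j $ j) * H x $ i $ i)"
        by (simp add: sum_distrib_right)
      also have "\<dots> = (\<phi>' x \<bullet> U x + \<phi> x * trace (H x)) * trace (H x)"
      proof -
        have "(\<Sum>j\<in>UNIV. U x $ j * \<phi>' x $ j + \<phi> x * H x $ j $ j) = \<phi>' x \<bullet> U x + \<phi> x * trace (H x)"
          by (simp add: sum_distrib_left sum.distrib inner_vec_def trace_def mult.commute)
        then show ?thesis by (simp add: trace_def sum_distrib_left)
      qed
      finally show ?thesis by (simp add: algebra_simps power2_eq_square)
    qed
    ultimately show ?thesis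
      by (simp add: J_def sum_subtractf inner_diff_right algebra_simps)
  qed
  then have J: "J = (\<lambda>x. \<Sum>i\<in>UNIV. \<Sum>j\<in>UNIV. ?F i j x - ?G i j x)" by blast
  show "integrable lborel J"
    unfolding J using iF iG by (intro Bochner_Integration.integrable_sum Bochner_Integration.integrable_diff)
  have "(LINT x|lborel. (\<Sum>i\<in>UNIV. \<Sum>j\<in>UNIV. ?F i j x - ?G i j x))
      = (\<Sum>i\<in>UNIV. \<Sum>j\<in>UNIV. (LINT x|lborel. ?F i j x) - (LINT x|lborel. ?G i j x))"
    using iF iG by (subst Bochner_Integration.integral_sum)
      (auto intro!: Bochner_Integration.integrable_sum Bochner_Integration.integrable_diff sum.cong
        simp: Bochner_Integration.integral_sum Bochner_Integration.integral_diff)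
  also have "\<dots> = 0"
    by (intro sum.neutral ballI, subst FG, simp)
  finally show "(LINT x|lborel. J x) = 0"
    unfolding J .
qed

end

text \<open>Nonnegativity of the squared norm of \<open>H - e t\<^sup>T - t e\<^sup>T - h e e\<^sup>T - c (I - e e\<^sup>T)\<close>, where
  \<open>H e = h e + t\<close> with \<open>t\<close> orthogonal to \<open>e\<close>, and \<open>c\<close> is the mean of the remaining diagonal.\<close>

lemma symmetric_matrix_norm_ge:
  fixes H :: "real ^ 'n::finite ^ 'n"
  assumes sym: "\<And>i j. H $ i $ j = H $ j $ i" and e: "e \<bullet> e = 1" and n: "CARD('n) \<ge> 2"
  defines "h \<equiv> e \<bullet> (H *v e)"
  defines "t \<equiv> H *v e - h *\<^sub>R e"
  shows "h\<^sup>2 + 2 * (t \<bullet> t) + (trace H - h)\<^sup>2 / (real CARD('n) - 1) \<le> (\<Sum>i\<in>UNIV. \<Sum>j\<in>UNIV. (H $ i $ j)\<^sup>2)"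
proof -
  let ?N = "real CARD('n) - 1"
  have N: "?N > 0" using n by simp
  define c where "c = (trace H - h) / ?N"
  define B where "B = (\<lambda>i j. e $ i * t $ j + t $ i * e $ j + (h - c) * (e $ i * e $ j) + (if i = j then c else 0))"
  have et: "e \<bullet> t = 0" by (simp add: t_def h_def inner_diff_right e)
  have He: "H *v e = h *\<^sub>R e + t" by (simp add: t_def)
  have See: "(\<Sum>i\<in>UNIV. e $ i * e $ i) = 1" using e by (simp add: inner_vec_def)
  have Set: "(\<Sum>i\<in>UNIV. e $ i * t $ i) = 0" using et by (simp add: inner_vec_def)
  have Hei: "(\<Sum>j\<in>UNIV. H $ i $ j * e $ j) = h * e $ i + t $ i" for i
    using arg_cong[OF He, of "\<lambda>v. v $ i"] by (simp add: matrix_vector_mult_def)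
  have bil: "(\<Sum>i\<in>UNIV. \<Sum>j\<in>UNIV. H $ i $ j * (a $ i * b $ j)) = a \<bullet> (H *v b)" for a b :: "real ^ 'n"
    by (simp add: inner_vec_def matrix_vector_mult_def sum_distrib_left mult_ac)
  have Hsym: "a \<bullet> (H *v b) = b \<bullet> (H *v a)" for a b :: "real ^ 'n"
  proof -
    have "transpose H = H" using sym by (simp add: transpose_def vec_eq_iff)
    then show ?thesis by (metis dot_lmul_matrix inner_commute vector_transpose_matrix)
  qed
  have rank1: "(\<Sum>i\<in>UNIV. \<Sum>j\<in>UNIV. (a $ i * b $ j) * (a' $ i * b' $ j)) = (a \<bullet> a') * (b \<bullet> b')"
    for a b a' b' :: "real ^ 'n"
    by (simp add: inner_vec_def sum_product mult_ac)
  have diag: "(\<Sum>i\<in>UNIV. \<Sum>j\<in>UNIV. f i j * (if i = j then c else 0)) = c * (\<Sum>i\<in>UNIV. f i i)" for f :: "'n \<Rightarrow> 'n \<Rightarrow> real"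
    by (simp add: if_distrib sum.delta sum_distrib_left mult.commute cong: if_cong)
  have HB: "(\<Sum>i\<in>UNIV. \<Sum>j\<in>UNIV. H $ i $ j * B i j) = 2 * (t \<bullet> t) + (h - c) * h + c * trace H"
  proof -
    have "(\<Sum>i\<in>UNIV. \<Sum>j\<in>UNIV. H $ i $ j * B i j)
      = (\<Sum>i\<in>UNIV. \<Sum>j\<in>UNIV. H $ i $ j * (e $ i * t $ j)) + (\<Sum>i\<in>UNIV. \<Sum>j\<in>UNIV. H $ i $ j * (t $ i * e $ j))
        + (h - c) * (\<Sum>i\<in>UNIV. \<Sum>j\<in>UNIV. H $ i $ j * (e $ i * e $ j))
        + (\<Sum>i\<in>UNIV. \<Sum>j\<in>UNIV. H $ i $ j * (if i = j then c else 0))"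
      unfolding B_def by (simp add: distrib_left sum.distrib sum_distrib_left mult_ac)
    also have "\<dots> = e \<bullet> (H *v t) + t \<bullet> (H *v e) + (h - c) * (e \<bullet> (H *v e)) + c * trace H"
      by (simp only: bil diag trace_def)
    also have "e \<bullet> (H *v t) = t \<bullet> (H *v e)" by (rule Hsym)
    also have "t \<bullet> (H *v e) = t \<bullet> t" using et by (simp add: He inner_add_right inner_commute)
    finally show ?thesis by (simp add: h_def)
  qed
  have BB: "(\<Sum>i\<in>UNIV. \<Sum>j\<in>UNIV. B i j * B i j) = 2 * (t \<bullet> t) + (h - c)\<^sup>2 + 2 * c * (h - c) + c\<^sup>2 * real CARD('n)"
  proof -
    have "(\<Sum>i\<in>UNIV. \<Sum>j\<in>UNIV. B i j * B i j)
      = (\<Sum>i\<in>UNIV. \<Sum>j\<in>UNIV. (e $ i * t $ j) * (e $ i * t $ j)) + (\<Sum>i\<in>UNIV. \<Sum>j\<in>UNIV. (t $ i * e $ j) * (t $ i * e $ j))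
        + 2 * (\<Sum>i\<in>UNIV. \<Sum>j\<in>UNIV. (e $ i * t $ j) * (t $ i * e $ j))
        + (h - c)\<^sup>2 * (\<Sum>i\<in>UNIV. \<Sum>j\<in>UNIV. (e $ i * e $ j) * (e $ i * e $ j))
        + 2 * (h - c) * (\<Sum>i\<in>UNIV. \<Sum>j\<in>UNIV. (e $ i * t $ j) * (e $ i * e $ j))
        + 2 * (h - c) * (\<Sum>i\<in>UNIV. \<Sum>j\<in>UNIV. (t $ i * e $ j) * (e $ i * e $ j))
        + (\<Sum>i\<in>UNIV. \<Sum>j\<in>UNIV. (2 * (e $ i * t $ j) + 2 * (t $ i * e $ j) + 2 * (h - c) * (e $ i * e $ j)
             + (if i = j then c else 0)) * (if i = j then c else 0))"
      unfolding B_def sum_distrib_left sum.distrib[symmetric]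
      by (intro sum.cong refl) (simp add: algebra_simps power2_eq_square)
    also have "\<dots> = 2 * (t \<bullet> t) + (h - c)\<^sup>2 + 2 * c * (h - c) + c\<^sup>2 * real CARD('n)"
    proof -
      have "(\<Sum>i\<in>UNIV. 2 * (e $ i * t $ i) + 2 * (t $ i * e $ i) + 2 * (h - c) * (e $ i * e $ i) + (if i = i then c else 0))
        = (\<Sum>i\<in>UNIV. 4 * (e $ i * t $ i) + 2 * (h - c) * (e $ i * e $ i) + c)"
        by (intro sum.cong refl) simp
      also have "\<dots> = 2 * (h - c) + real CARD('n) * c"
        by (simp only: sum.distrib sum_distrib_left[symmetric] sum_constant See Set mult_zero_right mult_1_right add_0)
      finally have "(\<Sum>i\<in>UNIV. 2 * (e $ i * t $ i) + 2 * (t $ i * e $ i) + 2 * (h - c) * (e $ i * e $ i) + (if i = i then c else 0))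
        = 2 * (h - c) + real CARD('n) * c" .
      moreover have "t \<bullet> e = 0" using et by (simp add: inner_commute)
      ultimately show ?thesis
        unfolding rank1 diag by (simp only: et e) (simp add: algebra_simps power2_eq_square)
    qed
    finally show ?thesis .
  qed
  have "0 \<le> (\<Sum>i\<in>UNIV. \<Sum>j\<in>UNIV. (H $ i $ j - B i j)\<^sup>2)"
    by (intro sum_nonneg) auto
  also have "\<dots> = (\<Sum>i\<in>UNIV. \<Sum>j\<in>UNIV. (H $ i $ j)\<^sup>2) - 2 * (\<Sum>i\<in>UNIV. \<Sum>j\<in>UNIV. H $ i $ j * B i j)
      + (\<Sum>i\<in>UNIV. \<Sum>j\<in>UNIV. B i j * B i j)"
    unfolding sum_distrib_left sum.distrib[symmetric] sum_subtractf[symmetric]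
    by (intro sum.cong refl) (simp add: algebra_simps power2_eq_square)
  also have "\<dots> = (\<Sum>i\<in>UNIV. \<Sum>j\<in>UNIV. (H $ i $ j)\<^sup>2) - (h\<^sup>2 + 2 * (t \<bullet> t) + (2 * c * (trace H - h) - c\<^sup>2 * ?N))"
    unfolding HB BB by (simp add: algebra_simps power2_eq_square)
  also have "2 * c * (trace H - h) - c\<^sup>2 * ?N = (trace H - h)\<^sup>2 / ?N"
  proof -
    have *: "2 * c * (c * N) - c\<^sup>2 * N = (c * N)\<^sup>2 / N" if "N > 0" for N
      using that by (simp add: power2_eq_square)
    have "trace H - h = c * ?N" using N by (simp add: c_def)
    then show ?thesis using *[OF N] by (simp only:)
  qed
  finally show ?thesis by (simp add: algebra_simps)
qed

section \<open>The exponents\<close>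

text \<open>With \<open>K = |Du|\<^sup>2 / u\<close> and \<open>F = u\<^sup>E |Du|\<^sup>q\<close> the two linear equations say
  \<open>|Du|\<^sup>2 = (K\<^sup>2)\<^bsup>\<theta>0\<^esup> (F\<^sup>2)\<^bsup>\<theta>1\<^esup> (u\<^bsup>2N - 2\<^esup> |Du|\<^bsup>-b\<^esup>)\<^bsup>\<theta>2\<^esup>\<close>; Young's inequality then produces the factor
  \<open>R\<^bsup>-2 / \<theta>2\<^esup>\<close>, which beats the volume \<open>R\<^bsup>N + 1\<^esup>\<close> of the ball because \<open>\<theta>2 < 2 / (N + 1)\<close>.\<close>

lemma interpolation_exponents:
  fixes N q b E :: real
  assumes N: "2 \<le> N" and q: "0 \<le> q" "q \<le> 1 / 2" and b: "- 3 / 2 < b" "b \<le> 0" and E: "E < 1 - q"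
    and den: "(N + 1) * (1 - E - q) < (2 - q) * (2 * N - 2) - b - 2 * q - E * (b + 4)"
  obtains \<theta>0 \<theta>1 \<theta>2 where "0 \<le> \<theta>0" "0 \<le> \<theta>1" "0 < \<theta>2" "\<theta>2 < 2 / (N + 1)" "\<theta>0 + \<theta>1 + \<theta>2 = 1"
    "- 2 * \<theta>0 + 2 * E * \<theta>1 + (2 * N - 2) * \<theta>2 = 0" "4 * \<theta>0 + 2 * q * \<theta>1 - b * \<theta>2 = 2"
proof
  \<comment> \<open>Eliminating \<theta>0 and \<theta>1 from the three linear equations leaves
    \<open>D * \<theta>2 = 2 * (1 - E - q)\<close>; hypothesis \<open>den\<close> then says exactly
    \<theta>2 < 2 / (N + 1).\<close>
  define D where "D = (2 - q) * (2 * N - 2) - b - 2 * q - E * (b + 4)"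
  define \<theta>2 where "\<theta>2 = 2 * (1 - E - q) / D"
  define \<theta>0 where "\<theta>0 = (2 + b * \<theta>2 - 2 * q * (1 - \<theta>2)) / (4 - 2 * q)"
  define \<theta>1 where "\<theta>1 = 1 - \<theta>0 - \<theta>2"
  have s: "1 - E - q > 0" using E by simp
  have Dgt: "(N + 1) * (1 - E - q) < D" using den by (simp add: D_def)
  moreover have "0 < (N + 1) * (1 - E - q)" using N s by simp
  ultimately have D: "D > 0" by linarith
  have D\<theta>: "D * \<theta>2 = 2 * (1 - E - q)" using D by (simp add: \<theta>2_def)
  show \<theta>2: "0 < \<theta>2" using D s by (simp add: \<theta>2_def)
  show \<theta>2': "\<theta>2 < 2 / (N + 1)"
    using D Dgt N by (simp add: \<theta>2_def field_simps)
  have "2 / (N + 1) \<le> 2 / 3" using N by (intro divide_left_mono) auto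
  then have t3: "\<theta>2 < 2 / 3" using \<theta>2' by linarith
  have q4: "4 - 2 * q > 0" using q by simp
  have e0: "(4 - 2 * q) * \<theta>0 = 2 + b * \<theta>2 - 2 * q * (1 - \<theta>2)" using q4 by (simp add: \<theta>0_def)
  have "(b + 2 * q) * \<theta>2 \<ge> (- 3 / 2) * \<theta>2" using b q \<theta>2 by (intro mult_right_mono) auto
  then have "2 + b * \<theta>2 - 2 * q * (1 - \<theta>2) \<ge> 0" using t3 q by (simp add: algebra_simps)
  then show "0 \<le> \<theta>0" using q4 by (simp add: \<theta>0_def)
  \<comment> \<open>After elimination \<theta>1 has the sign of 2 - (4 + b) \<theta>2, so its
    nonnegativity amounts to \<open>(4 + b) * (1 - E - q) \<le> D\<close>.\<close>
  have "D - (4 + b) * (1 - E - q) = (2 - q) * (2 * N - 4 - b)"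
    by (simp add: D_def algebra_simps)
  moreover have "0 \<le> (2 - q) * (2 * N - 4 - b)" using N b q by (intro mult_nonneg_nonneg) auto
  ultimately have "(4 + b) * (1 - E - q) \<le> D" by linarith
  moreover have "(4 + b) * (D * \<theta>2) = 2 * ((4 + b) * (1 - E - q))"
    unfolding D\<theta> by (rule mult.left_commute)
  ultimately have "(4 + b) * (D * \<theta>2) \<le> 2 * D" by linarith
  then have "D * ((4 + b) * \<theta>2) \<le> D * 2" by (simp add: mult_ac)
  then have le2: "(4 + b) * \<theta>2 \<le> 2" using D by simp
  have "(4 - 2 * q) * \<theta>1 = 2 - (4 + b) * \<theta>2"
    using e0 by (simp add: \<theta>1_def algebra_simps)
  then have "(4 - 2 * q) * \<theta>1 \<ge> 0" using le2 by simp
  then show "0 \<le> \<theta>1" using q4 by (simp add: zero_le_mult_iff)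
  show "\<theta>0 + \<theta>1 + \<theta>2 = 1" by (simp add: \<theta>1_def)
  show "4 * \<theta>0 + 2 * q * \<theta>1 - b * \<theta>2 = 2"
    using e0 by (simp add: \<theta>1_def algebra_simps)
  have "(4 - 2 * q) * (- 2 * \<theta>0 + 2 * E * \<theta>1 + (2 * N - 2) * \<theta>2)
      = (- 2 - 2 * E) * ((4 - 2 * q) * \<theta>0) + (4 - 2 * q) * (2 * E * (1 - \<theta>2) + (2 * N - 2) * \<theta>2)"
    by (simp add: \<theta>1_def algebra_simps)
  also have "\<dots> = 2 * (D * \<theta>2 - 2 * (1 - E - q))"
    unfolding e0 by (simp add: D_def algebra_simps)
  finally have "(4 - 2 * q) * (- 2 * \<theta>0 + 2 * E * \<theta>1 + (2 * N - 2) * \<theta>2) = 0"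
    unfolding D\<theta> by simp
  then show "- 2 * \<theta>0 + 2 * E * \<theta>1 + (2 * N - 2) * \<theta>2 = 0" using q4 by simp
qed

text \<open>The discriminant inequality is definiteness of the (h, F) block for the full weight; the
  bound 3 keeps it definite where the weight is regularised away;
  \<open>(N - 2 - E) * (1 - r) < N\<close> gives the K F term its sign; the last inequality is what
  \<open>interpolation_exponents\<close> needs.\<close>

lemma weight_parameters:
  fixes N p q :: real
  assumes N: "2 \<le> N" and q: "0 \<le> q" "q \<le> 1 / N" and pq: "1 < p + q"
    and subcritical: "(N - 1) * p + N * q < N + 1 + (2 - q) / (1 - q)"
  defines "E \<equiv> N - (N - 1) * p - N * q"
  obtains b r where "0 < (N + 1) / N + b" "b \<le> 0" "0 < r" "N * r \<le> 1"
    "(- 2 / N + q - r * (q + b))\<^sup>2 < 4 * ((N + 1) / N + b) * (1 / N - r)"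
    "2 - N * q + N * r * (1 / 2 - b) \<le> 3" "(N - 2 - E) * (1 - r) < N"
    "(N + 1) * (1 - E - q) < (2 - q) * (2 * N - 2) - b - 2 * q - E * (b + 4)"
proof -
  have z: "N * q \<le> 1" using N q by (simp add: field_simps)
  have "1 / N \<le> 1 / 2" using N by (intro divide_left_mono) auto
  then have qh: "q \<le> 1 / 2" using q by linarith
  have q1: "1 - q > 0" using qh by simp
  have y1: "1 - q - E > 0"
  proof -
    have "1 - q - E = (N - 1) * (p + q - 1)" by (simp add: E_def algebra_simps)
    then show ?thesis using N pq by simp
  qed
  have Elow: "E > - 1 - (2 - q) / (1 - q)" using subcritical by (simp add: E_def)
  have "(- 1 - (2 - q) / (1 - q)) * (1 - q) = - (3 - 2 * q)" using q1 by (simp add: field_simps)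
  then have y2: "E * (1 - q) + 3 - 2 * q > 0"
    using mult_strict_right_mono[OF Elow q1] by linarith
  \<comment> \<open>The limiting exponent: with r = 1 / (N + 1 - N q) and b = \<open>bs\<close> the
    discriminant condition is an equality. \<open>g b > 0\<close> is the last inequality of the
    conclusion.\<close>
  define bs where "bs = - q * (N + 2 - N * q)"
  define g where "g = (\<lambda>b. (2 - q) * (2 * N - 2) - b - 2 * q - E * (b + 4) - (N + 1) * (1 - E - q))"
  have bs: "bs \<le> 0" using q z N by (simp add: bs_def)
  \<comment> \<open>Both products are nonnegative by \<open>y2\<close> and \<open>y1\<close>. The
    first can vanish only for q = 0, the second only for N q = 1, hence the case distinction
    below.\<close>
  have gid: "(2 - q) * g bs = (2 * N - 4 - bs) * (E * (1 - q) + 3 - 2 * q) + (1 - N * q) * (2 - q) * (1 - q - E)"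
    by (simp add: g_def bs_def algebra_simps power2_eq_square)
  have gpos: "g bs > 0"
  proof -
    have n1: "0 \<le> (1 - N * q) * (2 - q) * (1 - q - E)"
      using z qh y1 by (intro mult_nonneg_nonneg) auto
    have n2: "0 \<le> (2 * N - 4 - bs) * (E * (1 - q) + 3 - 2 * q)"
      using N bs y2 by (intro mult_nonneg_nonneg) auto
    have "0 < (2 - q) * g bs"
    proof (cases "q = 0")
      case True
      then have "0 < (1 - N * q) * (2 - q) * (1 - q - E)" using y1 by simp
      then show ?thesis unfolding gid using n2 by linarith
    next
      case False
      then have "bs < 0" using q z N by (simp add: bs_def mult_pos_pos)
      then have "0 < (2 * N - 4 - bs) * (E * (1 - q) + 3 - 2 * q)"
        using N y2 by (intro mult_pos_pos) auto
      then show ?thesis unfolding gid using n1 by linarith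
    qed
    then show ?thesis using qh by (simp add: zero_less_mult_iff)
  qed
  have Pbound: "(N - 2 - E) * (1 - 1 / (N + 1 - N * q)) < N"
  proof -
    have nz: "N + 1 - N * q > 0" using z N by linarith
    have "(N - 2 - E) * (1 - q) < N * (1 - q) + 1" using y2 by (simp add: algebra_simps)
    then have "N * ((N - 2 - E) * (1 - q)) < N * (N * (1 - q) + 1)" using N by simp
    then have "(N - 2 - E) * (N - N * q) < N * (N + 1 - N * q)" by (simp add: algebra_simps)
    moreover have "(1 - 1 / (N + 1 - N * q)) = (N - N * q) / (N + 1 - N * q)"
      using nz by (simp add: field_simps)
    ultimately show ?thesis using nz by (simp add: divide_less_eq)
  qed
  show thesis
  proof (cases "q = 0")
    case True
    \<comment> \<open>For q = 0 the limiting exponent is 0 and moving off it as in the other case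
      would make b positive. So b = 0 is kept, and the discriminant condition becomes r < 1 / (N +
      1).\<close>
    have "((\<lambda>r. (N - 2 - E) * (1 - r)) \<longlongrightarrow> (N - 2 - E) * (1 - 1 / (N + 1))) (at_left (1 / (N + 1)))"
      by (intro tendsto_intros)
    then have "eventually (\<lambda>r. (N - 2 - E) * (1 - r) < N) (at_left (1 / (N + 1)))"
      by (rule order_tendstoD) (use Pbound True in simp)
    moreover have "eventually (\<lambda>r. r \<in> {0<..<1 / (N + 1)}) (at_left (1 / (N + 1)))"
      by (rule eventually_at_left_field[THEN iffD2]) (use N in \<open>auto intro!: exI[of _ 0]\<close>)
    ultimately have "eventually (\<lambda>r. (N - 2 - E) * (1 - r) < N \<and> r \<in> {0<..<1 / (N + 1)}) (at_left (1 / (N + 1)))"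
      by eventually_elim auto
    then obtain r where r: "(N - 2 - E) * (1 - r) < N" "0 < r" "r < 1 / (N + 1)"
      using eventually_happens by (fastforce simp: trivial_limit_at_left_real)
    have r': "r * (N + 1) < 1" using r N by (simp add: field_simps)
    then have r'': "N * r < 1" using r N by (simp add: algebra_simps)
    show thesis
    proof (rule that[of 0 r])
      show "0 < (N + 1) / N + 0" using N by simp
      have "4 * ((N + 1) / N + 0) * (1 / N - r) - (- 2 / N)\<^sup>2 = 4 * (1 - r * (N + 1)) / N"
        using N by (simp add: field_simps power2_eq_square)
      also have "\<dots> > 0" using r' N by simp
      finally show "(- 2 / N + q - r * (q + 0))\<^sup>2 < 4 * ((N + 1) / N + 0) * (1 / N - r)" using True by simp
      show "(N + 1) * (1 - E - q) < (2 - q) * (2 * N - 2) - 0 - 2 * q - E * (0 + 4)"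
        using gpos True by (simp add: g_def bs_def)
    qed (use r r'' N True in auto)
  next
    case False
    (* In the one-parameter family b = B x, r = 1 / (N (1 + x)) the discriminant condition is an
       equality at x = w and strict for x > w; the other conditions are open and hold at x = w. *)
    define w where "w = 1 / N - q"
    have w0: "w \<ge> 0" using q by (simp add: w_def)
    have q_w: "q = 1 / N - w" by (simp add: w_def)
    \<comment> \<open>The h^2 coefficient becomes N x (1 + x) and the F^2 coefficient x / (N (1 +
      x)). Four times their product is (2 x)^2, so the discriminant condition reduces to a bound on
      the mixed coefficient by 2 x.\<close>
    define B where "B = (\<lambda>x. N * x * (1 + x) - (N + 1) / N)"
    have Bw: "B w = bs" unfolding B_def bs_def w_def using N by (simp add: field_simps power2_eq_square)
    have bs0: "bs < 0" using q z N False by (simp add: bs_def mult_pos_pos)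
    have tB: "(B \<longlongrightarrow> B w) (at_right w)" unfolding B_def by (intro tendsto_intros)
    have tg: "((\<lambda>x. g (B x)) \<longlongrightarrow> g (B w)) (at_right w)" unfolding g_def by (intro tendsto_intros tB)
    have tP: "((\<lambda>x. (N - 2 - E) * (1 - 1 / (N * (1 + x)))) \<longlongrightarrow> (N - 2 - E) * (1 - 1 / (N * (1 + w)))) (at_right w)"
      by (intro tendsto_intros) (use N w0 in auto)
    have Nw: "N * (1 + w) = N + 1 - N * q" using N by (simp add: w_def field_simps)
    have ev: "eventually (\<lambda>x. B x < 0 \<and> g (B x) > 0 \<and> (N - 2 - E) * (1 - 1 / (N * (1 + x))) < N \<and> w < x) (at_right w)"
      using order_tendstoD(2)[OF tB, unfolded Bw, OF bs0] order_tendstoD(1)[OF tg, unfolded Bw, OF gpos]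
        order_tendstoD(2)[OF tP, unfolded Nw, OF Pbound] eventually_at_right_less[of w]
      by eventually_elim auto
    then obtain x where x: "B x < 0" "g (B x) > 0" "(N - 2 - E) * (1 - 1 / (N * (1 + x))) < N" "w < x"
      using eventually_happens by (fastforce simp: trivial_limit_at_right_real)
    have x0: "x > 0" using x w0 by linarith
    define r where "r = 1 / (N * (1 + x))"
    have r0: "r > 0" using N x0 by (simp add: r_def)
    have Nr: "N * r = 1 / (1 + x)" using N by (simp add: r_def)
    have Nr1: "N * r \<le> 1" using x0 by (simp add: Nr)
    show thesis
    proof (rule that[of "B x" r])
      show "0 < (N + 1) / N + B x" using N x0 by (simp add: B_def)
      show "B x \<le> 0" using x by simp
      show "0 < r" by fact
      show "N * r \<le> 1" by fact
      have e1: "4 * ((N + 1) / N + B x) * (1 / N - r) = (2 * x)\<^sup>2"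
      proof -
        have "(N + 1) / N + B x = N * x * (1 + x)" by (simp add: B_def)
        moreover have "1 / N - r = x / (N * (1 + x))"
        proof -
          have "1 / N = (1 + x) / (N * (1 + x))" using x0 by simp
          then show ?thesis
            unfolding r_def by (simp only: diff_divide_distrib[symmetric] add_diff_cancel_left')
        qed
        ultimately show ?thesis using N x0 by (simp add: power2_eq_square)
      qed
      have e2: "- 2 / N + q - r * (q + B x) = - (x + x * (1 + w) / (N * (1 + x)) + w * (1 - 1 / N))"
        unfolding q_w B_def r_def using N x0 by (simp add: divide_simps) (simp add: algebra_simps)
      have "x * (1 + w) / (N * (1 + x)) \<le> x / N"
      proof -
        have "x * (1 + w) / (N * (1 + x)) \<le> x * (1 + x) / (N * (1 + x))"
          using N x0 x(4) by (intro divide_right_mono mult_left_mono) auto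
        also have "\<dots> = x / N" using x0 by simp
        finally show ?thesis .
      qed
      moreover have "w * (1 - 1 / N) < x * (1 - 1 / N)"
        using x N by (intro mult_strict_right_mono) auto
      moreover have "x * (1 - 1 / N) = x - x / N" by (simp add: algebra_simps)
      ultimately have lt: "x + x * (1 + w) / (N * (1 + x)) + w * (1 - 1 / N) < 2 * x" by linarith
      have "0 \<le> x + x * (1 + w) / (N * (1 + x)) + w * (1 - 1 / N)"
        using N x0 w0 by (intro add_nonneg_nonneg mult_nonneg_nonneg divide_nonneg_nonneg) auto
      then show "(- 2 / N + q - r * (q + B x))\<^sup>2 < 4 * ((N + 1) / N + B x) * (1 / N - r)"
        unfolding e1 e2 using lt by (simp only: power2_minus) (intro power_strict_mono, auto)
      have "B x \<ge> bs"
      proof -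
        have "w * (1 + w) \<le> x * (1 + x)" using w0 x(4) by (intro mult_mono) auto
        then have "N * (w * (1 + w)) \<le> N * (x * (1 + x))" using N by simp
        then show ?thesis unfolding Bw[symmetric] B_def by (simp add: mult.assoc)
      qed
      \<comment> \<open>The summand N q cancels against \<open>2 - N * q\<close>, and the two
        halves, this one and the one in \<open>1 / 2 - B x\<close>, add up to the admissible total
        3.\<close>
      moreover have "- bs \<le> N * q + 1 / 2"
      proof -
        have "2 * q\<^sup>2 \<le> N * q\<^sup>2" using N by (intro mult_right_mono) auto
        moreover have "0 \<le> (1 - 2 * q)\<^sup>2" by simp
        ultimately show ?thesis by (simp add: bs_def algebra_simps power2_eq_square)
      qed
      ultimately have Bx: "- B x \<le> N * q + 1 / 2" by linarith
      have "N * r * (1 / 2 - B x) \<le> 1 * (1 / 2 - B x)"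
        using Nr1 x by (intro mult_right_mono) auto
      then have "2 - N * q + N * r * (1 / 2 - B x) \<le> 2 - N * q + (1 / 2 - B x)" by simp
      also have "\<dots> \<le> 3" using Bx by simp
      finally show "2 - N * q + N * r * (1 / 2 - B x) \<le> 3" .
      show "(N - 2 - E) * (1 - r) < N" using x by (simp add: r_def)
      show "(N + 1) * (1 - E - q) < (2 - q) * (2 * N - 2) - B x - 2 * q - E * (B x + 4)"
        using x by (simp add: g_def)
    qed
  qed
qed

section \<open>Positivity of the quadratic form\<close>

text \<open>The constant is determinant over trace, a lower bound for the smaller eigenvalue;
  completing the square in \<open>x\<close> verifies it.\<close>

lemma quadratic_form_coercive:
  fixes A B C :: real
  assumes "0 < A" "B\<^sup>2 < 4 * A * C"
  obtains c where "0 < c" "\<And>x y. c * (x\<^sup>2 + y\<^sup>2) \<le> A * x\<^sup>2 + B * (x * y) + C * y\<^sup>2"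
proof
  have "0 < 4 * A * C" using assms(2) zero_le_power2[of B] by linarith
  then have C: "0 < C" using assms(1) by (simp add: zero_less_mult_iff)
  define c where "c = (4 * A * C - B\<^sup>2) / (4 * (A + C))"
  have AC: "A + C > 0" using assms(1) C by simp
  show c: "0 < c" using assms AC by (simp add: c_def)
  have cAC: "4 * (c * (A + C)) = 4 * A * C - B\<^sup>2" using AC by (simp add: c_def field_simps)
  have cA: "c < A"
  proof -
    have "c * (A + C) \<le> A * C" using cAC zero_le_power2[of B] by linarith
    also have "\<dots> < A * (A + C)" using assms(1) by simp
    finally show ?thesis using AC by simp
  qed
  fix x y :: real
  have "(A - c) * (A * x\<^sup>2 + B * (x * y) + C * y\<^sup>2 - c * (x\<^sup>2 + y\<^sup>2))
      = ((A - c) * x + B / 2 * y)\<^sup>2 + c\<^sup>2 * y\<^sup>2 + y\<^sup>2 / 4 * (4 * A * C - B\<^sup>2 - 4 * (c * (A + C)))"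
    by (simp add: algebra_simps power2_eq_square)
  also have "\<dots> \<ge> 0" unfolding cAC by simp
  finally have "0 \<le> A * x\<^sup>2 + B * (x * y) + C * y\<^sup>2 - c * (x\<^sup>2 + y\<^sup>2)"
    using cA by (simp add: zero_le_mult_iff)
  then show "c * (x\<^sup>2 + y\<^sup>2) \<le> A * x\<^sup>2 + B * (x * y) + C * y\<^sup>2" by simp
qed

text \<open>Compare with the convex combination, weighted by \<Theta>, of the form for b = r = 0 and
  the form for the full b and r. The mixed coefficient is quadratic in \<Theta>; its deviation from
  linearity is charged to the first form. The effect of \<kappa> < 1 carries the factor
  \<open>\<Theta> * (1 - \<kappa>)\<close> and is absorbed.\<close>

lemma weighted_form_coercive:
  fixes N q b r :: real
  assumes N: "2 \<le> N" and q: "0 \<le> q" "N * q \<le> 1" and b: "0 < (N + 1) / N + b" "b \<le> 0"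
    and r: "0 < r" "N * r \<le> 1"
    and disc: "(- 2 / N + q - r * (q + b))\<^sup>2 < 4 * ((N + 1) / N + b) * (1 / N - r)"
    and le3: "2 - N * q + N * r * (1 / 2 - b) \<le> 3"
  obtains c where "0 < c"
    "\<And>\<Theta> \<kappa> h F. 0 \<le> \<Theta> \<Longrightarrow> \<Theta> \<le> 1 \<Longrightarrow> 0 \<le> \<kappa> \<Longrightarrow> \<kappa> \<le> 1 \<Longrightarrow> \<Theta> * (1 - \<kappa>) \<le> c \<Longrightarrow>
      c * (h\<^sup>2 + F\<^sup>2) \<le> ((N + 1) / N + b * \<Theta> * \<kappa>) * h\<^sup>2
        + (- 2 / N - b * \<Theta> * \<kappa> + (1 - r * \<Theta>) * (b * \<Theta> * \<kappa> + q) - r / 2 * \<Theta> * (1 - \<Theta>) * \<kappa>) * (h * F)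
        + (1 / N - r * \<Theta>) * F\<^sup>2"
proof -
  have D: "0 < (N + 1) / N + b" by (rule b(1))
  obtain c1 where c1: "0 < c1" "\<And>x y. c1 * (x\<^sup>2 + y\<^sup>2) \<le> ((N + 1) / N + b) * x\<^sup>2
      + (- 2 / N + q - r * (q + b)) * (x * y) + (1 / N - r) * y\<^sup>2"
    using quadratic_form_coercive[OF D disc] by blast
  \<comment> \<open>This is 9 < 4 (N + 1), true from N = 2 on: the slack in the unweighted form that
    allows for the error in its mixed coefficient.\<close>
  have "(- 3 / N)\<^sup>2 < 4 * ((N + 1) / N) * (1 / N)"
    using N by (simp add: power2_eq_square divide_simps)
  moreover have "0 < (N + 1) / N" using N by simp
  ultimately obtain c0 where c0: "0 < c0" "\<And>x y. c0 * (x\<^sup>2 + y\<^sup>2) \<le> (N + 1) / N * x\<^sup>2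
      + - 3 / N * (x * y) + 1 / N * y\<^sup>2"
    using quadratic_form_coercive[of "(N + 1) / N" "- 3 / N" "1 / N"] by blast
  define c where "c = min c0 c1 / 2"
  have c: "0 < c" "2 * c \<le> c0" "2 * c \<le> c1" using c0 c1 by (auto simp: c_def)
  show thesis
  proof (rule that[OF c(1)])
    fix \<Theta> \<kappa> h F :: real
    assume \<Theta>: "0 \<le> \<Theta>" "\<Theta> \<le> 1" and l: "0 \<le> \<kappa>" "\<kappa> \<le> 1" and small: "\<Theta> * (1 - \<kappa>) \<le> c"
    \<comment> \<open>Mixed coefficient of the unweighted form plus the deviation. In
      \<open>b - 1 / 2\<close> the b stems from the product of (1 - r \<Theta>) and b \<Theta>, the
      1/2 from differentiating \<Theta>.\<close>
    define B0 where "B0 = - 2 / N + q + r * \<Theta> * (b - 1 / 2)"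
    have B0: "\<bar>B0\<bar> \<le> 3 / N"
    proof -
      have i: "r * \<Theta> * (1 / 2 - b) \<le> r * (1 / 2 - b)" "0 \<le> r * \<Theta> * (1 / 2 - b)"
        using \<Theta> r b by (auto intro!: mult_right_mono mult_left_le)
      have "(2 - N * q + N * r * (1 / 2 - b)) / N \<le> 3 / N"
        using le3 N by (intro divide_right_mono) auto
      then have "2 / N - q + r * (1 / 2 - b) \<le> 3 / N"
        using N by (simp add: add_divide_distrib diff_divide_distrib)
      moreover have "q \<le> 1 / N" using q N by (simp add: field_simps)
      moreover have "B0 = - (2 / N - q + r * \<Theta> * (1 / 2 - b))"
        by (simp add: B0_def algebra_simps)
      moreover have "0 \<le> 1 / N" "2 / N = 1 / N + 1 / N" using N by auto
      ultimately show ?thesis using i by linarith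
    qed
    have f0: "2 * c * (h\<^sup>2 + F\<^sup>2) \<le> (N + 1) / N * h\<^sup>2 + B0 * (h * F) + 1 / N * F\<^sup>2"
    proof -
      have "\<bar>B0 * (h * F)\<bar> \<le> 3 / N * \<bar>h * F\<bar>"
        unfolding abs_mult[of B0] by (intro mult_right_mono B0) auto
      then have "- (3 / N * (\<bar>h\<bar> * \<bar>F\<bar>)) \<le> B0 * (h * F)" unfolding abs_mult[of h] by linarith
      moreover have "c0 * (h\<^sup>2 + F\<^sup>2) \<le> (N + 1) / N * h\<^sup>2 - 3 / N * (\<bar>h\<bar> * \<bar>F\<bar>) + 1 / N * F\<^sup>2"
        using c0(2)[of "\<bar>h\<bar>" "\<bar>F\<bar>"] by simp
      moreover have "2 * c * (h\<^sup>2 + F\<^sup>2) \<le> c0 * (h\<^sup>2 + F\<^sup>2)"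
        using c by (intro mult_right_mono) auto
      ultimately show ?thesis by linarith
    qed
    have f1: "2 * c * (h\<^sup>2 + F\<^sup>2) \<le> ((N + 1) / N + b) * h\<^sup>2 + (- 2 / N + q - r * (q + b)) * (h * F) + (1 / N - r) * F\<^sup>2"
    proof -
      have "2 * c * (h\<^sup>2 + F\<^sup>2) \<le> c1 * (h\<^sup>2 + F\<^sup>2)"
        using c by (intro mult_right_mono) auto
      then show ?thesis using c1(2)[of h F] by linarith
    qed
    \<comment> \<open>\<open>\<Theta> * B2\<close> is the change of the mixed coefficient per unit
      of \<open>1 - \<kappa>\<close>. The corresponding change in h^2 is favourable because b is not
      positive.\<close>
    define B2 where "B2 = r * b * \<Theta> + r / 2 * (1 - \<Theta>)"
    have B2: "\<bar>B2\<bar> \<le> 1"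
    proof -
      have rN: "r \<le> 1 / 2"
      proof -
        have "2 * r \<le> N * r" using N r by (intro mult_right_mono) auto
        then show ?thesis using r by linarith
      qed
      have "b \<ge> - 3 / 2"
      proof -
        have "(N + 1) / N \<le> 3 / 2" using N by (simp add: field_simps)
        then show ?thesis using D by linarith
      qed
      then have "\<bar>b\<bar> * (r * \<Theta>) \<le> 3 / 2 * (1 / 2 * 1)"
        using b r rN \<Theta> by (intro mult_mono) auto
      moreover have "\<bar>r * b * \<Theta>\<bar> = \<bar>b\<bar> * (r * \<Theta>)" using r \<Theta> by (simp add: abs_mult)
      moreover have "0 \<le> r / 2 * (1 - \<Theta>)" "r / 2 * (1 - \<Theta>) \<le> r / 2 * 1"
        using r \<Theta> by (auto intro!: mult_left_mono simp del: mult_1_right)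
      ultimately show ?thesis unfolding B2_def using rN by linarith
    qed
    have e2: "- (c * (h\<^sup>2 + F\<^sup>2)) \<le> (1 - \<kappa>) * (- b * \<Theta> * h\<^sup>2 + \<Theta> * B2 * (h * F))"
    proof -
      have "\<bar>B2 * (h * F)\<bar> \<le> 1 * \<bar>h * F\<bar>"
        unfolding abs_mult[of B2] by (intro mult_right_mono B2) auto
      moreover have "2 * \<bar>h * F\<bar> \<le> h\<^sup>2 + F\<^sup>2"
        using zero_le_power2[of "\<bar>h\<bar> - \<bar>F\<bar>"] by (simp add: power2_diff abs_mult)
      moreover have "0 \<le> h\<^sup>2 + F\<^sup>2" by simp
      ultimately have "- (h\<^sup>2 + F\<^sup>2) \<le> B2 * (h * F)" by linarith
      then have "\<Theta> * (1 - \<kappa>) * (- (h\<^sup>2 + F\<^sup>2)) \<le> \<Theta> * (1 - \<kappa>) * (B2 * (h * F))"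
        using \<Theta> l by (intro mult_left_mono) auto
      moreover have "\<Theta> * (1 - \<kappa>) * (h\<^sup>2 + F\<^sup>2) \<le> c * (h\<^sup>2 + F\<^sup>2)"
        using small by (intro mult_right_mono) auto
      moreover have "0 \<le> (1 - \<kappa>) * (- b * \<Theta> * h\<^sup>2)" using b \<Theta> l by (intro mult_nonneg_nonneg) auto
      ultimately show ?thesis by (simp add: algebra_simps)
    qed
    have "(1 - \<Theta>) * (2 * c * (h\<^sup>2 + F\<^sup>2)) \<le> (1 - \<Theta>) * ((N + 1) / N * h\<^sup>2 + B0 * (h * F) + 1 / N * F\<^sup>2)"
      using f0 \<Theta> by (intro mult_left_mono) auto
    moreover have "\<Theta> * (2 * c * (h\<^sup>2 + F\<^sup>2)) \<le> \<Theta> * (((N + 1) / N + b) * h\<^sup>2 + (- 2 / N + q - r * (q + b)) * (h * F) + (1 / N - r) * F\<^sup>2)"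
      using f1 \<Theta> by (intro mult_left_mono) auto
    moreover have "((N + 1) / N + b * \<Theta> * \<kappa>) * h\<^sup>2
        + (- 2 / N - b * \<Theta> * \<kappa> + (1 - r * \<Theta>) * (b * \<Theta> * \<kappa> + q) - r / 2 * \<Theta> * (1 - \<Theta>) * \<kappa>) * (h * F)
        + (1 / N - r * \<Theta>) * F\<^sup>2
      = (1 - \<Theta>) * ((N + 1) / N * h\<^sup>2 + B0 * (h * F) + 1 / N * F\<^sup>2)
        + \<Theta> * (((N + 1) / N + b) * h\<^sup>2 + (- 2 / N + q - r * (q + b)) * (h * F) + (1 / N - r) * F\<^sup>2)
        + (1 - \<kappa>) * (- b * \<Theta> * h\<^sup>2 + \<Theta> * B2 * (h * F))"
      unfolding B0_def B2_def by algebra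
    moreover have "(1 - \<Theta>) * (2 * c * (h\<^sup>2 + F\<^sup>2)) + \<Theta> * (2 * c * (h\<^sup>2 + F\<^sup>2)) = 2 * (c * (h\<^sup>2 + F\<^sup>2))"
      by algebra
    ultimately show "c * (h\<^sup>2 + F\<^sup>2) \<le> ((N + 1) / N + b * \<Theta> * \<kappa>) * h\<^sup>2
        + (- 2 / N - b * \<Theta> * \<kappa> + (1 - r * \<Theta>) * (b * \<Theta> * \<kappa> + q) - r / 2 * \<Theta> * (1 - \<Theta>) * \<kappa>) * (h * F)
        + (1 / N - r * \<Theta>) * F\<^sup>2"
      using e2 by linarith
  qed
qed

text \<open>Pointwise algebra of the energy estimate. With e = Du / |Du|, h stands for the
  e-component of D^2u e, \<open>T\<close> for the squared length of the rest, \<open>HH\<close> for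
  |D^2u|^2, \<open>w\<close> for |Du|, \<kappa> for |Du|^2 / (|Du|^2 + \<delta>); \<alpha> and
  \<beta> come from the gradient of the cut-off \<rho>. The two subtracted terms are the price of
  the cut-off and of \<Theta> < 1 in the K F coefficient.\<close>

lemma integrand_lower_bound:
  fixes N q b r E :: real
  assumes N: "2 \<le> N" and q: "0 \<le> q" "N * q \<le> 1" and b: "0 < (N + 1) / N + b" "b \<le> 0"
    and r: "0 < r" "N * r \<le> 1"
    and disc: "(- 2 / N + q - r * (q + b))\<^sup>2 < 4 * ((N + 1) / N + b) * (1 / N - r)"
    and le3: "2 - N * q + N * r * (1 / 2 - b) \<le> 3"
    and P: "(N - 2 - E) * (1 - r) < N"
  obtains c \<eta> where "0 < c" "0 < \<eta>" "\<eta> \<le> 1"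
    "\<And>\<Theta> \<kappa> h F K T HH \<rho> \<psi> w \<alpha> \<beta> \<Gamma>. 0 \<le> \<Theta> \<Longrightarrow> \<Theta> \<le> 1 \<Longrightarrow> 0 \<le> \<kappa> \<Longrightarrow> \<kappa> \<le> 1 \<Longrightarrow> \<Theta> * (1 - \<kappa>) \<le> c \<Longrightarrow>
      0 \<le> F \<Longrightarrow> 0 \<le> K \<Longrightarrow> 0 \<le> T \<Longrightarrow> 0 \<le> \<rho> \<Longrightarrow> 0 \<le> \<psi> \<Longrightarrow> 0 \<le> w \<Longrightarrow> 0 \<le> \<Gamma> \<Longrightarrow>
      \<alpha>\<^sup>2 \<le> \<rho> * \<Gamma> \<Longrightarrow> \<beta>\<^sup>2 \<le> \<rho> * \<Gamma> * T \<Longrightarrow> h\<^sup>2 + 2 * T + (N * K + F - h)\<^sup>2 / N \<le> HH \<Longrightarrow>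
      \<rho> * \<psi> * (c * (F\<^sup>2 + K\<^sup>2)) - \<psi> * w\<^sup>2 * \<Gamma> / c - \<bar>N - 2 - E\<bar> * (\<rho> * \<psi> * (1 - \<Theta>) * K * F)
      \<le> \<rho> * \<psi> * (HH - (N * K + F)\<^sup>2 + (2 - 2 * N) * K * (h - (N * K + F))
            + b * \<Theta> * \<kappa> * (h\<^sup>2 + T - (N * K + F) * h)
            + (1 - r * \<Theta>) * F * ((2 - 2 * N + E) * K + b * \<Theta> * \<kappa> * h + (N * K + F) + q * h)
            - r / 2 * \<Theta> * (1 - \<Theta>) * \<kappa> * h * F
            + (N - \<eta>) * K * ((1 - 2 * N) * K + b * \<Theta> * \<kappa> * h + 2 * h + (N * K + F)))
        + \<psi> * w * (\<beta> + \<alpha> * (h - (N * K + F) + (1 - r * \<Theta>) * F + (N - \<eta>) * K))"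
proof -
  obtain c0 where c0: "0 < c0" and form: "\<And>\<Theta> \<kappa> h F. 0 \<le> \<Theta> \<Longrightarrow> \<Theta> \<le> 1 \<Longrightarrow> 0 \<le> \<kappa> \<Longrightarrow> \<kappa> \<le> 1 \<Longrightarrow> \<Theta> * (1 - \<kappa>) \<le> c0 \<Longrightarrow>
      c0 * (h\<^sup>2 + F\<^sup>2) \<le> ((N + 1) / N + b * \<Theta> * \<kappa>) * h\<^sup>2
        + (- 2 / N - b * \<Theta> * \<kappa> + (1 - r * \<Theta>) * (b * \<Theta> * \<kappa> + q) - r / 2 * \<Theta> * (1 - \<Theta>) * \<kappa>) * (h * F)
        + (1 / N - r * \<Theta>) * F\<^sup>2"
    using weighted_form_coercive[OF N q b r disc le3] by blast
  define \<eta> where "\<eta> = min (min 1 (c0 / 4)) (N - (N - 2 - E) * (1 - r))"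
  have \<eta>: "0 < \<eta>" "\<eta> \<le> 1" "4 * \<eta> \<le> c0" "\<eta> \<le> N - (N - 2 - E) * (1 - r)"
    using c0 P by (simp_all add: \<eta>_def min_def)
  define k where "k = \<eta> / 4"
  have k: "0 < k" "4 * k \<le> \<eta>" using \<eta> by (auto simp: k_def)
  define c where "c = k / 2"
  have c: "0 < c" "c \<le> c0" "c \<le> k" using k \<eta> by (auto simp: c_def)
  have b3: "- 3 / 2 < b"
  proof -
    have "(N + 1) / N \<le> 3 / 2" using N by (simp add: field_simps)
    then show ?thesis using b by linarith
  qed
  show thesis
  proof (rule that[OF c(1) \<eta>(1,2)])
    fix \<Theta> \<kappa> h F K T HH \<rho> \<psi> w \<alpha> \<beta> \<Gamma> :: real
    assume \<Theta>: "0 \<le> \<Theta>" "\<Theta> \<le> 1" and l: "0 \<le> \<kappa>" "\<kappa> \<le> 1" and small: "\<Theta> * (1 - \<kappa>) \<le> c"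
      and nn: "0 \<le> F" "0 \<le> K" "0 \<le> T" "0 \<le> \<rho>" "0 \<le> \<psi>" "0 \<le> w" "0 \<le> \<Gamma>"
      and \<alpha>: "\<alpha>\<^sup>2 \<le> \<rho> * \<Gamma>" and \<beta>: "\<beta>\<^sup>2 \<le> \<rho> * \<Gamma> * T"
      and HH: "h\<^sup>2 + 2 * T + (N * K + F - h)\<^sup>2 / N \<le> HH"
    define y where "y = b * \<Theta> * \<kappa>"
    have \<Theta>l: "0 \<le> \<Theta> * \<kappa>" "\<Theta> * \<kappa> \<le> 1" using \<Theta> l by (auto intro: mult_le_one)
    have y: "- 3 / 2 \<le> y" "y \<le> 0"
    proof -
      have "- y = (- b) * (\<Theta> * \<kappa>)" by (simp add: y_def)
      also have "\<dots> \<le> (- b) * 1" using b \<Theta>l by (intro mult_left_mono) auto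
      finally show "- 3 / 2 \<le> y" using b3 by linarith
      show "y \<le> 0" using b \<Theta>l by (simp add: y_def mult.assoc mult_nonpos_nonneg)
    qed
    define Q where "Q = HH - (N * K + F)\<^sup>2 + (2 - 2 * N) * K * (h - (N * K + F))
            + y * (h\<^sup>2 + T - (N * K + F) * h)
            + (1 - r * \<Theta>) * F * ((2 - 2 * N + E) * K + y * h + (N * K + F) + q * h)
            - r / 2 * \<Theta> * (1 - \<Theta>) * \<kappa> * h * F
            + (N - \<eta>) * K * ((1 - 2 * N) * K + y * h + 2 * h + (N * K + F))"
    define Q1 where "Q1 = ((N + 1) / N + y) * h\<^sup>2
        + (- 2 / N - y + (1 - r * \<Theta>) * (y + q) - r / 2 * \<Theta> * (1 - \<Theta>) * \<kappa>) * (h * F)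
        + (1 / N - r * \<Theta>) * F\<^sup>2"
    \<comment> \<open>All K^2 terms cancel except \<eta> (N - 1) K^2, and the K h terms cancel
      except one with factor \<eta>.\<close>
    have Qeq: "Q = (HH - (h\<^sup>2 + 2 * T + (N * K + F - h)\<^sup>2 / N)) + Q1 + (2 + y) * T + \<eta> * (N - 1) * K\<^sup>2
        - \<eta> * (2 + y) * (K * h) + (N - \<eta> - (N - 2 - E) * (1 - r * \<Theta>)) * (K * F)"
    proof -
      have "(N * K + F - h)\<^sup>2 / N = N * K\<^sup>2 + F\<^sup>2 / N + h\<^sup>2 / N + 2 * K * F - 2 * K * h - 2 * (F * h) / N"
        using N by (simp add: power2_eq_square field_simps)
      moreover have "(N + 1) / N = 1 + 1 / N" using N by (simp add: field_simps)
      ultimately show ?thesis unfolding Q_def Q1_def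
        by (simp add: algebra_simps power2_eq_square diff_divide_distrib add_divide_distrib)
    qed
    have "c0 * (h\<^sup>2 + F\<^sup>2) \<le> Q1"
      unfolding Q1_def y_def using form[OF \<Theta> l, of h F] small c by simp
    moreover have "T / 2 \<le> (2 + y) * T" using y nn mult_right_mono[of "1 / 2" "2 + y" T] by simp
    moreover have "\<eta> * (2 + y) * (K * h) \<le> \<eta> * (K\<^sup>2 / 2 + 2 * h\<^sup>2)"
    proof -
      have "(2 + y) * (K * h) \<le> (2 + y) * (K * \<bar>h\<bar>)"
        using y nn by (intro mult_left_mono) auto
      also have "\<dots> \<le> 2 * (K * \<bar>h\<bar>)" using y nn by (intro mult_right_mono) auto
      also have "\<dots> \<le> K\<^sup>2 / 2 + 2 * h\<^sup>2"
        using zero_le_power2[of "K - 2 * \<bar>h\<bar>"] by (simp add: power2_diff power_mult_distrib)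
      finally show ?thesis using \<eta> by (simp add: mult.assoc mult_left_mono)
    qed
    moreover have "\<eta> * K\<^sup>2 \<le> \<eta> * (N - 1) * K\<^sup>2" using \<eta> N by (intro mult_right_mono) auto
    moreover have "- (\<bar>N - 2 - E\<bar> * ((1 - \<Theta>) * (K * F))) \<le> (N - \<eta> - (N - 2 - E) * (1 - r * \<Theta>)) * (K * F)"
    proof -
      have "r \<le> 1"
      proof -
        have "2 * r \<le> N * r" using N r by (intro mult_right_mono) auto
        then show ?thesis using r by linarith
      qed
      then have "(N - 2 - E) * (r * (1 - \<Theta>)) \<le> \<bar>N - 2 - E\<bar> * (1 * (1 - \<Theta>))"
        using r \<Theta> by (intro mult_mono) auto
      moreover have "(N - 2 - E) * (1 - r * \<Theta>) = (N - 2 - E) * (1 - r) + (N - 2 - E) * (r * (1 - \<Theta>))"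
        by (simp add: algebra_simps)
      ultimately have "- (\<bar>N - 2 - E\<bar> * (1 - \<Theta>)) \<le> N - \<eta> - (N - 2 - E) * (1 - r * \<Theta>)"
        using \<eta> by linarith
      then have "- (\<bar>N - 2 - E\<bar> * (1 - \<Theta>)) * (K * F) \<le> (N - \<eta> - (N - 2 - E) * (1 - r * \<Theta>)) * (K * F)"
        using nn by (intro mult_right_mono) auto
      then show ?thesis by (simp add: mult.assoc)
    qed
    moreover have "4 * \<eta> * (h\<^sup>2 + F\<^sup>2) \<le> c0 * (h\<^sup>2 + F\<^sup>2)" using \<eta> by (intro mult_right_mono) auto
    moreover have "0 \<le> \<eta> * F\<^sup>2" "0 \<le> \<eta> * h\<^sup>2" "0 \<le> \<eta> * K\<^sup>2" "\<eta> * T \<le> T" using \<eta> nn by (auto intro: mult_left_le_one_le)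
    ultimately have Qlow: "\<eta> / 2 * (h\<^sup>2 + F\<^sup>2 + T + K\<^sup>2) - \<bar>N - 2 - E\<bar> * ((1 - \<Theta>) * (K * F)) \<le> Q"
      unfolding Qeq using HH by (simp add: algebra_simps)
    \<comment> \<open>The trace N K + F cancels here: \<open>w * X\<close> is the gradient of the
      cut-off tested against D^2u Du - r \<Theta> F Du - \<eta> K Du.\<close>
    define X where "X = \<beta> + \<alpha> * (h - r * \<Theta> * F - \<eta> * K)"
    have Xeq: "\<beta> + \<alpha> * (h - (N * K + F) + (1 - r * \<Theta>) * F + (N - \<eta>) * K) = X"
      by (simp add: X_def algebra_simps)
    have X2: "X\<^sup>2 \<le> 4 * (\<rho> * \<Gamma>) * (h\<^sup>2 + F\<^sup>2 + T + K\<^sup>2)"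
    proof -
      define f where "f = r * \<Theta> * F"
      define g where "g = \<eta> * K"
      have "r \<le> 1"
      proof -
        have "2 * r \<le> N * r" using N r by (intro mult_right_mono) auto
        then show ?thesis using r by linarith
      qed
      then have "f \<le> 1 * F" unfolding f_def using r \<Theta> nn by (intro mult_right_mono mult_le_one) auto
      then have f2: "f\<^sup>2 \<le> F\<^sup>2" unfolding f_def using r \<Theta> nn by (intro power_mono) auto
      have "g \<le> 1 * K" unfolding g_def using \<eta> nn by (intro mult_right_mono) auto
      then have g2: "g\<^sup>2 \<le> K\<^sup>2" unfolding g_def using \<eta> nn by (intro power_mono) auto
      have sq4: "(p1 + p2 + p3 + p4)\<^sup>2 \<le> 4 * (p1\<^sup>2 + p2\<^sup>2 + p3\<^sup>2 + p4\<^sup>2)" for p1 p2 p3 p4 :: real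
      proof -
        have "4 * (p1\<^sup>2 + p2\<^sup>2 + p3\<^sup>2 + p4\<^sup>2) - (p1 + p2 + p3 + p4)\<^sup>2
          = (p1 - p2)\<^sup>2 + (p1 - p3)\<^sup>2 + (p1 - p4)\<^sup>2 + (p2 - p3)\<^sup>2 + (p2 - p4)\<^sup>2 + (p3 - p4)\<^sup>2"
          by algebra
        then show ?thesis by (smt (verit) zero_le_power2)
      qed
      have "X = \<beta> + \<alpha> * h + (- (\<alpha> * f)) + (- (\<alpha> * g))" by (simp add: X_def f_def g_def algebra_simps)
      then have "X\<^sup>2 \<le> 4 * (\<beta>\<^sup>2 + (\<alpha> * h)\<^sup>2 + (- (\<alpha> * f))\<^sup>2 + (- (\<alpha> * g))\<^sup>2)"
        using sq4 by metis
      also have "\<dots> = 4 * (\<beta>\<^sup>2 + \<alpha>\<^sup>2 * (h\<^sup>2 + f\<^sup>2 + g\<^sup>2))" by (simp add: power_mult_distrib algebra_simps)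
      also have "\<dots> \<le> 4 * (\<rho> * \<Gamma> * T + \<rho> * \<Gamma> * (h\<^sup>2 + F\<^sup>2 + K\<^sup>2))"
        using \<alpha> \<beta> f2 g2 nn by (intro mult_left_mono add_mono mult_mono) auto
      finally show ?thesis by (simp add: algebra_simps)
    qed
    define Z where "Z = h\<^sup>2 + F\<^sup>2 + T + K\<^sup>2"
    have Z: "0 \<le> Z" using nn by (simp add: Z_def)
    \<comment> \<open>Cauchy-Schwarz with weights: half of the coercive term
      \<open>\<eta> / 2 * Z\<close> is spent on the cut-off.\<close>
    have "w * X \<ge> - (\<eta> / 4 * \<rho> * Z + 4 / \<eta> * w\<^sup>2 * \<Gamma>)"
    proof -
      define s where "s = \<eta> / 4 * \<rho> * Z + 4 / \<eta> * w\<^sup>2 * \<Gamma>"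
      have s: "0 \<le> s" using nn Z \<eta> by (simp add: s_def)
      have "(w * X)\<^sup>2 \<le> w\<^sup>2 * (4 * (\<rho> * \<Gamma>) * Z)"
        unfolding power_mult_distrib Z_def by (intro mult_left_mono X2) auto
      also have "\<dots> \<le> s\<^sup>2"
      proof -
        have "s\<^sup>2 - w\<^sup>2 * (4 * (\<rho> * \<Gamma>) * Z) = (\<eta> / 4 * \<rho> * Z - 4 / \<eta> * w\<^sup>2 * \<Gamma>)\<^sup>2"
          using \<eta> by (simp add: s_def power2_eq_square field_simps)
        then show ?thesis using zero_le_power2 by (smt (verit))
      qed
      finally have "\<bar>w * X\<bar> \<le> s" using s by (metis abs_le_square_iff abs_of_nonneg)
      then show ?thesis by (simp add: s_def)
    qed
    then have "\<psi> * (w * X) \<ge> \<psi> * - (\<eta> / 4 * \<rho> * Z + 4 / \<eta> * w\<^sup>2 * \<Gamma>)"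
      using nn by (intro mult_left_mono)
    moreover have "\<rho> * \<psi> * (\<eta> / 2 * Z - \<bar>N - 2 - E\<bar> * ((1 - \<Theta>) * (K * F))) \<le> \<rho> * \<psi> * Q"
      using Qlow nn unfolding Z_def by (intro mult_left_mono) auto
    moreover have "\<rho> * \<psi> * (c * (F\<^sup>2 + K\<^sup>2)) \<le> \<rho> * \<psi> * (\<eta> / 4 * Z)"
      using nn c k unfolding Z_def by (intro mult_left_mono mult_mono) (auto simp: k_def)
    moreover have "4 / \<eta> * (\<psi> * w\<^sup>2 * \<Gamma>) \<le> 1 / c * (\<psi> * w\<^sup>2 * \<Gamma>)"
      using nn \<eta> by (intro mult_right_mono) (auto simp: c_def k_def field_simps)
    ultimately have "\<rho> * \<psi> * (c * (F\<^sup>2 + K\<^sup>2)) - \<psi> * w\<^sup>2 * \<Gamma> / c - \<bar>N - 2 - E\<bar> * (\<rho> * \<psi> * (1 - \<Theta>) * K * F)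
        \<le> \<rho> * \<psi> * Q + \<psi> * w * X"
      by (simp add: algebra_simps)
    then show "\<rho> * \<psi> * (c * (F\<^sup>2 + K\<^sup>2)) - \<psi> * w\<^sup>2 * \<Gamma> / c - \<bar>N - 2 - E\<bar> * (\<rho> * \<psi> * (1 - \<Theta>) * K * F)
      \<le> \<rho> * \<psi> * (HH - (N * K + F)\<^sup>2 + (2 - 2 * N) * K * (h - (N * K + F))
            + b * \<Theta> * \<kappa> * (h\<^sup>2 + T - (N * K + F) * h)
            + (1 - r * \<Theta>) * F * ((2 - 2 * N + E) * K + b * \<Theta> * \<kappa> * h + (N * K + F) + q * h)
            - r / 2 * \<Theta> * (1 - \<Theta>) * \<kappa> * h * F
            + (N - \<eta>) * K * ((1 - 2 * N) * K + b * \<Theta> * \<kappa> * h + 2 * h + (N * K + F)))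
        + \<psi> * w * (\<beta> + \<alpha> * (h - (N * K + F) + (1 - r * \<Theta>) * F + (N - \<eta>) * K))"
      unfolding Xeq Q_def y_def .
  qed
qed

section \<open>The integral identity\<close>

lemma has_grad_cong: "has_grad f g \<Longrightarrow> (\<And>x. g x = g' x) \<Longrightarrow> has_grad f g'"
  by (simp add: has_grad_def)

text \<open>Splitting 2 (M - 1) as M + (M - 2) leaves one full factor of the cut-off for absorption
  into the coercive term; the other factor goes to Young's inequality.\<close>

lemma norm_bump_power_grad_le:
  fixes x :: "real ^ 'n::finite"
  assumes "2 \<le> M" "R > 0"
  shows "(norm ((- (2 * real M / R\<^sup>2) * bump R x ^ (M - 1)) *\<^sub>R x))\<^sup>2
    \<le> bump R x ^ M * (4 * (real M)\<^sup>2 / R\<^sup>2 * bump R x ^ (M - 2))"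
proof (cases "norm x \<le> R")
  case True
  have "(norm ((- (2 * real M / R\<^sup>2) * bump R x ^ (M - 1)) *\<^sub>R x))\<^sup>2
      = 4 * (real M)\<^sup>2 / R ^ 4 * (bump R x ^ (M - 1))\<^sup>2 * (norm x)\<^sup>2"
    by (simp only: norm_scaleR power_mult_distrib power2_abs) (simp add: power_mult_distrib power_divide flip: power_mult)
  also have "\<dots> \<le> 4 * (real M)\<^sup>2 / R ^ 4 * (bump R x ^ (M - 1))\<^sup>2 * R\<^sup>2"
    using True by (intro mult_left_mono power_mono) auto
  also have "\<dots> = 4 * (real M)\<^sup>2 / R\<^sup>2 * (bump R x ^ (M - 1))\<^sup>2"
    using assms by (simp add: power2_eq_square power4_eq_xxxx)
  also have "(bump R x ^ (M - 1))\<^sup>2 = bump R x ^ M * bump R x ^ (M - 2)"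
  proof -
    have "(M - 1) * 2 = M + (M - 2)" using assms by simp
    then show ?thesis by (metis power_mult power_add)
  qed
  finally show ?thesis by (simp add: mult_ac)
next
  case False
  then have "bump R x = 0" using assms by (intro bump_eq_zero) auto
  then show ?thesis using assms by (simp add: power_0_left)
qed

locale gradient_equation = hessian u U H
  for u :: "real ^ 'n::finite \<Rightarrow> real" and U :: "real ^ 'n \<Rightarrow> real ^ 'n" and H :: "real ^ 'n \<Rightarrow> real ^ 'n ^ 'n" +
  fixes N c E q :: real
  assumes dim: "real CARD('n) = N + 1" "2 \<le> N"
    and q_nonneg: "0 \<le> q" and c_pos: "0 < c" and u_pos: "\<And>x. 0 < u x"
    and equation: "\<And>x. trace (H x) = N * (U x \<bullet> U x) / u x + c * u x powr E * norm_powr (U x) q"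
begin

lemma has_grad_inner_U: "has_grad (\<lambda>x. U x \<bullet> U x) (\<lambda>x. 2 *\<^sub>R (H x *v U x))"
proof -
  have "has_grad (\<lambda>x. \<Sum>i\<in>UNIV. U x $ i * U x $ i) (\<lambda>x. \<Sum>i\<in>UNIV. U x $ i *\<^sub>R H x $ i + U x $ i *\<^sub>R H x $ i)"
    by (intro has_grad_sum has_grad_mult has_grad_U) auto
  moreover have "(\<lambda>x. \<Sum>i\<in>UNIV. U x $ i * U x $ i) = (\<lambda>x. U x \<bullet> U x)"
    by (simp add: inner_vec_def)
  moreover have "(\<Sum>i\<in>UNIV. U x $ i *\<^sub>R H x $ i + U x $ i *\<^sub>R H x $ i) = 2 *\<^sub>R (H x *v U x)" for x
  proof -
    have "(\<Sum>i\<in>UNIV. (U x $ i *\<^sub>R H x $ i + U x $ i *\<^sub>R H x $ i) $ j) = 2 * (\<Sum>i\<in>UNIV. H x $ j $ i * U x $ i)" for j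
      unfolding sum_distrib_left by (intro sum.cong refl) (simp add: symmetric[of x j] mult.commute)
    then show ?thesis by (simp add: vec_eq_iff matrix_vector_mult_def)
  qed
  ultimately show ?thesis by simp
qed

text \<open>\<open>source\<close> and \<open>kinetic\<close> are the F and K of the algebraic
  lemmas.\<close>

definition source :: "real ^ 'n \<Rightarrow> real" where
  "source x = c * u x powr E * norm_powr (U x) q"

definition kinetic :: "real ^ 'n \<Rightarrow> real" where
  "kinetic x = (U x \<bullet> U x) / u x"

lemma source_nonneg: "0 \<le> source x" and kinetic_nonneg: "0 \<le> kinetic x"
  using c_pos u_pos[of x] by (auto simp: source_def kinetic_def norm_powr_nonneg)

lemma trace_eq: "trace (H x) = N * kinetic x + source x"
  by (simp add: equation source_def kinetic_def)

lemma norm_powr_sub_two: "q * norm (U x) powr (q - 2) * (U x \<bullet> U x) = q * norm_powr (U x) q"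
  by (cases "U x = 0") (auto simp: norm_powr_def powr_diff power2_norm_eq_inner[symmetric] powr_realpow)

text \<open>Comparable to |Du|^(1/2), so its power 2 b replaces |Du|^b. The power 1/4 is the origin
  of the 1/2 in the condition \<open>2 - N * q + N * r * (1 / 2 - b) \<le> 3\<close>; with a square
  root it would be 1, and the estimate in \<open>weight_parameters\<close> would give 7/2, beyond
  the threshold 2 sqrt 3 of definiteness at N = 2.\<close>

definition root_scale :: "real \<Rightarrow> real ^ 'n \<Rightarrow> real" where
  "root_scale \<delta> x = (U x \<bullet> U x + \<delta>) powr (1 / 4)"

lemma root_scale_pos: "\<delta> > 0 \<Longrightarrow> root_scale \<delta> x > 0"
  using add_nonneg_pos[OF inner_ge_zero[of "U x"], of \<delta>] by (simp add: root_scale_def)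

lemma has_grad_root_scale:
  assumes "\<delta> > 0"
  shows "has_grad (root_scale \<delta>) (\<lambda>x. (root_scale \<delta> x / (2 * (U x \<bullet> U x + \<delta>))) *\<^sub>R (H x *v U x))"
proof -
  have pos: "0 < U x \<bullet> U x + \<delta>" for x using assms by (simp add: add_nonneg_pos)
  have S: "has_grad (\<lambda>x. U x \<bullet> U x + \<delta>) (\<lambda>x. 2 *\<^sub>R (H x *v U x))"
    using has_grad_add[OF has_grad_inner_U has_grad_const[of \<delta>]] by simp
  have "has_grad (\<lambda>x. (U x \<bullet> U x + \<delta>) powr (1 / 4))
      (\<lambda>x. (1 / 4 * (U x \<bullet> U x + \<delta>) powr (1 / 4 - 1)) *\<^sub>R (2 *\<^sub>R (H x *v U x)))"
    by (rule has_grad_powr[OF S pos])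
  moreover have "(U x \<bullet> U x + \<delta>) powr (1 / 4 - 1) = (U x \<bullet> U x + \<delta>) powr (1 / 4) / (U x \<bullet> U x + \<delta>)" for x
    using pos[of x] by (subst powr_diff) simp
  moreover have "(1 / 4 * (s / t)) *\<^sub>R (2 *\<^sub>R v) = (s / (2 * t)) *\<^sub>R v" for s t :: real and v :: "real ^ 'n"
    by simp
  ultimately show ?thesis
    unfolding root_scale_def[abs_def] by (simp only:)
qed

text \<open>\<open>J1\<close> is Bochner's identity with weight \<phi> = \<rho> u^(2 - 2N) \<psi>;
  \<open>J2\<close> and \<open>J3\<close> are the divergences of \<phi> (1 - r \<Theta>) F Du and
  \<phi> (N - \<eta>) K Du. Since the trace of H is N K + F, the summands 1 and N of these factors
  cancel the trace term of \<open>J1\<close>. The scalars are existential because they are read off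
  pointwise in a frame adapted to Du.\<close>

lemma energy_integrand:
  fixes b r \<epsilon> \<delta> \<eta> R :: real and M :: nat
  assumes q: "N * q \<le> 1" and \<epsilon>: "0 < \<epsilon>" and \<delta>: "0 < \<delta>" and M: "2 \<le> M" and R: "0 < R"
  defines "m \<equiv> root_scale \<delta>"
  defines "\<Theta> \<equiv> \<lambda>x. m x / (m x + \<epsilon>)" and "\<psi> \<equiv> \<lambda>x. (m x + \<epsilon>) powr (2 * b)"
    and "\<rho> \<equiv> \<lambda>x. bump R x ^ M" and "S \<equiv> \<lambda>x. U x \<bullet> U x + \<delta>"
  obtains J where "integrable lborel J" "(LINT x|lborel. J x) = 0"
    "\<And>x. \<exists>h T HH \<alpha> \<beta>. 0 \<le> T \<and> h\<^sup>2 + 2 * T + (N * kinetic x + source x - h)\<^sup>2 / N \<le> HH \<and>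
      \<alpha>\<^sup>2 \<le> \<rho> x * (4 * (real M)\<^sup>2 / R\<^sup>2 * bump R x ^ (M - 2)) \<and>
      \<beta>\<^sup>2 \<le> \<rho> x * (4 * (real M)\<^sup>2 / R\<^sup>2 * bump R x ^ (M - 2)) * T \<and>
      J x = u x powr (2 - 2 * N) * (\<rho> x * \<psi> x * (HH - (N * kinetic x + source x)\<^sup>2
            + (2 - 2 * N) * kinetic x * (h - (N * kinetic x + source x))
            + b * \<Theta> x * ((U x \<bullet> U x) / S x) * (h\<^sup>2 + T - (N * kinetic x + source x) * h)
            + (1 - r * \<Theta> x) * source x * ((2 - 2 * N + E) * kinetic x + b * \<Theta> x * ((U x \<bullet> U x) / S x) * h + (N * kinetic x + source x) + q * h)
            - r / 2 * \<Theta> x * (1 - \<Theta> x) * ((U x \<bullet> U x) / S x) * h * source x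
            + (N - \<eta>) * kinetic x * ((1 - 2 * N) * kinetic x + b * \<Theta> x * ((U x \<bullet> U x) / S x) * h + 2 * h + (N * kinetic x + source x)))
        + \<psi> x * norm (U x) * (\<beta> + \<alpha> * (h - (N * kinetic x + source x) + (1 - r * \<Theta> x) * source x + (N - \<eta>) * kinetic x)))"
proof -
  define V where "V = (\<lambda>x. H x *v U x)"
  define a where "a = 2 - 2 * N"
  define \<rho>' where "\<rho>' = (\<lambda>x :: real ^ 'n. (- (2 * real M / R\<^sup>2) * bump R x ^ (M - 1)) *\<^sub>R x)"
  have \<rho>: "has_grad \<rho> \<rho>'" unfolding \<rho>_def \<rho>'_def by (rule has_grad_bump_power[OF M])
  have \<rho>0: "\<rho> x = 0" if "norm x > R" for x
    using bump_eq_zero[of R x] that R M by (simp add: \<rho>_def power_0_left)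
  have Spos: "0 < S x" for x using \<delta> by (simp add: S_def add_nonneg_pos)
  have mpos: "0 < m x" for x unfolding m_def by (rule root_scale_pos[OF \<delta>])
  have npos: "0 < m x + \<epsilon>" for x using mpos[of x] \<epsilon> by linarith
  have gm: "has_grad m (\<lambda>x. (m x / (2 * S x)) *\<^sub>R V x)"
    unfolding m_def S_def V_def by (rule has_grad_root_scale[OF \<delta>])
  have gn: "has_grad (\<lambda>x. m x + \<epsilon>) (\<lambda>x. (m x / (2 * S x)) *\<^sub>R V x)"
    using has_grad_add[OF gm has_grad_const[of \<epsilon>]] by simp
  have g\<psi>: "has_grad \<psi> (\<lambda>x. (b * \<psi> x * \<Theta> x / S x) *\<^sub>R V x)"
    unfolding \<psi>_def
    by (rule has_grad_cong[OF has_grad_powr[OF gn npos]])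
      (use npos Spos in \<open>simp add: \<Theta>_def powr_diff less_imp_le\<close>)
  define \<psi>2 where "\<psi>2 = (\<lambda>x. \<psi> x * (1 - r * \<Theta> x))"
  have g\<psi>2: "has_grad \<psi>2 (\<lambda>x. (\<psi> x * \<Theta> x / S x * (b * (1 - r * \<Theta> x) - r / 2 * (1 - \<Theta> x))) *\<^sub>R V x)"
  proof -
    \<comment> \<open>Writing 1 - r \<Theta> as (1 - r) + r \<epsilon> / (m + \<epsilon>) reduces
      its gradient to that of a single power.\<close>
    have "has_grad (\<lambda>x. (m x + \<epsilon>) powr (- 1)) (\<lambda>x. (- 1 * (m x + \<epsilon>) powr (- 1 - 1)) *\<^sub>R ((m x / (2 * S x)) *\<^sub>R V x))"
      by (rule has_grad_powr[OF gn npos])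
    from has_grad_add[OF has_grad_const[of "1 - r"] has_grad_cmult[OF this, of "r * \<epsilon>"]]
    have "has_grad (\<lambda>x. (1 - r) + r * \<epsilon> * (m x + \<epsilon>) powr (- 1))
       (\<lambda>x. 0 + (r * \<epsilon>) *\<^sub>R ((- 1 * (m x + \<epsilon>) powr (- 1 - 1)) *\<^sub>R ((m x / (2 * S x)) *\<^sub>R V x)))" .
    moreover have "(\<lambda>x. (1 - r) + r * \<epsilon> * (m x + \<epsilon>) powr (- 1)) = (\<lambda>x. 1 - r * \<Theta> x)"
    proof
      fix x
      have "(m x + \<epsilon>) powr (- 1) = 1 / (m x + \<epsilon>)" using npos[of x] by (simp add: powr_minus_divide)
      moreover have "m x / (m x + \<epsilon>) = 1 - \<epsilon> * (1 / (m x + \<epsilon>))" using npos[of x] by (simp add: field_simps)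
      ultimately show "(1 - r) + r * \<epsilon> * (m x + \<epsilon>) powr (- 1) = 1 - r * \<Theta> x"
        unfolding \<Theta>_def by (simp only:) (simp add: algebra_simps)
    qed
    moreover have "0 + (r * \<epsilon>) *\<^sub>R ((- 1 * (m x + \<epsilon>) powr (- 1 - 1)) *\<^sub>R ((m x / (2 * S x)) *\<^sub>R V x))
        = (- (r / 2 * \<Theta> x * (1 - \<Theta> x) / S x)) *\<^sub>R V x" for x
    proof -
      have "(m x + \<epsilon>) powr (- 1 - 1) = 1 / (m x + \<epsilon>)\<^sup>2"
        using npos[of x] by (simp add: powr_minus_divide)
      moreover have "1 - \<Theta> x = \<epsilon> / (m x + \<epsilon>)" using npos[of x] by (simp add: \<Theta>_def field_simps)
      moreover have "0 + (r * \<epsilon>) *\<^sub>R ((- 1 * (1 / n\<^sup>2)) *\<^sub>R ((k / (2 * s)) *\<^sub>R v)) = (- (r / 2 * (k / n) * (\<epsilon> / n) / s)) *\<^sub>R v"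
        for n k s :: real and v :: "real ^ 'n"
        by (simp add: power2_eq_square mult_ac)
      ultimately show ?thesis by (simp only: \<Theta>_def)
    qed
    ultimately have "has_grad (\<lambda>x. 1 - r * \<Theta> x) (\<lambda>x. (- (r / 2 * \<Theta> x * (1 - \<Theta> x) / S x)) *\<^sub>R V x)"
      by (simp only:)
    from has_grad_mult[OF g\<psi> this] show ?thesis
      unfolding \<psi>2_def by (rule has_grad_cong)
       (simp add: algebra_simps diff_divide_distrib add_divide_distrib flip: scaleR_add_left)
  qed
  have gu: "has_grad (\<lambda>x. u x powr s) (\<lambda>x. (s * u x powr s / u x) *\<^sub>R U x)" for s
    by (rule has_grad_cong[OF has_grad_powr[OF has_grad_u u_pos]]) (use u_pos in \<open>simp add: powr_diff less_imp_le\<close>)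
  define \<phi> where "\<phi> = (\<lambda>x. \<rho> x * (u x powr a * \<psi> x))"
  define \<phi>' where "\<phi>' = (\<lambda>x. (u x powr a * \<psi> x) *\<^sub>R \<rho>' x + (\<rho> x * a * u x powr a * \<psi> x / u x) *\<^sub>R U x
      + (\<rho> x * u x powr a * b * \<psi> x * \<Theta> x / S x) *\<^sub>R V x)"
  have g\<phi>: "has_grad \<phi> \<phi>'"
    unfolding \<phi>_def \<phi>'_def
    by (rule has_grad_cong[OF has_grad_mult[OF \<rho> has_grad_mult[OF gu g\<psi>]]]) (simp add: scaleR_add_right mult_ac)
  define A1 where "A1 = (\<lambda>x. \<rho> x * (c * (u x powr (a + E) * \<psi>2 x)))"
  define A1' where "A1' = (\<lambda>x. (c * u x powr (a + E) * \<psi>2 x) *\<^sub>R \<rho>' x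
      + (\<rho> x * c * (a + E) * u x powr (a + E) * \<psi>2 x / u x) *\<^sub>R U x
      + (\<rho> x * c * u x powr (a + E) * (\<psi> x * \<Theta> x / S x * (b * (1 - r * \<Theta> x) - r / 2 * (1 - \<Theta> x)))) *\<^sub>R V x)"
  have gA1: "has_grad A1 A1'"
    unfolding A1_def A1'_def
    by (rule has_grad_cong[OF has_grad_mult[OF \<rho> has_grad_cmult[OF has_grad_mult[OF gu g\<psi>2]]]]) (simp add: scaleR_add_right mult_ac)
  define A2 where "A2 = (\<lambda>x. \<rho> x * ((N - \<eta>) * ((u x powr (a - 1) * \<psi> x) * (U x \<bullet> U x))))"
  define A2' where "A2' = (\<lambda>x. ((N - \<eta>) * u x powr (a - 1) * \<psi> x * (U x \<bullet> U x)) *\<^sub>R \<rho>' x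
      + (\<rho> x * (N - \<eta>) * (a - 1) * u x powr (a - 1) * \<psi> x * (U x \<bullet> U x) / u x) *\<^sub>R U x
      + (\<rho> x * (N - \<eta>) * u x powr (a - 1) * (U x \<bullet> U x) * (b * \<psi> x * \<Theta> x / S x) + 2 * (\<rho> x * (N - \<eta>) * u x powr (a - 1) * \<psi> x)) *\<^sub>R V x)"
  have gA2: "has_grad A2 A2'"
    unfolding A2_def A2'_def
    by (rule has_grad_cong[OF has_grad_mult[OF \<rho> has_grad_cmult[OF has_grad_mult[OF has_grad_mult[OF gu g\<psi>] has_grad_inner_U]]]])
      (simp add: scaleR_add_right scaleR_add_left mult_ac V_def)
  \<comment> \<open>F Du is split so that |Du|^q stays attached to Du, which makes the field C^1
    even at critical points; the remaining factors of F go into \<open>A1\<close>.\<close>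
  define B where "B = (\<lambda>x. norm_powr (U x) q *\<^sub>R U x)"
  define B' where "B' = (\<lambda>x. \<chi> i. norm_powr (U x) q *\<^sub>R H x $ i + (q * norm (U x) powr (q - 2) * U x $ i) *\<^sub>R (U x v* H x))"
  have gB: "has_grad (\<lambda>x. B x $ i) (\<lambda>x. B' x $ i)" for i
    using has_grad_norm_powr_U[OF q_nonneg, of i] by (simp add: B_def B'_def)
  define J1 where "J1 = (\<lambda>x. \<phi> x * ((\<Sum>i\<in>UNIV. \<Sum>j\<in>UNIV. (H x $ i $ j)\<^sup>2) - (trace (H x))\<^sup>2)
     + \<phi>' x \<bullet> (H x *v U x - trace (H x) *\<^sub>R U x))"
  define J2 where "J2 = (\<lambda>x. A1' x \<bullet> B x + A1 x * trace (B' x))"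
  define J3 where "J3 = (\<lambda>x. A2' x \<bullet> U x + A2 x * trace (H x))"
  have J1: "integrable lborel J1" "(LINT x|lborel. J1 x) = 0"
    unfolding J1_def by (rule integral_bochner[OF g\<phi>, of R], use \<rho>0 in \<open>simp add: \<phi>_def\<close>)+
  have J2: "integrable lborel J2" "(LINT x|lborel. J2 x) = 0"
    unfolding J2_def by (rule integral_div_zero[OF gA1 _ gB, of R], use \<rho>0 in \<open>simp add: A1_def\<close>)+
  have J3: "integrable lborel J3" "(LINT x|lborel. J3 x) = 0"
    unfolding J3_def by (rule integral_div_zero[OF gA2 _ has_grad_U, of R], use \<rho>0 in \<open>simp add: A2_def\<close>)+
  show thesis
  proof (rule that[of "\<lambda>x. J1 x + J2 x + J3 x"])
    show "integrable lborel (\<lambda>x. J1 x + J2 x + J3 x)"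
      using J1 J2 J3 by (intro Bochner_Integration.integrable_add)
    show "(LINT x|lborel. J1 x + J2 x + J3 x) = 0"
      using J1 J2 J3 by (simp add: Bochner_Integration.integral_add)
    fix x
    define w where "w = norm (U x)"
    obtain e :: "real ^ 'n" where e: "e \<bullet> e = 1" "U x = w *\<^sub>R e"
    \<comment> \<open>At a critical point any unit vector serves as \<open>e\<close>, because then
      \<open>w\<close> = 0.\<close>
    proof (cases "U x = 0")
      case True
      then show thesis using that[of "axis undefined 1"] by (simp add: w_def inner_axis_axis)
    next
      case False
      then show thesis using that[of "(1 / w) *\<^sub>R U x"]
        by (simp add: w_def dot_square_norm power2_eq_square)
    qed
    define h where "h = e \<bullet> (H x *v e)"
    define t where "t = H x *v e - h *\<^sub>R e"
    define T where "T = t \<bullet> t"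
    define HH where "HH = (\<Sum>i\<in>UNIV. \<Sum>j\<in>UNIV. (H x $ i $ j)\<^sup>2)"
    define \<alpha> where "\<alpha> = \<rho>' x \<bullet> e"
    define \<beta> where "\<beta> = \<rho>' x \<bullet> t"
    define G where "G = N * kinetic x + source x"
    define \<Gamma> where "\<Gamma> = 4 * (real M)\<^sup>2 / R\<^sup>2 * bump R x ^ (M - 2)"
    have T0: "0 \<le> T" by (simp add: T_def)
    have trG: "trace (H x) = G" by (simp add: G_def trace_eq)
    have card: "CARD('n) \<ge> 2" using dim by linarith
    have HH: "h\<^sup>2 + 2 * T + (G - h)\<^sup>2 / N \<le> HH"
      using symmetric_matrix_norm_ge[OF symmetric[of x] e(1) card] dim
      by (simp add: h_def t_def T_def HH_def trG)
    have \<Gamma>: "(norm (\<rho>' x))\<^sup>2 \<le> \<rho> x * \<Gamma>"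
      unfolding \<rho>'_def \<rho>_def \<Gamma>_def by (rule norm_bump_power_grad_le[OF M R])
    have ne: "norm e = 1" using e(1) by (simp add: norm_eq_sqrt_inner)
    have \<alpha>: "\<alpha>\<^sup>2 \<le> \<rho> x * \<Gamma>"
      using Cauchy_Schwarz_ineq[of "\<rho>' x" e] \<Gamma> e(1) by (simp add: \<alpha>_def dot_square_norm)
    have \<beta>: "\<beta>\<^sup>2 \<le> \<rho> x * \<Gamma> * T"
    proof -
      have "\<beta>\<^sup>2 \<le> (norm (\<rho>' x))\<^sup>2 * T"
        using Cauchy_Schwarz_ineq[of "\<rho>' x" t] by (simp add: \<beta>_def T_def dot_square_norm)
      also have "\<dots> \<le> \<rho> x * \<Gamma> * T" using \<Gamma> T0 by (intro mult_right_mono)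
      finally show ?thesis .
    qed
    have et: "e \<bullet> t = 0" by (simp add: t_def h_def inner_diff_right e(1))
    have V: "V x = w *\<^sub>R (h *\<^sub>R e + t)"
      by (simp add: V_def e(2) t_def matrix_vector_mult_scaleR)
    have UU: "U x \<bullet> U x = w\<^sup>2" by (simp add: w_def dot_square_norm)
    have VU: "V x \<bullet> U x = w\<^sup>2 * h"
      using e(1) et unfolding V e(2) by (simp add: inner_add_left inner_commute[of t e] power2_eq_square)
    have VV: "V x \<bullet> V x = w\<^sup>2 * (h\<^sup>2 + T)"
      using e(1) et unfolding V by (simp add: inner_add_left inner_add_right inner_commute[of t e] T_def power2_eq_square algebra_simps)
    have \<rho>V: "\<rho>' x \<bullet> V x = w * (\<alpha> * h + \<beta>)"
      unfolding V by (simp add: inner_add_right \<alpha>_def \<beta>_def)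
    have \<rho>U: "\<rho>' x \<bullet> U x = w * \<alpha>"
      unfolding e(2) by (simp add: \<alpha>_def)
    have trB: "trace (B' x) = norm_powr (U x) q * (G + q * h)"
    proof -
      have "trace (B' x) = norm_powr (U x) q * trace (H x) + q * norm (U x) powr (q - 2) * (U x \<bullet> (U x v* H x))"
        by (simp add: B'_def trace_def sum.distrib sum_distrib_left inner_vec_def mult_ac)
      also have "U x \<bullet> (U x v* H x) = (U x \<bullet> U x) * h"
      proof -
        have "U x \<bullet> (U x v* H x) = (U x v* H x) \<bullet> U x" by (rule inner_commute)
        also have "\<dots> = U x \<bullet> V x" by (simp only: dot_lmul_matrix V_def)
        also have "\<dots> = V x \<bullet> U x" by (rule inner_commute)
        finally show ?thesis by (simp only: VU UU)
      qed
      also have "q * norm (U x) powr (q - 2) * ((U x \<bullet> U x) * h) = q * norm_powr (U x) q * h"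
        by (simp only: mult.assoc[symmetric] norm_powr_sub_two)
      finally show ?thesis by (simp add: trG algebra_simps)
    qed
    define ui where "ui = 1 / u x"
    define Si where "Si = 1 / S x"
    define ua where "ua = u x powr a"
    have K: "kinetic x = w\<^sup>2 * ui" by (simp add: kinetic_def UU ui_def)
    have F: "source x = c * u x powr E * norm_powr (U x) q" by (rule source_def)
    have up: "u x powr (a + E) = ua * u x powr E" "u x powr (a - 1) = ua * ui"
      using u_pos[of x] by (simp_all add: powr_add powr_diff ua_def ui_def)
    have l: "(U x \<bullet> U x) / S x = w\<^sup>2 * Si" by (simp add: UU Si_def)
    have j1: "J1 x = ua * (\<rho> x * \<psi> x * (HH - G\<^sup>2 + (2 - 2 * N) * kinetic x * (h - G)
            + b * \<Theta> x * (w\<^sup>2 * Si) * (h\<^sup>2 + T - G * h)) + \<psi> x * w * (\<beta> + \<alpha> * (h - G)))"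
    proof -
      have "J1 x = \<phi> x * (HH - G\<^sup>2) + (\<phi>' x \<bullet> V x - G * (\<phi>' x \<bullet> U x))"
        by (simp add: J1_def HH_def trG V_def inner_diff_right)
      moreover have "\<phi>' x \<bullet> V x = ua * \<psi> x * (w * (\<alpha> * h + \<beta>)) + \<rho> x * a * ua * \<psi> x * ui * (w\<^sup>2 * h)
          + \<rho> x * ua * b * \<psi> x * \<Theta> x * Si * (w\<^sup>2 * (h\<^sup>2 + T))"
        by (simp add: \<phi>'_def inner_add_left \<rho>V VV VU inner_commute[of "U x" "V x"] ua_def ui_def Si_def)
      moreover have "\<phi>' x \<bullet> U x = ua * \<psi> x * (w * \<alpha>) + \<rho> x * a * ua * \<psi> x * ui * w\<^sup>2
          + \<rho> x * ua * b * \<psi> x * \<Theta> x * Si * (w\<^sup>2 * h)"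
        by (simp add: \<phi>'_def inner_add_left \<rho>U UU VU ua_def ui_def Si_def)
      ultimately show ?thesis
        unfolding K \<phi>_def a_def[symmetric] ua_def[symmetric] by algebra
    qed
    have j2: "J2 x = ua * (\<rho> x * \<psi> x * ((1 - r * \<Theta> x) * source x * ((2 - 2 * N + E) * kinetic x + b * \<Theta> x * (w\<^sup>2 * Si) * h + G + q * h)
            - r / 2 * \<Theta> x * (1 - \<Theta> x) * (w\<^sup>2 * Si) * h * source x)
         + \<psi> x * w * (\<alpha> * ((1 - r * \<Theta> x) * source x)))"
    proof -
      have "A1' x \<bullet> U x = c * (ua * u x powr E) * (\<psi> x * (1 - r * \<Theta> x)) * (w * \<alpha>)
         + \<rho> x * c * (a + E) * (ua * u x powr E) * (\<psi> x * (1 - r * \<Theta> x)) * ui * w\<^sup>2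
         + \<rho> x * c * (ua * u x powr E) * (\<psi> x * \<Theta> x * Si * (b * (1 - r * \<Theta> x) - r / 2 * (1 - \<Theta> x))) * (w\<^sup>2 * h)"
        by (simp add: A1'_def inner_add_left \<rho>U UU VU up \<psi>2_def ui_def Si_def)
      moreover have "J2 x = norm_powr (U x) q * (A1' x \<bullet> U x) + A1 x * (norm_powr (U x) q * (G + q * h))"
        by (simp add: J2_def B_def trB)
      ultimately show ?thesis
        unfolding K F A1_def \<psi>2_def up a_def[symmetric] by algebra
    qed
    have j3: "J3 x = ua * (\<rho> x * \<psi> x * ((N - \<eta>) * kinetic x * ((1 - 2 * N) * kinetic x + b * \<Theta> x * (w\<^sup>2 * Si) * h + 2 * h + G))
         + \<psi> x * w * (\<alpha> * ((N - \<eta>) * kinetic x)))"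
    proof -
      have a1: "1 - 2 * N = a - 1" by (simp add: a_def)
      have "A2' x \<bullet> U x = (N - \<eta>) * (ua * ui) * \<psi> x * w\<^sup>2 * (w * \<alpha>)
         + \<rho> x * (N - \<eta>) * (a - 1) * (ua * ui) * \<psi> x * w\<^sup>2 * ui * w\<^sup>2
         + (\<rho> x * (N - \<eta>) * (ua * ui) * w\<^sup>2 * (b * \<psi> x * \<Theta> x * Si) + 2 * (\<rho> x * (N - \<eta>) * (ua * ui) * \<psi> x)) * (w\<^sup>2 * h)"
        by (simp add: A2'_def inner_add_left \<rho>U UU VU up ui_def Si_def)
      moreover have "J3 x = A2' x \<bullet> U x + \<rho> x * ((N - \<eta>) * ((ua * ui * \<psi> x) * w\<^sup>2)) * G"
        by (simp add: J3_def trG A2_def up UU)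
      ultimately show ?thesis
        unfolding K a1 by algebra
    qed
    show "\<exists>h T HH \<alpha> \<beta>. 0 \<le> T \<and> h\<^sup>2 + 2 * T + (N * kinetic x + source x - h)\<^sup>2 / N \<le> HH \<and>
      \<alpha>\<^sup>2 \<le> \<rho> x * (4 * (real M)\<^sup>2 / R\<^sup>2 * bump R x ^ (M - 2)) \<and>
      \<beta>\<^sup>2 \<le> \<rho> x * (4 * (real M)\<^sup>2 / R\<^sup>2 * bump R x ^ (M - 2)) * T \<and>
      J1 x + J2 x + J3 x = u x powr (2 - 2 * N) * (\<rho> x * \<psi> x * (HH - (N * kinetic x + source x)\<^sup>2
            + (2 - 2 * N) * kinetic x * (h - (N * kinetic x + source x))
            + b * \<Theta> x * ((U x \<bullet> U x) / S x) * (h\<^sup>2 + T - (N * kinetic x + source x) * h)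
            + (1 - r * \<Theta> x) * source x * ((2 - 2 * N + E) * kinetic x + b * \<Theta> x * ((U x \<bullet> U x) / S x) * h + (N * kinetic x + source x) + q * h)
            - r / 2 * \<Theta> x * (1 - \<Theta> x) * ((U x \<bullet> U x) / S x) * h * source x
            + (N - \<eta>) * kinetic x * ((1 - 2 * N) * kinetic x + b * \<Theta> x * ((U x \<bullet> U x) / S x) * h + 2 * h + (N * kinetic x + source x)))
        + \<psi> x * norm (U x) * (\<beta> + \<alpha> * (h - (N * kinetic x + source x) + (1 - r * \<Theta> x) * source x + (N - \<eta>) * kinetic x)))"
      apply (rule exI[of _ h], rule exI[of _ T], rule exI[of _ HH], rule exI[of _ \<alpha>], rule exI[of _ \<beta>])
      apply (intro conjI)
      subgoal by (rule T0)
      subgoal using HH by (simp only: G_def)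
      subgoal using \<alpha> by (simp only: \<Gamma>_def)
      subgoal using \<beta> by (simp only: \<Gamma>_def)
      subgoal unfolding j1 j2 j3 l w_def[symmetric] G_def[symmetric] ua_def a_def by algebra
      done
  qed
qed

end

section \<open>Decay of the energy\<close>

text \<open>A convex combination is at most the maximum; this weak weighted arithmetic-geometric
  inequality suffices, since constants are free.\<close>

lemma exp_weighted_le:
  fixes x y z :: real
  assumes "0 \<le> \<theta>0" "0 \<le> \<theta>1" "0 \<le> \<theta>2" "\<theta>0 + \<theta>1 + \<theta>2 = 1"
  shows "exp (\<theta>0 * x + \<theta>1 * y + \<theta>2 * z) \<le> exp x + exp y + exp z"
proof -
  define k where "k = max x (max y z)"
  have "\<theta>0 * x + \<theta>1 * y + \<theta>2 * z \<le> \<theta>0 * k + \<theta>1 * k + \<theta>2 * k"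
    using assms by (intro add_mono mult_left_mono) (auto simp: k_def)
  also have "\<dots> = k" using assms(4) by (metis distrib_right mult_1)
  finally have "exp (\<theta>0 * x + \<theta>1 * y + \<theta>2 * z) \<le> exp k" by simp
  also have "\<dots> \<le> exp x + exp y + exp z"
    by (auto simp: k_def max_def intro: add_increasing add_increasing2)
  finally show ?thesis .
qed

text \<open>In logarithms the left side is dominated by the \<theta>-weighted mean of the three
  right-hand terms: the equations \<open>ex\<close> match the powers of u and w, and the exponent of
  R matches by construction. For \<sigma> \<le> 1 the condition M \<theta>2 \<ge> 2 settles the
  power of the cut-off.\<close>

lemma weighted_young:
  fixes N q b E c B \<kappa> :: real
  assumes \<theta>: "0 \<le> \<theta>0" "0 \<le> \<theta>1" "0 < \<theta>2" "\<theta>0 + \<theta>1 + \<theta>2 = 1"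
    and ex: "- 2 * \<theta>0 + 2 * E * \<theta>1 + (2 * N - 2) * \<theta>2 = 0" "4 * \<theta>0 + 2 * q * \<theta>1 - b * \<theta>2 = 2"
    and pos: "0 < c" "0 < B" "0 < \<kappa>" and M: "3 \<le> M" "2 \<le> real M * \<theta>2"
  obtains C where "0 < C"
    "\<And>w u \<sigma> R. 0 < w \<Longrightarrow> 0 < u \<Longrightarrow> 0 \<le> \<sigma> \<Longrightarrow> \<sigma> \<le> 1 \<Longrightarrow> 0 < R \<Longrightarrow>
      B * w\<^sup>2 / R\<^sup>2 * \<sigma> ^ (M - 2) \<le> \<kappa> * (\<sigma> ^ M * ((w\<^sup>2 / u)\<^sup>2 + (c * u powr E * w powr q)\<^sup>2))
        + C * R powr (- 2 / \<theta>2) * u powr (2 * N - 2) * w powr (- b)"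
proof -
  \<comment> \<open>The logarithm of the constant, solved from equality of the constant terms in the
    weighted mean.\<close>
  define lC where "lC = (ln B - (\<theta>0 + \<theta>1) * ln \<kappa> - 2 * \<theta>1 * ln c) / \<theta>2"
  have lC: "\<theta>2 * lC = ln B - (\<theta>0 + \<theta>1) * ln \<kappa> - 2 * \<theta>1 * ln c" using \<theta> by (simp add: lC_def)
  show thesis
  proof (rule that[of "exp lC"])
    fix w u \<sigma> R :: real
    assume w: "0 < w" and u: "0 < u" and s: "0 \<le> \<sigma>" "\<sigma> \<le> 1" and R: "0 < R"
    show "B * w\<^sup>2 / R\<^sup>2 * \<sigma> ^ (M - 2) \<le> \<kappa> * (\<sigma> ^ M * ((w\<^sup>2 / u)\<^sup>2 + (c * u powr E * w powr q)\<^sup>2))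
        + exp lC * R powr (- 2 / \<theta>2) * u powr (2 * N - 2) * w powr (- b)"
    proof (cases "\<sigma> = 0")
      case True
      have "0 \<le> exp lC * R powr (- 2 / \<theta>2) * u powr (2 * N - 2) * w powr (- b)" by simp
      then show ?thesis using True M by (simp add: power_0_left)
    next
      case False
      then have s0: "0 < \<sigma>" using s by simp
      define L where "L = ln \<sigma>"
      have L: "L \<le> 0" using s s0 by (simp add: L_def)
      have pw: "t ^ k = exp (real k * ln t)" if "0 < t" for t :: real and k
        using that by (metis exp_ln exp_of_nat_mult)
      define X where "X = ln \<kappa> + real M * L + 4 * ln w - 2 * ln u"
      define Y where "Y = ln \<kappa> + real M * L + 2 * ln c + 2 * E * ln u + 2 * q * ln w"
      define Z where "Z = lC - 2 / \<theta>2 * ln R + (2 * N - 2) * ln u - b * ln w"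
      have eX: "exp X = \<kappa> * (\<sigma> ^ M * (w\<^sup>2 / u)\<^sup>2)"
      proof -
        have "\<kappa> * (\<sigma> ^ M * (w\<^sup>2 / u)\<^sup>2) = exp (ln \<kappa>) * (exp (real M * L) * (exp (4 * ln w) / exp (2 * ln u)))"
          using pos w u s0 pw[of \<sigma> M] pw[of w 4] pw[of u 2] by (simp add: L_def power_divide flip: power_mult)
        then show ?thesis by (simp add: X_def exp_add exp_diff)
      qed
      have eY: "exp Y = \<kappa> * (\<sigma> ^ M * (c * u powr E * w powr q)\<^sup>2)"
      proof -
        have "(u powr E)\<^sup>2 = exp (2 * E * ln u)" "(w powr q)\<^sup>2 = exp (2 * q * ln w)"
          using u w by (simp_all add: powr_def power2_eq_square flip: exp_add)
        then have "\<kappa> * (\<sigma> ^ M * (c * u powr E * w powr q)\<^sup>2)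
            = exp (ln \<kappa>) * (exp (real M * L) * (exp (2 * ln c) * exp (2 * E * ln u) * exp (2 * q * ln w)))"
          using pos s0 pw[of \<sigma> M] pw[of c 2] by (simp add: L_def power_mult_distrib)
        then show ?thesis by (simp add: Y_def exp_add mult_ac)
      qed
      have eZ: "exp Z = exp lC * R powr (- 2 / \<theta>2) * u powr (2 * N - 2) * w powr (- b)"
        using R u w by (simp add: Z_def powr_def exp_add exp_diff exp_minus divide_inverse)
      have "B * w\<^sup>2 / R\<^sup>2 * \<sigma> ^ (M - 2) = exp (ln B) * exp (2 * ln w) / exp (2 * ln R) * exp (real (M - 2) * L)"
        using pos w R s0 pw[of w 2] pw[of R 2] pw[of \<sigma> "M - 2"] by (simp add: L_def)
      also have "\<dots> = exp (ln B + 2 * ln w - 2 * ln R + (real M - 2) * L)"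
        using M by (simp add: exp_add exp_diff of_nat_diff)
      also have "\<dots> \<le> exp (\<theta>0 * X + \<theta>1 * Y + \<theta>2 * Z)"
      proof -
        have "\<theta>2 * Z = \<theta>2 * lC - 2 * ln R + \<theta>2 * (2 * N - 2) * ln u - \<theta>2 * b * ln w"
          using \<theta> by (simp add: Z_def algebra_simps)
        then have "\<theta>0 * X + \<theta>1 * Y + \<theta>2 * Z = ln B - 2 * ln R + real M * (\<theta>0 + \<theta>1) * L
           + (4 * \<theta>0 + 2 * q * \<theta>1 - b * \<theta>2) * ln w + (- 2 * \<theta>0 + 2 * E * \<theta>1 + (2 * N - 2) * \<theta>2) * ln u"
          unfolding lC X_def Y_def by (simp add: algebra_simps)
        also have "\<dots> = ln B - 2 * ln R + real M * (\<theta>0 + \<theta>1) * L + 2 * ln w" unfolding ex by simp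
        finally have eq: "\<theta>0 * X + \<theta>1 * Y + \<theta>2 * Z = ln B - 2 * ln R + real M * (\<theta>0 + \<theta>1) * L + 2 * ln w" .
        have "\<theta>0 + \<theta>1 = 1 - \<theta>2" using \<theta> by simp
        then have "real M * (\<theta>0 + \<theta>1) = real M - real M * \<theta>2"
          by (simp only: right_diff_distrib mult_1_right)
        then have "real M * (\<theta>0 + \<theta>1) \<le> real M - 2" using M by linarith
        then have "(real M - 2) * L \<le> real M * (\<theta>0 + \<theta>1) * L" using L by (intro mult_right_mono_neg)
        then show ?thesis unfolding eq by simp
      qed
      also have "\<dots> \<le> exp X + exp Y + exp Z" using \<theta> by (intro exp_weighted_le) auto
      finally show ?thesis unfolding eX eY eZ by (simp add: algebra_simps)
    qed
  qed simp
qed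

context gradient_equation
begin

text \<open>With \<delta> = (\<zeta> \<epsilon>)^4 the scale m is at least \<zeta> \<epsilon>, so 1
  - \<kappa> = \<delta> / m^4 is small unless m, and with it \<Theta> \<le> m / \<epsilon>, is
  small. The other bounds use b \<le> 0 and |Du|^(1/2) \<le> m; their comparison functions of |Du|
  do not depend on \<epsilon>, apart from the factor \<epsilon> in the last.\<close>

lemma regularised_weight_bounds:
  fixes b :: real and x :: "real ^ 'n"
  assumes \<epsilon>: "0 < \<epsilon>" "\<epsilon> \<le> 1" and \<zeta>: "0 < \<zeta>" "\<zeta> \<le> 1" and b: "- 3 / 2 < b" "b \<le> 0"
  defines "\<delta> \<equiv> (\<zeta> * \<epsilon>) ^ 4"
  defines "\<nu> \<equiv> root_scale \<delta> x + \<epsilon>"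
  defines "\<Theta> \<equiv> root_scale \<delta> x / \<nu>"
  shows "0 \<le> \<Theta>" "\<Theta> \<le> 1" "\<Theta> * (1 - (U x \<bullet> U x) / (U x \<bullet> U x + \<delta>)) \<le> \<zeta>"
    "((norm (U x))\<^sup>2 + 3) powr (2 * b) \<le> \<nu> powr (2 * b)"
    "0 < norm (U x) \<Longrightarrow> \<nu> powr (2 * b) * norm (U x) powr (- b) \<le> 1"
    "\<nu> powr (2 * b) * (1 - \<Theta>) * (norm (U x))\<^sup>2 \<le> \<epsilon> * ((norm (U x))\<^sup>2 + 3) ^ 3"
proof -
  define w where "w = norm (U x)"
  define m where "m = root_scale \<delta> x"
  have w: "0 \<le> w" by (simp add: w_def)
  have UU: "U x \<bullet> U x = w\<^sup>2" by (simp add: w_def dot_square_norm)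
  have \<delta>0: "0 < \<delta>" using \<epsilon> \<zeta> by (simp add: \<delta>_def)
  have \<delta>1: "\<delta> \<le> 1" unfolding \<delta>_def using \<epsilon> \<zeta> by (intro power_le_one mult_le_one) auto
  have S: "0 < w\<^sup>2 + \<delta>" using \<delta>0 by (simp add: add_nonneg_pos)
  have m_def': "m = (w\<^sup>2 + \<delta>) powr (1 / 4)" by (simp add: m_def root_scale_def UU)
  have m0: "0 < m" using S by (simp add: m_def')
  have m4: "m ^ 4 = w\<^sup>2 + \<delta>" using S by (simp add: m_def' powr_power)
  have \<nu>: "\<nu> = m + \<epsilon>" "0 < \<nu>" "m \<le> \<nu>" using m0 \<epsilon> by (auto simp: \<nu>_def m_def)
  have \<Theta>: "\<Theta> = m / \<nu>" by (simp add: \<Theta>_def m_def)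
  show "0 \<le> \<Theta>" "\<Theta> \<le> 1" using \<nu> m0 by (auto simp: \<Theta>)
  have mge: "\<zeta> * \<epsilon> \<le> m"
  proof (rule power_le_imp_le_base[of _ 3])
    show "(\<zeta> * \<epsilon>) ^ Suc 3 \<le> m ^ Suc 3" using m4 by (simp add: \<delta>_def)
  qed (use m0 in simp)
  show "\<Theta> * (1 - (U x \<bullet> U x) / (U x \<bullet> U x + \<delta>)) \<le> \<zeta>"
  proof -
    have "1 - (U x \<bullet> U x) / (U x \<bullet> U x + \<delta>) = \<delta> / m ^ 4"
      unfolding UU m4 using S by (simp add: field_simps)
    moreover have "\<Theta> \<le> m / \<epsilon>" unfolding \<Theta> using \<nu> m0 \<epsilon> by (intro divide_left_mono) auto
    moreover have "0 \<le> \<delta> / m ^ 4" using \<delta>0 m0 by simp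
    ultimately have "\<Theta> * (1 - (U x \<bullet> U x) / (U x \<bullet> U x + \<delta>)) \<le> m / \<epsilon> * (\<delta> / m ^ 4)"
      by (simp only: mult_right_mono)
    also have "\<dots> = \<delta> / (\<epsilon> * m ^ 3)" using m0 by (simp add: power4_eq_xxxx power3_eq_cube)
    also have "\<dots> \<le> \<delta> / (\<epsilon> * (\<zeta> * \<epsilon>) ^ 3)"
      using mge \<delta>0 \<epsilon> \<zeta> m0 by (intro divide_left_mono mult_left_mono power_mono) auto
    also have "\<dots> = \<zeta>" using \<epsilon> \<zeta> by (simp add: \<delta>_def power4_eq_xxxx power3_eq_cube)
    finally show ?thesis .
  qed
  have \<nu>le: "\<nu> \<le> w\<^sup>2 + 3"
  proof -
    have "m \<le> (w\<^sup>2 + 1) powr (1 / 4)" unfolding m_def' using \<delta>0 \<delta>1 by (intro powr_mono2) auto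
    also have "\<dots> \<le> (w\<^sup>2 + 1) powr 1" by (intro powr_mono) auto
    finally show ?thesis using \<epsilon> \<nu> by simp
  qed
  show "((norm (U x))\<^sup>2 + 3) powr (2 * b) \<le> \<nu> powr (2 * b)"
    unfolding w_def[symmetric] using \<nu>le \<nu> b by (intro powr_mono2') auto
  show "\<nu> powr (2 * b) * norm (U x) powr (- b) \<le> 1" if "0 < norm (U x)"
  proof -
    have w0: "0 < w" using that by (simp add: w_def)
    have "w powr (1 / 2) = (w\<^sup>2) powr (1 / 4)" using w0 by (simp add: powr_powr flip: powr_numeral)
    also have "\<dots> \<le> m" unfolding m_def' using \<delta>0 by (intro powr_mono2) auto
    finally have "w powr (1 / 2) \<le> \<nu>" using \<nu> by linarith
    then have "\<nu> powr (2 * b) \<le> (w powr (1 / 2)) powr (2 * b)"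
      using w0 b by (intro powr_mono2') auto
    also have "\<dots> = w powr b" using w0 by (simp add: powr_powr)
    finally have "\<nu> powr (2 * b) * w powr (- b) \<le> w powr b * w powr (- b)"
      by (intro mult_right_mono) auto
    also have "\<dots> = 1" using w0 by (simp flip: powr_add)
    finally show ?thesis by (simp add: w_def)
  qed
  show "\<nu> powr (2 * b) * (1 - \<Theta>) * (norm (U x))\<^sup>2 \<le> \<epsilon> * ((norm (U x))\<^sup>2 + 3) ^ 3"
  proof -
    have "1 - \<Theta> = \<epsilon> * \<nu> powr (- 1)" using \<nu> by (simp add: \<Theta> powr_minus_divide field_simps)
    moreover have "w\<^sup>2 \<le> \<nu> powr 4"
    proof -
      have "w\<^sup>2 \<le> m ^ 4" using m4 \<delta>0 by simp
      also have "\<dots> \<le> \<nu> ^ 4" using \<nu> m0 by (intro power_mono) auto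
      finally show ?thesis using \<nu> by (simp add: powr_numeral)
    qed
    moreover have "0 \<le> \<nu> powr (2 * b) * (\<epsilon> * \<nu> powr (- 1))" using \<epsilon> by simp
    ultimately have "\<nu> powr (2 * b) * (1 - \<Theta>) * w\<^sup>2 \<le> \<nu> powr (2 * b) * (\<epsilon> * \<nu> powr (- 1)) * \<nu> powr 4"
      by (simp only: mult_left_mono)
    \<comment> \<open>The exponent is positive since b > - 3 / 2, so no negative power of \<epsilon>
      can spoil the factor \<epsilon>.\<close>
    also have "\<dots> = \<epsilon> * \<nu> powr (2 * b + 3)"
    proof -
      have "\<nu> powr (2 * b) * \<nu> powr (- 1) * \<nu> powr 4 = \<nu> powr (2 * b + 3)"
        by (simp only: powr_add[symmetric]) (simp add: add.commute)
      then show ?thesis by (simp only: mult.left_commute[of _ \<epsilon>] mult.assoc)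
    qed
    also have "\<dots> \<le> \<epsilon> * ((w\<^sup>2 + 3) powr (2 * b + 3))"
      using \<epsilon> \<nu> \<nu>le b by (intro mult_left_mono powr_mono2) auto
    also have "\<dots> \<le> \<epsilon> * ((w\<^sup>2 + 3) powr 3)"
      using \<epsilon> b by (intro mult_left_mono powr_mono) auto
    finally show ?thesis by (simp add: w_def powr_numeral add_nonneg_pos)
  qed
qed

lemma continuous_source: "continuous_on S source" and continuous_kinetic: "continuous_on S kinetic"
proof -
  have "continuous_on UNIV source" unfolding source_def
    using u_pos by (intro continuous_intros continuous_u
        continuous_on_compose2[OF continuous_on_norm_powr[OF q_nonneg, of UNIV] continuous_U]) (auto simp: less_imp_neq[symmetric])
  then show "continuous_on S source" by (rule continuous_on_subset) simp
  have "continuous_on UNIV kinetic" unfolding kinetic_def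
    using u_pos by (intro continuous_intros continuous_u continuous_U) (auto simp: less_imp_neq[symmetric])
  then show "continuous_on S kinetic" by (rule continuous_on_subset) simp
qed

text \<open>The integrand has integral zero and is bounded below pointwise by a coercive term minus
  errors. For fixed R the limit \<epsilon> -> 0 removes the regularisation error; only then R tends
  to infinity.\<close>

lemma gradient_vanishes:
  assumes q: "q \<le> 1 / N" and pq: "1 < p + q"
    and subcritical: "(N - 1) * p + N * q < N + 1 + (2 - q) / (1 - q)"
    and E: "E = N - (N - 1) * p - N * q"
  shows "U y = 0"
proof -
  have N: "2 \<le> N" by (rule dim)
  have Nq: "N * q \<le> 1" using q N by (simp add: field_simps)
  have "1 / N \<le> 1 / 2" using N by (intro divide_left_mono) auto
  then have qh: "q \<le> 1 / 2" using q by linarith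
  obtain b r where b: "0 < (N + 1) / N + b" "b \<le> 0" and r: "0 < r" "N * r \<le> 1"
    and disc: "(- 2 / N + q - r * (q + b))\<^sup>2 < 4 * ((N + 1) / N + b) * (1 / N - r)"
    and le3: "2 - N * q + N * r * (1 / 2 - b) \<le> 3" and P: "(N - 2 - E) * (1 - r) < N"
    and den: "(N + 1) * (1 - E - q) < (2 - q) * (2 * N - 2) - b - 2 * q - E * (b + 4)"
    using weight_parameters[OF N q_nonneg q pq subcritical] unfolding E by blast
  have b3: "- 3 / 2 < b"
  proof -
    have "(N + 1) / N \<le> 3 / 2" using N by (simp add: field_simps)
    then show ?thesis using b by linarith
  qed
  have "1 - q - E = (N - 1) * (p + q - 1)" by (simp add: E algebra_simps)
  then have "1 - q - E > 0" using N pq by simp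
  then have Elt: "E < 1 - q" by simp
  obtain \<theta>0 \<theta>1 \<theta>2 where \<theta>: "0 \<le> \<theta>0" "0 \<le> \<theta>1" "0 < \<theta>2" "\<theta>2 < 2 / (N + 1)" "\<theta>0 + \<theta>1 + \<theta>2 = 1"
    "- 2 * \<theta>0 + 2 * E * \<theta>1 + (2 * N - 2) * \<theta>2 = 0" "4 * \<theta>0 + 2 * q * \<theta>1 - b * \<theta>2 = 2"
    using interpolation_exponents[OF N q_nonneg qh b3 b(2) Elt den] by blast
  obtain k \<eta> where k: "0 < k" and \<eta>: "0 < \<eta>" "\<eta> \<le> 1"
    and low: "\<And>\<Theta> \<kappa> h F K T HH \<rho> \<psi> w \<alpha> \<beta> \<Gamma>. 0 \<le> \<Theta> \<Longrightarrow> \<Theta> \<le> 1 \<Longrightarrow> 0 \<le> \<kappa> \<Longrightarrow> \<kappa> \<le> 1 \<Longrightarrow> \<Theta> * (1 - \<kappa>) \<le> k \<Longrightarrow>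
      0 \<le> F \<Longrightarrow> 0 \<le> K \<Longrightarrow> 0 \<le> T \<Longrightarrow> 0 \<le> \<rho> \<Longrightarrow> 0 \<le> \<psi> \<Longrightarrow> 0 \<le> w \<Longrightarrow> 0 \<le> \<Gamma> \<Longrightarrow>
      \<alpha>\<^sup>2 \<le> \<rho> * \<Gamma> \<Longrightarrow> \<beta>\<^sup>2 \<le> \<rho> * \<Gamma> * T \<Longrightarrow> h\<^sup>2 + 2 * T + (N * K + F - h)\<^sup>2 / N \<le> HH \<Longrightarrow>
      \<rho> * \<psi> * (k * (F\<^sup>2 + K\<^sup>2)) - \<psi> * w\<^sup>2 * \<Gamma> / k - \<bar>N - 2 - E\<bar> * (\<rho> * \<psi> * (1 - \<Theta>) * K * F)
      \<le> \<rho> * \<psi> * (HH - (N * K + F)\<^sup>2 + (2 - 2 * N) * K * (h - (N * K + F))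
            + b * \<Theta> * \<kappa> * (h\<^sup>2 + T - (N * K + F) * h)
            + (1 - r * \<Theta>) * F * ((2 - 2 * N + E) * K + b * \<Theta> * \<kappa> * h + (N * K + F) + q * h)
            - r / 2 * \<Theta> * (1 - \<Theta>) * \<kappa> * h * F
            + (N - \<eta>) * K * ((1 - 2 * N) * K + b * \<Theta> * \<kappa> * h + 2 * h + (N * K + F)))
        + \<psi> * w * (\<beta> + \<alpha> * (h - (N * K + F) + (1 - r * \<Theta>) * F + (N - \<eta>) * K))"
    using integrand_lower_bound[OF N q_nonneg Nq b r disc le3 P] by blast
  \<comment> \<open>The ceiling gives M \<theta>2 \<ge> 2 for Young's inequality; the summand 3
    makes the power M - 2 of the cut-off vanish where the cut-off does.\<close>
  define M where "M = nat \<lceil>2 / \<theta>2\<rceil> + 3"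
  have M: "3 \<le> M" "2 \<le> real M * \<theta>2"
  proof -
    show "3 \<le> M" by (simp add: M_def)
    have "2 / \<theta>2 \<le> real M" unfolding M_def by linarith
    then show "2 \<le> real M * \<theta>2" using \<theta> by (simp add: field_simps)
  qed
  have M2: "2 \<le> M" using M by simp
  have "0 < 4 * (real M)\<^sup>2 / k" "0 < k / 2" using M k by auto
  then obtain C where C: "0 < C" and young: "\<And>w u \<sigma> R. 0 < w \<Longrightarrow> 0 < u \<Longrightarrow> 0 \<le> \<sigma> \<Longrightarrow> \<sigma> \<le> 1 \<Longrightarrow> 0 < R \<Longrightarrow>
      4 * (real M)\<^sup>2 / k * w\<^sup>2 / R\<^sup>2 * \<sigma> ^ (M - 2) \<le> k / 2 * (\<sigma> ^ M * ((w\<^sup>2 / u)\<^sup>2 + (c * u powr E * w powr q)\<^sup>2))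
        + C * R powr (- 2 / \<theta>2) * u powr (2 * N - 2) * w powr (- b)"
    using weighted_young[OF \<theta>(1,2,3,5,6,7) c_pos _ _ M] by metis
  \<comment> \<open>\<open>f\<close> underestimates the coercive term and
    \<open>\<epsilon> * g\<close> overestimates the regularisation error. Both functions are free of
    \<epsilon>, so \<epsilon> can tend to zero.\<close>
  define f where "f = (\<lambda>R x. bump R x ^ M * (u x powr (2 - 2 * N) * (kinetic x)\<^sup>2 * ((norm (U x))\<^sup>2 + 3) powr (2 * b)))"
  define g where "g = (\<lambda>R x. bump R x ^ M * (\<bar>N - 2 - E\<bar> * u x powr (2 - 2 * N) / u x * source x * ((norm (U x))\<^sup>2 + 3) ^ 3))"
  have cbump: "continuous_on UNIV (\<lambda>x :: real ^ 'n. bump R x ^ M)" for R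
    by (rule has_grad_continuous[OF has_grad_bump_power[OF M2]])
  have bump0: "bump R x ^ M = 0" if "norm x > R" "0 < R" for R and x :: "real ^ 'n"
    using bump_eq_zero[of R x] that M by (simp add: power_0_left)
  have cf: "continuous_on UNIV (f R)" for R unfolding f_def
    using u_pos by (intro continuous_intros cbump continuous_u continuous_kinetic continuous_U)
      (auto simp: less_imp_neq[symmetric] add_nonneg_eq_0_iff)
  have cg: "continuous_on UNIV (g R)" for R unfolding g_def
    using u_pos by (intro continuous_intros cbump continuous_u continuous_source continuous_U)
      (auto simp: less_imp_neq[symmetric])
  have intf: "integrable lborel (f R)" and intg: "integrable lborel (g R)" if "0 < R" for R
    by (rule integrable_continuous_compact_support[OF cf, of R], use that bump0 in \<open>simp add: f_def\<close>,
        rule integrable_continuous_compact_support[OF cg, of R], use that bump0 in \<open>simp add: g_def\<close>)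
  have f0: "0 \<le> f R x" for R x by (simp add: f_def bump_nonneg)
  have bound: "(LINT x|lborel. f R x) \<le> 2 / k * (C * R powr (- 2 / \<theta>2) * measure lborel (cball 0 R :: (real ^ 'n) set))"
    if R: "0 < R" for R
  proof -
    have step: "k / 2 * (LINT x|lborel. f R x) \<le> C * R powr (- 2 / \<theta>2) * measure lborel (cball 0 R :: (real ^ 'n) set) + \<epsilon> * (LINT x|lborel. g R x)"
      if \<epsilon>: "0 < \<epsilon>" "\<epsilon> \<le> 1" for \<epsilon>
    proof -
      \<comment> \<open>At most k for the smallness condition in \<open>low\<close>, at most 1 for
        \<open>regularised_weight_bounds\<close>.\<close>
      define \<zeta> where "\<zeta> = min k 1"
      have \<zeta>: "0 < \<zeta>" "\<zeta> \<le> 1" "\<zeta> \<le> k" using k by (auto simp: \<zeta>_def)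
      define \<delta> where "\<delta> = (\<zeta> * \<epsilon>) ^ 4"
      have \<delta>: "0 < \<delta>" using \<zeta> \<epsilon> by (simp add: \<delta>_def)
      define \<nu> where "\<nu> = (\<lambda>x. root_scale \<delta> x + \<epsilon>)"
      define \<Theta> where "\<Theta> = (\<lambda>x. root_scale \<delta> x / \<nu> x)"
      define \<psi> where "\<psi> = (\<lambda>x. \<nu> x powr (2 * b))"
      have w1: "0 \<le> \<Theta> x" "\<Theta> x \<le> 1" "\<Theta> x * (1 - (U x \<bullet> U x) / (U x \<bullet> U x + \<delta>)) \<le> \<zeta>"
        "((norm (U x))\<^sup>2 + 3) powr (2 * b) \<le> \<psi> x"
        "0 < norm (U x) \<Longrightarrow> \<psi> x * norm (U x) powr (- b) \<le> 1"
        "\<psi> x * (1 - \<Theta> x) * (norm (U x))\<^sup>2 \<le> \<epsilon> * ((norm (U x))\<^sup>2 + 3) ^ 3" for x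
        unfolding \<psi>_def \<Theta>_def \<nu>_def \<delta>_def
        by (rule regularised_weight_bounds[OF \<epsilon> \<zeta>(1,2) b3 b(2)], assumption?)+
      obtain J where J: "integrable lborel J" "(LINT x|lborel. J x) = 0"
        and Jx: "\<And>x. \<exists>h T HH \<alpha> \<beta>. 0 \<le> T \<and> h\<^sup>2 + 2 * T + (N * kinetic x + source x - h)\<^sup>2 / N \<le> HH \<and>
      \<alpha>\<^sup>2 \<le> bump R x ^ M * (4 * (real M)\<^sup>2 / R\<^sup>2 * bump R x ^ (M - 2)) \<and>
      \<beta>\<^sup>2 \<le> bump R x ^ M * (4 * (real M)\<^sup>2 / R\<^sup>2 * bump R x ^ (M - 2)) * T \<and>
      J x = u x powr (2 - 2 * N) * (bump R x ^ M * \<psi> x * (HH - (N * kinetic x + source x)\<^sup>2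
            + (2 - 2 * N) * kinetic x * (h - (N * kinetic x + source x))
            + b * \<Theta> x * ((U x \<bullet> U x) / (U x \<bullet> U x + \<delta>)) * (h\<^sup>2 + T - (N * kinetic x + source x) * h)
            + (1 - r * \<Theta> x) * source x * ((2 - 2 * N + E) * kinetic x + b * \<Theta> x * ((U x \<bullet> U x) / (U x \<bullet> U x + \<delta>)) * h + (N * kinetic x + source x) + q * h)
            - r / 2 * \<Theta> x * (1 - \<Theta> x) * ((U x \<bullet> U x) / (U x \<bullet> U x + \<delta>)) * h * source x
            + (N - \<eta>) * kinetic x * ((1 - 2 * N) * kinetic x + b * \<Theta> x * ((U x \<bullet> U x) / (U x \<bullet> U x + \<delta>)) * h + 2 * h + (N * kinetic x + source x)))
        + \<psi> x * norm (U x) * (\<beta> + \<alpha> * (h - (N * kinetic x + source x) + (1 - r * \<Theta> x) * source x + (N - \<eta>) * kinetic x)))"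
        using energy_integrand[OF Nq \<epsilon>(1) \<delta> M2 R, where b = b and r = r and \<eta> = \<eta>]
        unfolding \<Theta>_def \<psi>_def \<nu>_def by blast
      let ?ind = "\<lambda>x :: real ^ 'n. indicator (cball 0 R) x :: real"
      have pw: "k / 2 * f R x - C * R powr (- 2 / \<theta>2) * ?ind x - \<epsilon> * g R x \<le> J x" for x
      proof -
        define ua where "ua = u x powr (2 - 2 * N)"
        define w where "w = norm (U x)"
        define F where "F = source x"
        define K where "K = kinetic x"
        define \<sigma> where "\<sigma> = bump R x"
        define \<Gamma> where "\<Gamma> = 4 * (real M)\<^sup>2 / R\<^sup>2 * \<sigma> ^ (M - 2)"
        define P' where "P' = \<bar>N - 2 - E\<bar>"
        have ua: "0 < ua" using u_pos[of x] by (simp add: ua_def)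
        have \<sigma>: "0 \<le> \<sigma>" "\<sigma> \<le> 1" by (auto simp: \<sigma>_def bump_nonneg bump_le_1)
        have \<psi>0: "0 \<le> \<psi> x" by (simp add: \<psi>_def)
        have FK: "0 \<le> F" "0 \<le> K" by (auto simp: F_def K_def source_nonneg kinetic_nonneg)
        have Kw: "K = w\<^sup>2 / u x" by (simp add: K_def kinetic_def w_def dot_square_norm)
        obtain h T HH \<alpha> \<beta> where J': "0 \<le> T" "h\<^sup>2 + 2 * T + (N * K + F - h)\<^sup>2 / N \<le> HH"
            "\<alpha>\<^sup>2 \<le> \<sigma> ^ M * \<Gamma>" "\<beta>\<^sup>2 \<le> \<sigma> ^ M * \<Gamma> * T"
            "J x = ua * (\<sigma> ^ M * \<psi> x * (HH - (N * K + F)\<^sup>2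
            + (2 - 2 * N) * K * (h - (N * K + F))
            + b * \<Theta> x * ((U x \<bullet> U x) / (U x \<bullet> U x + \<delta>)) * (h\<^sup>2 + T - (N * K + F) * h)
            + (1 - r * \<Theta> x) * F * ((2 - 2 * N + E) * K + b * \<Theta> x * ((U x \<bullet> U x) / (U x \<bullet> U x + \<delta>)) * h + (N * K + F) + q * h)
            - r / 2 * \<Theta> x * (1 - \<Theta> x) * ((U x \<bullet> U x) / (U x \<bullet> U x + \<delta>)) * h * F
            + (N - \<eta>) * K * ((1 - 2 * N) * K + b * \<Theta> x * ((U x \<bullet> U x) / (U x \<bullet> U x + \<delta>)) * h + 2 * h + (N * K + F)))
        + \<psi> x * w * (\<beta> + \<alpha> * (h - (N * K + F) + (1 - r * \<Theta> x) * F + (N - \<eta>) * K)))"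
          using Jx[of x] unfolding ua_def w_def F_def K_def \<sigma>_def \<Gamma>_def by blast
        have frac: "0 \<le> (U x \<bullet> U x) / (U x \<bullet> U x + \<delta>)" "(U x \<bullet> U x) / (U x \<bullet> U x + \<delta>) \<le> 1"
          using \<delta> by (auto simp: divide_le_eq add_nonneg_pos)
        have \<Gamma>0: "0 \<le> \<Gamma>" using \<sigma> by (simp add: \<Gamma>_def)
        have "ua * (\<sigma> ^ M * \<psi> x * (k * (F\<^sup>2 + K\<^sup>2)) - \<psi> x * w\<^sup>2 * \<Gamma> / k - P' * (\<sigma> ^ M * \<psi> x * (1 - \<Theta> x) * K * F)) \<le> J x"
          unfolding J'(5) P'_def
          using ua by (intro mult_left_mono low) (use w1(1-3)[of x] \<zeta> frac FK J'(1-4) \<sigma> \<psi>0 \<Gamma>0 in \<open>auto simp: w_def\<close>)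
        moreover have "ua * (\<psi> x * w\<^sup>2 * \<Gamma> / k) \<le> ua * (\<sigma> ^ M * \<psi> x * (k / 2 * (F\<^sup>2 + K\<^sup>2))) + C * R powr (- 2 / \<theta>2) * ?ind x"
        proof (cases "w = 0 \<or> norm x > R")
          case True
          have "w\<^sup>2 * \<Gamma> = 0"
          proof (cases "w = 0")
            case False
            then have "\<sigma> = 0" using True R by (auto simp: \<sigma>_def intro: bump_eq_zero)
            then show ?thesis using M by (simp add: \<Gamma>_def power_0_left)
          qed simp
          then have "ua * (\<psi> x * w\<^sup>2 * \<Gamma> / k) = 0" by (simp add: mult.assoc)
          moreover have "0 \<le> ua * (\<sigma> ^ M * \<psi> x * (k / 2 * (F\<^sup>2 + K\<^sup>2)))" using ua \<sigma> \<psi>0 k by simp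
          moreover have "0 \<le> C * R powr (- 2 / \<theta>2) * ?ind x" using C by simp
          ultimately show ?thesis by linarith
        next
          case False
          then have w0: "0 < w" and ind: "?ind x = 1" by (auto simp: w_def)
          have Fw: "F = c * u x powr E * w powr q"
            using w0 by (simp add: F_def source_def norm_powr_def w_def)
          have "w\<^sup>2 * \<Gamma> / k \<le> k / 2 * (\<sigma> ^ M * (K\<^sup>2 + F\<^sup>2)) + C * R powr (- 2 / \<theta>2) * u x powr (2 * N - 2) * w powr (- b)"
            using young[OF w0 u_pos[of x] \<sigma> R] unfolding Kw Fw \<Gamma>_def by (simp add: mult_ac)
          then have "ua * \<psi> x * (w\<^sup>2 * \<Gamma> / k) \<le> ua * \<psi> x * (k / 2 * (\<sigma> ^ M * (K\<^sup>2 + F\<^sup>2)) + C * R powr (- 2 / \<theta>2) * u x powr (2 * N - 2) * w powr (- b))"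
            using ua \<psi>0 by (intro mult_left_mono) auto
          also have "\<dots> = ua * (\<sigma> ^ M * \<psi> x * (k / 2 * (F\<^sup>2 + K\<^sup>2))) + (ua * u x powr (2 * N - 2)) * (C * R powr (- 2 / \<theta>2)) * (\<psi> x * w powr (- b))"
            by (simp add: algebra_simps)
          \<comment> \<open>The third term of Young's inequality is designed to cancel both weights;
            what remains is a constant on the ball, whose integral is a multiple of the
            volume.\<close>
          also have "ua * u x powr (2 * N - 2) = 1"
            using u_pos[of x] by (simp add: ua_def flip: powr_add)
          also have "1 * (C * R powr (- 2 / \<theta>2)) * (\<psi> x * w powr (- b)) \<le> 1 * (C * R powr (- 2 / \<theta>2)) * 1"
            using w1(5)[of x] w0 C unfolding w_def by (intro mult_left_mono) auto
          finally show ?thesis by (simp add: ind mult.assoc)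
        qed
        moreover have "k / 2 * f R x \<le> ua * (\<sigma> ^ M * \<psi> x * (k / 2 * (F\<^sup>2 + K\<^sup>2)))"
        proof -
          have "\<sigma> ^ M * ua * (k / 2) * (K\<^sup>2 * (w\<^sup>2 + 3) powr (2 * b)) \<le> \<sigma> ^ M * ua * (k / 2) * ((F\<^sup>2 + K\<^sup>2) * \<psi> x)"
            using w1(4)[of x] \<sigma> ua k unfolding w_def by (intro mult_left_mono mult_mono) auto
          then show ?thesis by (simp add: f_def \<sigma>_def ua_def K_def w_def mult_ac)
        qed
        moreover have "ua * (P' * (\<sigma> ^ M * \<psi> x * (1 - \<Theta> x) * K * F)) \<le> \<epsilon> * g R x"
        proof -
          have "\<psi> x * (1 - \<Theta> x) * w\<^sup>2 * (\<sigma> ^ M * P' * ua / u x * F) \<le> \<epsilon> * (w\<^sup>2 + 3) ^ 3 * (\<sigma> ^ M * P' * ua / u x * F)"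
            using w1(6)[of x] \<sigma> ua FK u_pos[of x] unfolding w_def
            by (intro mult_right_mono) (auto simp: P'_def)
          then show ?thesis by (simp add: g_def \<sigma>_def ua_def P'_def F_def w_def Kw mult_ac)
        qed
        ultimately show ?thesis
          by (simp add: algebra_simps)
      qed
      have cb: "integrable lborel ?ind"
        using emeasure_lborel_cball_finite[of "0 :: real ^ 'n" R] by (intro integrable_real_indicator) auto
      have "(LINT x|lborel. k / 2 * f R x - C * R powr (- 2 / \<theta>2) * ?ind x - \<epsilon> * g R x) \<le> (LINT x|lborel. J x)"
        using intf[OF R] intg[OF R] cb J(1) pw
        by (intro integral_mono Bochner_Integration.integrable_diff integrable_mult_right) auto
      also have "(LINT x|lborel. k / 2 * f R x - C * R powr (- 2 / \<theta>2) * ?ind x - \<epsilon> * g R x)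
          = k / 2 * (LINT x|lborel. f R x) - C * R powr (- 2 / \<theta>2) * (LINT x|lborel. ?ind x) - \<epsilon> * (LINT x|lborel. g R x)"
        using intf[OF R] intg[OF R] cb
        by (simp add: Bochner_Integration.integral_diff Bochner_Integration.integrable_diff integrable_mult_right)
      finally show ?thesis using J(2) by simp
    qed
    have "k / 2 * (LINT x|lborel. f R x) \<le> C * R powr (- 2 / \<theta>2) * measure lborel (cball 0 R :: (real ^ 'n) set)"
    proof (rule field_le_epsilon)
      fix e :: real assume e: "0 < e"
      define D where "D = \<bar>LINT x|lborel. g R x\<bar> + 1"
      have D: "0 < D" "(LINT x|lborel. g R x) \<le> D" by (auto simp: D_def)
      have "min 1 (e / D) * (LINT x|lborel. g R x) \<le> min 1 (e / D) * D"
        using D e by (intro mult_left_mono) auto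
      also have "\<dots> \<le> e / D * D" using D by (intro mult_right_mono) auto
      also have "\<dots> = e" using D by simp
      finally show "k / 2 * (LINT x|lborel. f R x) \<le> C * R powr (- 2 / \<theta>2) * measure lborel (cball 0 R :: (real ^ 'n) set) + e"
        using step[of "min 1 (e / D)"] D e by fastforce
    qed
    then show ?thesis using k by (simp add: field_simps)
  qed
  define R0 where "R0 = norm y + 1"
  have R0: "0 < R0" "norm y < R0" by (auto simp: R0_def add_nonneg_pos)
  define V where "V = measure lborel (cball 0 1 :: (real ^ 'n) set)"
  have vol: "measure lborel (cball 0 R :: (real ^ 'n) set) = V * R powr (N + 1)" if "0 < R" for R
    using that by (simp add: V_def content_cball DIM_cart dim(1)[symmetric] powr_realpow)
  have le: "(LINT x|lborel. f R0 x) \<le> 2 / k * C * V * R powr (N + 1 - 2 / \<theta>2)" if "R0 \<le> R" for R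
  proof -
    have R: "0 < R" using R0 that by simp
    \<comment> \<open>The cut-off increases with the radius, so the energy on a fixed ball is
      bounded by that on every larger one.\<close>
    have "(LINT x|lborel. f R0 x) \<le> (LINT x|lborel. f R x)"
    proof (rule integral_mono)
      fix x :: "real ^ 'n"
      have "(x \<bullet> x) / R\<^sup>2 \<le> (x \<bullet> x) / R0\<^sup>2"
        using that R0 by (intro divide_left_mono power_mono) auto
      then have "bump R0 x \<le> bump R x" unfolding bump_def by (intro max.mono) auto
      then show "f R0 x \<le> f R x"
        unfolding f_def by (intro mult_right_mono power_mono bump_nonneg) auto
    qed (use intf R R0 in auto)
    also have "\<dots> \<le> 2 / k * (C * R powr (- 2 / \<theta>2) * (V * R powr (N + 1)))"
      using bound[OF R] by (simp add: vol[OF R])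
    also have "\<dots> = 2 / k * C * V * R powr (N + 1 - 2 / \<theta>2)"
      using R by (simp add: powr_add powr_diff powr_minus_divide)
    finally show ?thesis .
  qed
  have neg: "N + 1 - 2 / \<theta>2 < 0" using \<theta> N by (simp add: field_simps)
  have "((\<lambda>R. 2 / k * C * V * R powr (N + 1 - 2 / \<theta>2)) \<longlongrightarrow> 2 / k * C * V * 0) at_top"
    by (intro tendsto_mult tendsto_const tendsto_neg_powr[OF neg] filterlim_ident)
  then have "(LINT x|lborel. f R0 x) \<le> 2 / k * C * V * 0"
    by (rule tendsto_lowerbound) (use le in \<open>auto simp: eventually_at_top_linorder\<close>)
  then have "f R0 y = 0"
    by (intro continuous_nonneg_integral_zero[OF cf intf[OF R0(1)] f0]) simp
  moreover have "bump R0 y > 0"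
  proof -
    have "y \<bullet> y < R0\<^sup>2" using R0 by (simp add: dot_square_norm power_strict_mono)
    then show ?thesis using R0 by (simp add: bump_def)
  qed
  moreover have "(norm (U y))\<^sup>2 + 3 > 0" by (simp add: add_nonneg_pos)
  ultimately have "kinetic y = 0" using u_pos[of y] by (simp add: f_def)
  then show ?thesis using u_pos[of y] by (simp add: kinetic_def)
qed

end

section \<open>Reduction of the theorem\<close>

lemma norm_powr_scaleR: "0 < t \<Longrightarrow> norm_powr (t *\<^sub>R z) q = t powr q * norm_powr z q"
  by (simp add: norm_powr_def powr_mult)

text \<open>Substituting v = u^(-k) and |Dv| = k v^(1/k + 1) |Du| into the term - (1/k) v^(-1/k - 1)
  Delta v of Delta u yields the constant (1/k) k^q and the exponent of u.\<close>

lemma gradient_equation_of_positive_solution: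
  fixes v :: "real ^ 'n::finite \<Rightarrow> real" and p q k :: real
  assumes sol: "positive_solution p q v" and q: "0 \<le> q" and k: "real CARD('n) = k + 2" "1 \<le> k"
  defines "s \<equiv> \<lambda>x. - 1 / k * v x powr (- 1 / k - 1)"
  shows "\<exists>H. gradient_equation (\<lambda>x. v x powr (- 1 / k)) (\<lambda>x. s x *\<^sub>R grad v x) H (k + 1)
    (1 / k * k powr q) (k + 1 - k * p - (k + 1) * q) q"
proof -
  have C2: "C1 v" "\<And>i. C1 (partial_deriv i v)" and v0: "\<And>x. 0 < v x"
    and "\<And>x. - laplacian v x = v x powr p * norm_powr (grad v x) q"
    using sol by (auto simp: positive_solution_def C2_def)
  then have eq: "laplacian v x = - (v x powr p * norm_powr (grad v x) q)" for x
    by (metis minus_minus)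
  have gv: "has_grad v (grad v)" by (rule has_grad_of_C1[OF C2(1)])
  have gp: "has_grad (partial_deriv i v) (grad (partial_deriv i v))" for i by (rule has_grad_of_C1[OF C2(2)])
  define s' where "s' = (\<lambda>x. (1 / k * (1 / k + 1) * v x powr (- 1 / k - 2)) *\<^sub>R grad v x)"
  have gs: "has_grad s s'"
    unfolding s_def s'_def
    by (rule has_grad_cong[OF has_grad_cmult[OF has_grad_powr[OF gv v0]]]) (simp add: algebra_simps)
  define H where "H = (\<lambda>x. \<chi> i. partial_deriv i v x *\<^sub>R s' x + s x *\<^sub>R grad (partial_deriv i v) x)"
  have "gradient_equation (\<lambda>x. v x powr (- 1 / k)) (\<lambda>x. s x *\<^sub>R grad v x) H (k + 1)
    (1 / k * k powr q) (k + 1 - k * p - (k + 1) * q) q"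
  proof
    show "has_grad (\<lambda>x. v x powr (- 1 / k)) (\<lambda>x. s x *\<^sub>R grad v x)"
      unfolding s_def by (rule has_grad_powr[OF gv v0])
    show "has_grad (\<lambda>x. (s x *\<^sub>R grad v x) $ i) (\<lambda>x. H x $ i)" for i
      using has_grad_mult[OF gs gp[of i]] by (simp add: H_def grad_def)
    fix x
    define g where "g = grad v x"
    define V where "V = v x"
    have V: "0 < V" using v0 by (simp add: V_def)
    have trH: "trace (H x) = g \<bullet> s' x + s x * laplacian v x"
      by (simp add: trace_def H_def sum.distrib sum_distrib_left laplacian_def g_def inner_vec_def grad_def)
    have vs: "V powr (- 1 / k - 1) = V powr (- 1 / k) / V" "V powr (- 1 / k - 2) = V powr (- 1 / k) / V\<^sup>2"
      using V by (simp_all add: powr_diff powr_numeral)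
    \<comment> \<open>\<open>s x\<close> is negative; the norm sees only its absolute value.\<close>
    have n: "norm_powr (s x *\<^sub>R g) q = (1 / k * V powr (- 1 / k - 1)) powr q * norm_powr g q"
    proof -
      have "norm_powr (s x *\<^sub>R g) q = norm_powr ((1 / k * V powr (- 1 / k - 1)) *\<^sub>R g) q"
        by (simp add: norm_powr_def s_def V_def)
      also have "\<dots> = (1 / k * V powr (- 1 / k - 1)) powr q * norm_powr g q"
        by (rule norm_powr_scaleR) (use k V in simp)
      finally show ?thesis .
    qed
    have e: "1 / k * k powr q * (V powr (- 1 / k)) powr (k + 1 - k * p - (k + 1) * q) * norm_powr (s x *\<^sub>R g) q
      = 1 / k * V powr (- 1 / k - 1) * (V powr p * norm_powr g q)"
    proof -
      have "(1 / k * V powr (- 1 / k - 1)) powr q = V powr ((- 1 / k - 1) * q) / k powr q"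
        using k V by (simp add: powr_mult powr_divide powr_powr)
      moreover have "(V powr (- 1 / k)) powr (k + 1 - k * p - (k + 1) * q) * V powr ((- 1 / k - 1) * q)
          = V powr (- 1 / k - 1) * V powr p"
      proof -
        have "- 1 / k * (k + 1 - k * p - (k + 1) * q) + (- 1 / k - 1) * q = (- 1 / k - 1) + p"
          using k by (simp add: field_simps)
        then show ?thesis by (simp only: powr_powr powr_add[symmetric])
      qed
      ultimately show ?thesis unfolding n using k by simp
    qed
    show "trace (H x) = (k + 1) * ((s x *\<^sub>R grad v x) \<bullet> (s x *\<^sub>R grad v x)) / v x powr (- 1 / k)
        + 1 / k * k powr q * (v x powr (- 1 / k)) powr (k + 1 - k * p - (k + 1) * q) * norm_powr (s x *\<^sub>R grad v x) q"
      unfolding V_def[symmetric] g_def[symmetric] e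
    proof -
      have "g \<bullet> s' x = (k + 1) * ((s x *\<^sub>R g) \<bullet> (s x *\<^sub>R g)) / V powr (- 1 / k)"
      proof -
        have "g \<bullet> s' x = (1 / k * (1 / k + 1)) * (V powr (- 1 / k) / V\<^sup>2) * (g \<bullet> g)"
          by (simp only: s'_def g_def V_def[symmetric] vs inner_scaleR_right)
        moreover have "(s x *\<^sub>R g) \<bullet> (s x *\<^sub>R g) = 1 / k\<^sup>2 * (V powr (- 1 / k))\<^sup>2 / V\<^sup>2 * (g \<bullet> g)"
          unfolding s_def V_def[symmetric] vs by (simp add: power2_eq_square mult_ac)
        moreover have "1 / k * (1 / k + 1) = (k + 1) * (1 / k\<^sup>2)" using k by (simp add: field_simps power2_eq_square)
        moreover have "V powr (- 1 / k) \<noteq> 0" using V by simp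
        ultimately show ?thesis by (simp only:) (simp add: power2_eq_square mult_ac)
      qed
      moreover have "s x * laplacian v x = 1 / k * V powr (- 1 / k - 1) * (V powr p * norm_powr g q)"
        by (simp add: s_def eq V_def g_def)
      ultimately show "trace (H x) = (k + 1) * ((s x *\<^sub>R g) \<bullet> (s x *\<^sub>R g)) / V powr (- 1 / k)
          + 1 / k * V powr (- 1 / k - 1) * (V powr p * norm_powr g q)"
        unfolding trH by simp
    qed
  qed (use k q in \<open>auto simp: less_imp_neq[OF v0, symmetric]\<close>)
  then show ?thesis by blast
qed

theorem theorem1p3:
  fixes n :: nat and p q :: real and v :: "real ^ 'n::finite \<Rightarrow> real"
  assumes "CARD('n) = n" and "n \<ge> 3"
    and "p \<ge> 0" and "p + q > 1" and "0 \<le> q" and "q \<le> 1 / (real n - 1)"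
    and "p * (real n - 2) + q * (real n - 1) < real n + (2 - q) / (1 - q)"
    and "positive_solution p q v"
  shows "\<exists>c. \<forall>x. v x = c"
proof -
  define k where "k = real n - 2"
  have k: "real CARD('n) = k + 2" "1 \<le> k" using assms(1,2) by (auto simp: k_def)
  obtain H where "gradient_equation (\<lambda>x. v x powr (- 1 / k)) (\<lambda>x. (- 1 / k * v x powr (- 1 / k - 1)) *\<^sub>R grad v x) H
      (k + 1) (1 / k * k powr q) (k + 1 - k * p - (k + 1) * q) q"
    using gradient_equation_of_positive_solution[OF assms(8,5) k] by blast
  then interpret gradient_equation "\<lambda>x. v x powr (- 1 / k)" "\<lambda>x. (- 1 / k * v x powr (- 1 / k - 1)) *\<^sub>R grad v x" H
      "k + 1" "1 / k * k powr q" "k + 1 - k * p - (k + 1) * q" q .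
  have v0: "0 < v x" for x using assms(8) by (simp add: positive_solution_def)
  have gv: "has_grad v (grad v)"
    using assms(8) by (intro has_grad_of_C1) (simp add: positive_solution_def C2_def)
  have "(- 1 / k * v y powr (- 1 / k - 1)) *\<^sub>R grad v y = 0" for y
    by (rule gradient_vanishes[of p]) (use assms in \<open>auto simp: k_def algebra_simps\<close>)
  then have "v y = 0 \<or> grad v y = 0" for y using k by simp
  then have "grad v y = 0" for y using v0 by (metis less_irrefl)
  then have "(v has_derivative (\<lambda>h. 0)) (at x within UNIV)" for x
    using has_grad_deriv[OF gv, of x] by simp
  then show ?thesis
    using has_derivative_zero_constant[OF convex_UNIV, of v] by blast
qed

end
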